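(* Let $(X,\mathcal F)$ be a transitive compact Polish foliated space, let $X_0\subset X$ be the union of the leaves without holonomy, and let $X_{0,\mathrm d}\subset X_0$ be the union of the leaves that are dense and without holonomy. Then each of the following sets is either meager or residual in $X$: (i) the union of leaves in $X_0$ with polynomial growth; (ii) the union of leaves in $X_0$ with exponential growth; (iii) the union of leaves in $X_0$ with quasi-polynomial growth; (iv) the union of leaves in $X_0$ with quasi-exponential growth; and (v) the union of leaves in $X_0$ with pseudo-quasi-polynomial growth. Moreover, (a) if the set (iii) is residual in $X$, then it contains $X_{0,\mathrm d}$; and (b) if one of the sets (iv) or (v) is meager in $X$, then it does not meet $X_{0,\mathrm d}$.
   Context: Foliated spaces. A (topological) foliated structure $\mathcal F$ of dimension $n$ on a space $X$ is given by an atlas $\{(U_i,\phi_i)\}$, where $\{U_i\}$ is an open cover of $X$ and $\phi_i:U_i\to B_i\times Z_i$ are homeomorphisms, with $B_i\subset\mathbb R^n$ an open ball and $Z_i$ a locally compact Polish space, whose changes of coordinates are locally of the form $\phi_j\phi_i^{-1}(x,z)=(x_{ij}(x,z),h_{ij}(z))$. The sets $\phi_i^{-1}(B_i\times\{z\})$ are the plaques; the leaves are the connected components of $X$ with the (leaf) topology whose basic open sets are the plaques of all foliated charts. $L_x$ is the leaf through $x$. $(X,\mathcal F)$ is a compact Polish foliated space if $X$ is compact, Hausdorff and second countable. It is transitive if some leaf is dense in $X$. Regular atlas and holonomy. A foliated atlas $\mathcal U=\{(U_i,\phi_i)\}$ is regular if: each $(U_i,\phi_i)$ is the restriction of a foliated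 chart $(\widetilde U_i,\tilde\phi_i)$ with $\overline{U_i}\subset\widetilde U_i$; $\{U_i\}$ is locally finite; and the closure of every plaque of $(U_i,\phi_i)$ meets at most the closure of one plaque of $(U_j,\phi_j)$, for all $i,j$. Let $p_i:U_i\to Z_i$ be $\phi_i$ followed by the second projection; there are homeomorphisms $h_{ij}:p_i(U_i\cap U_j)\to p_j(U_i\cap U_j)$ with $p_j=h_{ij}p_i$ on $U_i\cap U_j$, generating the holonomy pseudogroup $\mathcal H$ on $\bigsqcup_iZ_i$. The holonomy group of the leaf through $x\in U_i$ is the group of germs at $p_i(x)$ of maps in $\mathcal H$ fixing $p_i(x)$; a leaf is without holonomy if this group is trivial. Growth. Fix a regular foliated atlas $\mathcal U$. For $x,y$ in the same leaf, $d^*_{\mathcal U}(x,y)=0$ if $x=y$, and otherwise it is the minimum number of $\mathcal U$-plaques whose union is connected and contains $x$ and $y$. For $x\in X$ and $r>0$, $v_{\mathcal U}(x,r)$ is the number of $\mathcal U$-plaques that meet the ball of center $x$ and radius $r$ in $(L_x,d^*_{\mathcal U})$. Let $L$ be a leaf, $x\in L$ and $u(r)=v_{\mathcal U}(x,r)$. The growth of $L$ is: polynomial if $\limsup_{r\to\infty}\frac{\log u(r)}{\log r}<\infty$; exponential if $0<\liminf_{r\to\infty}\frac{\log u(r)}{r}<\infty$; quasi-polynomial if $\limsup_{r\to\infty}\frac{\log u(r)}{r}\le0$; quasi-exponential if $0<\limsup_{r\to\infty}\frac{\log u(r)}{r}<\infty$; pseudo-quasi-polynomial if $\liminf_{r\to\infty}\frac{\log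 u(r)}{\log r}<\infty$. These properties do not depend on the choice of $x\in L$ and $\mathcal U$. Baire category. A subset is residual if it contains a countable intersection of dense open subsets, and meager if its complement is residual. *)

theory Defs
  imports "HOL-Analysis.Analysis"
begin

section \<open>Foliated charts and atlases\<close>

text \<open>
  A chart \<open>\<phi> : U \<rightarrow> B \<times> Z\<close>. Only the values of \<open>chart_map\<close> on \<open>chart_dom\<close> matter. The leaf
  dimension is \<open>CARD('n)\<close>.
\<close>

record ('a, 'n::finite, 'z) fol_chart =
  chart_dom :: "'a set"
  chart_map :: "'a \<Rightarrow> (real^'n) \<times> 'z"
  chart_ball :: "(real^'n) set"
  chart_trans :: "'z topology"

definition Polish_topology :: "'z topology \<Rightarrow> bool" where
  "Polish_topology Z \<longleftrightarrow> completely_metrizable_space Z \<and> separable_space Z"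

definition product_chart :: "'a topology \<Rightarrow> ('a,'n::finite,'z) fol_chart \<Rightarrow> bool" where
  "product_chart X c \<longleftrightarrow>
     openin X (chart_dom c) \<and>
     (\<exists>p r. r > 0 \<and> chart_ball c = ball p r) \<and>
     locally_compact_space (chart_trans c) \<and> Polish_topology (chart_trans c) \<and>
     homeomorphic_map (subtopology X (chart_dom c))
       (prod_topology (top_of_set (chart_ball c)) (chart_trans c)) (chart_map c)"

text \<open>
  The change of coordinates from \<open>c\<close> to \<open>d\<close> is locally of the form
  \<open>(x, z) \<mapsto> (g (x, z), h z)\<close>.
\<close>

definition foliated_change ::
  "('a,'n::finite,'z) fol_chart \<Rightarrow> ('a,'n,'z) fol_chart \<Rightarrow> bool" where
  "foliated_change c d \<longleftrightarrow>
     (\<forall>q \<in> chart_map c ` (chart_dom c \<inter> chart_dom d).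
        \<exists>W. openin (prod_topology (top_of_set (chart_ball c)) (chart_trans c)) W \<and> q \<in> W \<and>
            W \<subseteq> chart_map c ` (chart_dom c \<inter> chart_dom d) \<and>
            (\<exists>g h. \<forall>(x, z) \<in> W.
               chart_map d (inv_into (chart_dom c) (chart_map c) (x, z)) = (g (x, z), h z)))"

definition foliated_atlas :: "'a topology \<Rightarrow> ('a,'n::finite,'z) fol_chart set \<Rightarrow> bool" where
  "foliated_atlas X \<A> \<longleftrightarrow>
     (\<forall>c\<in>\<A>. product_chart X c) \<and> (\<Union>c\<in>\<A>. chart_dom c) = topspace X \<and>
     (\<forall>c\<in>\<A>. \<forall>d\<in>\<A>. foliated_change c d)"

text \<open>The foliated charts of the structure determined by \<open>\<A>\<close>, i.e. its maximal atlas.\<close>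

definition foliated_charts ::
  "'a topology \<Rightarrow> ('a,'n::finite,'z) fol_chart set \<Rightarrow> ('a,'n,'z) fol_chart set" where
  "foliated_charts X \<A> =
     {c. product_chart X c \<and> (\<forall>a\<in>\<A>. foliated_change a c \<and> foliated_change c a)}"

definition compact_Polish_foliated_space ::
  "'a topology \<Rightarrow> ('a,'n::finite,'z) fol_chart set \<Rightarrow> bool" where
  "compact_Polish_foliated_space X \<A> \<longleftrightarrow>
     compact_space X \<and> Hausdorff_space X \<and> second_countable X \<and> foliated_atlas X \<A>"


section \<open>Plaques and leaves\<close>

definition chart_proj :: "('a,'n::finite,'z) fol_chart \<Rightarrow> 'a \<Rightarrow> 'z" where
  "chart_proj c x = snd (chart_map c x)"

definition plaques :: "('a,'n::finite,'z) fol_chart \<Rightarrow> 'a set set" where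
  "plaques c = (\<lambda>z. {x \<in> chart_dom c. chart_map c x \<in> chart_ball c \<times> {z}}) ` topspace (chart_trans c)"

definition atlas_plaques :: "('a,'n::finite,'z) fol_chart set \<Rightarrow> 'a set set" where
  "atlas_plaques \<U> = (\<Union>c\<in>\<U>. plaques c)"

definition leaf_topology ::
  "'a topology \<Rightarrow> ('a,'n::finite,'z) fol_chart set \<Rightarrow> 'a topology" where
  "leaf_topology X \<A> = topology_generated_by (atlas_plaques (foliated_charts X \<A>))"

definition leaves :: "'a topology \<Rightarrow> ('a,'n::finite,'z) fol_chart set \<Rightarrow> 'a set set" where
  "leaves X \<A> = connected_components_of (leaf_topology X \<A>)"

definition leaf_through ::
  "'a topology \<Rightarrow> ('a,'n::finite,'z) fol_chart set \<Rightarrow> 'a \<Rightarrow> 'a set" where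
  "leaf_through X \<A> x = connected_component_of_set (leaf_topology X \<A>) x"

definition dense_subset :: "'a topology \<Rightarrow> 'a set \<Rightarrow> bool" where
  "dense_subset X S \<longleftrightarrow> X closure_of S = topspace X"

definition transitive_foliation ::
  "'a topology \<Rightarrow> ('a,'n::finite,'z) fol_chart set \<Rightarrow> bool" where
  "transitive_foliation X \<A> \<longleftrightarrow> (\<exists>L \<in> leaves X \<A>. dense_subset X L)"


section \<open>Regular atlases\<close>

definition chart_restriction ::
  "('a,'n::finite,'z) fol_chart \<Rightarrow> ('a,'n,'z) fol_chart \<Rightarrow> bool" where
  "chart_restriction c d \<longleftrightarrow>
     chart_dom c \<subseteq> chart_dom d \<and> (\<forall>x\<in>chart_dom c. chart_map c x = chart_map d x)"

text \<open>
  Local finiteness refers to the family of charts, not to the set of their domains.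
\<close>

definition regular_atlas ::
  "'a topology \<Rightarrow> ('a,'n::finite,'z) fol_chart set \<Rightarrow> ('a,'n,'z) fol_chart set \<Rightarrow> bool" where
  "regular_atlas X \<A> \<U> \<longleftrightarrow>
     \<U> \<subseteq> foliated_charts X \<A> \<and> foliated_atlas X \<U> \<and>
     (\<forall>c\<in>\<U>. \<exists>d\<in>foliated_charts X \<A>.
        chart_restriction c d \<and> X closure_of chart_dom c \<subseteq> chart_dom d) \<and>
     (\<forall>x\<in>topspace X. \<exists>V. openin X V \<and> x \<in> V \<and> finite {c\<in>\<U>. chart_dom c \<inter> V \<noteq> {}}) \<and>
     (\<forall>c\<in>\<U>. \<forall>d\<in>\<U>. \<forall>P\<in>plaques c. \<forall>Q\<in>plaques d. \<forall>Q'\<in>plaques d.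
        X closure_of P \<inter> X closure_of Q \<noteq> {} \<and> X closure_of P \<inter> X closure_of Q' \<noteq> {}
        \<longrightarrow> Q = Q')"


section \<open>Holonomy\<close>

text \<open>
  Local transformations are represented by their graphs, so \<open>f O g\<close> is ``first \<open>f\<close>, then \<open>g\<close>''
  and \<open>f \<inter> V \<times> UNIV\<close> is the restriction of \<open>f\<close> to \<open>V\<close>. The last rule says that a
  bijection obtained by gluing members of the pseudogroup belongs to the pseudogroup.
\<close>

inductive_set generated_pseudogroup ::
  "'t topology \<Rightarrow> ('t \<times> 't) set set \<Rightarrow> ('t \<times> 't) set set"
  for T :: "'t topology" and G :: "('t \<times> 't) set set"
where
  generator: "f \<in> G \<Longrightarrow> f \<in> generated_pseudogroup T G"
| identity: "Id_on (topspace T) \<in> generated_pseudogroup T G"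
| composition: "f \<in> generated_pseudogroup T G \<Longrightarrow> g \<in> generated_pseudogroup T G \<Longrightarrow>
    f O g \<in> generated_pseudogroup T G"
| inversion: "f \<in> generated_pseudogroup T G \<Longrightarrow> f\<inverse> \<in> generated_pseudogroup T G"
| restriction: "f \<in> generated_pseudogroup T G \<Longrightarrow> openin T V \<Longrightarrow>
    f \<inter> V \<times> UNIV \<in> generated_pseudogroup T G"
| gluing: "(\<And>f. f \<in> \<C> \<Longrightarrow> f \<in> generated_pseudogroup T G) \<Longrightarrow>
    single_valued (\<Union>\<C>) \<Longrightarrow> single_valued ((\<Union>\<C>)\<inverse>) \<Longrightarrow> \<Union>\<C> \<in> generated_pseudogroup T G"

text \<open>The disjoint union of the transversals of an atlas, indexed by the charts.\<close>

definition transversal ::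
  "('a,'n::finite,'z) fol_chart set \<Rightarrow> (('a,'n,'z) fol_chart \<times> 'z) topology" where
  "transversal \<U> = sum_topology chart_trans \<U>"

text \<open>The graph of \<open>h\<^sub>i\<^sub>j\<close>, the map determined by \<open>p\<^sub>j = h\<^sub>i\<^sub>j p\<^sub>i\<close> on \<open>U\<^sub>i \<inter> U\<^sub>j\<close>.\<close>

definition transition ::
  "('a,'n::finite,'z) fol_chart \<Rightarrow> ('a,'n,'z) fol_chart \<Rightarrow>
   ((('a,'n,'z) fol_chart \<times> 'z) \<times> (('a,'n,'z) fol_chart \<times> 'z)) set" where
  "transition c d =
     (\<lambda>x. ((c, chart_proj c x), (d, chart_proj d x))) ` (chart_dom c \<inter> chart_dom d)"

definition holonomy_pseudogroup ::
  "('a,'n::finite,'z) fol_chart set \<Rightarrow>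
   ((('a,'n,'z) fol_chart \<times> 'z) \<times> (('a,'n,'z) fol_chart \<times> 'z)) set set" where
  "holonomy_pseudogroup \<U> =
     generated_pseudogroup (transversal \<U>) {transition c d | c d. c \<in> \<U> \<and> d \<in> \<U>}"

definition germ_in ::
  "'t topology \<Rightarrow> ('t \<times> 't) set set \<Rightarrow> 't \<Rightarrow> ('t \<times> 't) set \<Rightarrow> ('t \<times> 't) set set" where
  "germ_in T H q f =
     {g \<in> H. \<exists>V. openin T V \<and> q \<in> V \<and> f \<inter> V \<times> UNIV = g \<inter> V \<times> UNIV}"

text \<open>
  The underlying set of the group of germs at \<open>q\<close> of members of \<open>H\<close> fixing \<open>q\<close>; its neutral
  element is the germ of the identity.
\<close>

definition germ_group ::
  "'t topology \<Rightarrow> ('t \<times> 't) set set \<Rightarrow> 't \<Rightarrow> ('t \<times> 't) set set set" where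
  "germ_group T H q = germ_in T H q ` {f \<in> H. (q, q) \<in> f}"

definition leaf_without_holonomy :: "('a,'n::finite,'z) fol_chart set \<Rightarrow> 'a set \<Rightarrow> bool" where
  "leaf_without_holonomy \<U> L \<longleftrightarrow>
     (\<forall>x\<in>L. \<forall>c\<in>\<U>. x \<in> chart_dom c \<longrightarrow>
        germ_group (transversal \<U>) (holonomy_pseudogroup \<U>) (c, chart_proj c x) =
        {germ_in (transversal \<U>) (holonomy_pseudogroup \<U>) (c, chart_proj c x)
           (Id_on (topspace (transversal \<U>)))})"


section \<open>Growth of leaves\<close>

text \<open>
  The plaque distance is only meaningful for \<open>x\<close> and \<open>y\<close> in the same leaf, where the set of
  cardinalities is nonempty.
\<close>

definition plaque_dist ::
  "'a topology \<Rightarrow> ('a,'n::finite,'z) fol_chart set \<Rightarrow> ('a,'n,'z) fol_chart set \<Rightarrow>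
   'a \<Rightarrow> 'a \<Rightarrow> nat" where
  "plaque_dist X \<A> \<U> x y =
     (if x = y then 0
      else Inf {card \<P> | \<P>. finite \<P> \<and> \<P> \<subseteq> atlas_plaques \<U> \<and>
                           connectedin (leaf_topology X \<A>) (\<Union>\<P>) \<and> x \<in> \<Union>\<P> \<and> y \<in> \<Union>\<P>})"

definition plaque_ball ::
  "'a topology \<Rightarrow> ('a,'n::finite,'z) fol_chart set \<Rightarrow> ('a,'n,'z) fol_chart set \<Rightarrow>
   'a \<Rightarrow> real \<Rightarrow> 'a set" where
  "plaque_ball X \<A> \<U> x r = {y \<in> leaf_through X \<A> x. real (plaque_dist X \<A> \<U> x y) < r}"

definition plaque_growth ::
  "'a topology \<Rightarrow> ('a,'n::finite,'z) fol_chart set \<Rightarrow> ('a,'n,'z) fol_chart set \<Rightarrow>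
   'a \<Rightarrow> real \<Rightarrow> nat" where
  "plaque_growth X \<A> \<U> x r = card {P \<in> atlas_plaques \<U>. P \<inter> plaque_ball X \<A> \<U> x r \<noteq> {}}"

definition polynomial_growth :: "(real \<Rightarrow> nat) \<Rightarrow> bool" where
  "polynomial_growth u \<longleftrightarrow> Limsup at_top (\<lambda>r. ereal (ln (real (u r)) / ln r)) < \<infinity>"

definition exponential_growth :: "(real \<Rightarrow> nat) \<Rightarrow> bool" where
  "exponential_growth u \<longleftrightarrow>
     0 < Liminf at_top (\<lambda>r. ereal (ln (real (u r)) / r)) \<and>
     Liminf at_top (\<lambda>r. ereal (ln (real (u r)) / r)) < \<infinity>"

definition quasi_polynomial_growth :: "(real \<Rightarrow> nat) \<Rightarrow> bool" where
  "quasi_polynomial_growth u \<longleftrightarrow> Limsup at_top (\<lambda>r. ereal (ln (real (u r)) / r)) \<le> 0"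

definition quasi_exponential_growth :: "(real \<Rightarrow> nat) \<Rightarrow> bool" where
  "quasi_exponential_growth u \<longleftrightarrow>
     0 < Limsup at_top (\<lambda>r. ereal (ln (real (u r)) / r)) \<and>
     Limsup at_top (\<lambda>r. ereal (ln (real (u r)) / r)) < \<infinity>"

definition pseudo_quasi_polynomial_growth :: "(real \<Rightarrow> nat) \<Rightarrow> bool" where
  "pseudo_quasi_polynomial_growth u \<longleftrightarrow>
     Liminf at_top (\<lambda>r. ereal (ln (real (u r)) / ln r)) < \<infinity>"

text \<open>
  The union \<open>X\<^sub>0\<^sub>,\<^sub>d\<close> of the dense leaves without holonomy, and the union of the leaves in \<open>X\<^sub>0\<close>
  (that is, without holonomy) whose growth function, at each base point, has the property \<open>\<Gamma>\<close>.
\<close>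

definition dense_leaves_without_holonomy ::
  "'a topology \<Rightarrow> ('a,'n::finite,'z) fol_chart set \<Rightarrow> ('a,'n,'z) fol_chart set \<Rightarrow> 'a set" where
  "dense_leaves_without_holonomy X \<A> \<U> =
     \<Union>{L \<in> leaves X \<A>. dense_subset X L \<and> leaf_without_holonomy \<U> L}"

definition leaves_without_holonomy_with_growth ::
  "'a topology \<Rightarrow> ('a,'n::finite,'z) fol_chart set \<Rightarrow> ('a,'n,'z) fol_chart set \<Rightarrow>
   ((real \<Rightarrow> nat) \<Rightarrow> bool) \<Rightarrow> 'a set" where
  "leaves_without_holonomy_with_growth X \<A> \<U> \<Gamma> =
     \<Union>{L \<in> leaves X \<A>. leaf_without_holonomy \<U> L \<and> (\<forall>x\<in>L. \<Gamma> (plaque_growth X \<A> \<U> x))}"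


section \<open>Baire category\<close>

definition residual_in :: "'a topology \<Rightarrow> 'a set \<Rightarrow> bool" where
  "residual_in X S \<longleftrightarrow>
     (\<exists>\<G>. countable \<G> \<and> (\<forall>G\<in>\<G>. openin X G \<and> dense_subset X G) \<and> topspace X \<inter> \<Inter>\<G> \<subseteq> S)"

definition meager_in :: "'a topology \<Rightarrow> 'a set \<Rightarrow> bool" where
  "meager_in X S \<longleftrightarrow> residual_in X (topspace X - S)"

end

theory Submission
  imports Defs "HOL-Real_Asymp.Real_Asymp"
begin

text \<open>
  Let two points be related if they lie on a common plaque, and let \<open>a k x\<close> be the number of plaques
  meeting the ball of radius \<open>k\<close> around \<open>x\<close> in the plaque metric; \<open>a\<close> is lower semicontinuous in \<open>x\<close>
  because plaque chains move continuously with their base point. Every growth type is a countable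
  Boolean combination of conditions that \<open>a k x\<close> is bounded above, or below, for all \<open>k\<close> by a member of a
  sequence of functions, and these conditions define saturated sets. An upper bound
  defines a closed set, a lower bound an intersection of open sets, so by Baire category each such
  set is meager or some member of the sequence bounds \<open>a\<close> densely in an open set; the saturation of that open
  set is dense because some leaf is. The points whose leaf has holonomy form a meager set because the
  holonomy pseudogroup is locally generated by countably many words.

  A dense leaf meets every open set, so it satisfies every generic upper bound. For the lower bounds needed
  in (b) for (v), the absence of holonomy gives upper semicontinuity up to a linear change of radius: all
  plaque chains that start near \<open>x\<close> follow finitely many holonomy maps defined at \<open>x\<close>, and maps
  with the same value at \<open>x\<close> agree near \<open>x\<close>.
\<close>

section \<open>Foliated charts\<close>

text \<open>Besides compactness and a dense orbit, the category argument uses only that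
  \<open>E\<close> is symmetric and carries open sets to open sets, that \<open>a\<close> is lower
  semicontinuous and positive, and that moving the base point by \<open>d\<close> steps costs
  \<open>d\<close> in the radius. A comparison sequence must therefore survive a shift of the radius
  up to a change of its index, and this decides how each growth type is written: one upper bound for
  polynomial growth, one lower bound for exponential growth, an upper bound for every rate for
  quasi-polynomial growth. The other two types are complements of sets of this kind.

  The obstacle is the asymmetry between the bounds. An upper bound valid on a dense part of an open
  set is valid on all of it. A lower bound does not pass to limits: for each radius separately it is
  known only at points nearby. Bringing it to a given point needs a compactness of plaque chains
  that open plaques lack; chains of shorter steps have it, at the price of a factor \<open>M\<close>
  in the radius, which polynomial lower bounds tolerate.\<close>

definition plaque_at :: "('a,'n::finite,'z) fol_chart \<Rightarrow> 'z \<Rightarrow> 'a set"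
  where "plaque_at c z = {x \<in> chart_dom c. chart_proj c x = z}"

lemma compactin_point_cover:
  assumes "compactin X K" and V: "\<And>x. x \<in> K \<Longrightarrow> openin X (V x) \<and> x \<in> V x"
  obtains F where "finite F" "F \<subseteq> K" "K \<subseteq> (\<Union>x\<in>F. V x)"
proof -
  have "\<And>S. S \<in> V ` K \<Longrightarrow> openin X S" "K \<subseteq> \<Union>(V ` K)"
    using V by auto
  then obtain \<F> where \<F>: "finite \<F>" "\<F> \<subseteq> V ` K" "K \<subseteq> \<Union>\<F>"
    using compactinD[OF assms(1)] by meson
  obtain F where "F \<subseteq> K" "finite F" "\<F> = V ` F"
    using \<F>(1,2) by (meson finite_subset_image)
  then show thesis
    using that \<F>(3) by simp
qed

lemma foliated_chart_imp_product_chart: "c \<in> foliated_charts X \<A> \<Longrightarrow> product_chart X c"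
  by (simp add: foliated_charts_def)

lemma chart_dom_subset_topspace: "product_chart X c \<Longrightarrow> chart_dom c \<subseteq> topspace X"
  by (simp add: product_chart_def openin_subset)

lemma Hausdorff_chart_trans: "product_chart X c \<Longrightarrow> Hausdorff_space (chart_trans c)"
  by (simp add: product_chart_def Polish_topology_def completely_metrizable_imp_metrizable_space
      metrizable_imp_Hausdorff_space)

context
  fixes X :: "'a topology" and c :: "('a,'n::finite,'z) fol_chart"
  assumes chart: "product_chart X c"
begin

lemma open_chart_dom: "openin X (chart_dom c)"
  using chart by (simp add: product_chart_def)

lemma topspace_chart_dom: "topspace (subtopology X (chart_dom c)) = chart_dom c"
  using chart_dom_subset_topspace[OF chart] by (simp add: inf.absorb2)

lemma homeomorphic_chart_map:
  "homeomorphic_map (subtopology X (chart_dom c))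
     (prod_topology (top_of_set (chart_ball c)) (chart_trans c)) (chart_map c)"
  using chart by (simp add: product_chart_def)

lemma chart_map_image: "chart_map c ` chart_dom c = chart_ball c \<times> topspace (chart_trans c)"
  using homeomorphic_imp_surjective_map[OF homeomorphic_chart_map] topspace_chart_dom by simp

lemma inj_on_chart_map: "inj_on (chart_map c) (chart_dom c)"
  using homeomorphic_imp_injective_map[OF homeomorphic_chart_map] topspace_chart_dom by simp

lemma chart_proj_in_trans: "x \<in> chart_dom c \<Longrightarrow> chart_proj c x \<in> topspace (chart_trans c)"
  using chart_map_image unfolding chart_proj_def by (metis image_eqI mem_Sigma_iff prod.collapse)

lemma open_chart_ball: "open (chart_ball c)"
  using chart unfolding product_chart_def by (metis open_ball)

lemma chart_ball_nonempty: "chart_ball c \<noteq> {}"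
  using chart unfolding product_chart_def by (metis ball_eq_empty not_less)

lemma convex_chart_ball: "convex (chart_ball c)"
  using chart unfolding product_chart_def by (metis convex_ball)

lemma continuous_chart_proj:
  "continuous_map (subtopology X (chart_dom c)) (chart_trans c) (chart_proj c)"
  using continuous_map_compose[OF homeomorphic_imp_continuous_map[OF homeomorphic_chart_map] continuous_map_snd]
  by (simp add: chart_proj_def[abs_def] comp_def)

lemma open_chart_proj_vimage:
  assumes "openin (chart_trans c) V"
  shows "openin X {x \<in> chart_dom c. chart_proj c x \<in> V}"
proof -
  have "openin (subtopology X (chart_dom c)) {x \<in> chart_dom c. chart_proj c x \<in> V}"
    using openin_continuous_map_preimage[OF continuous_chart_proj assms]
    unfolding topspace_chart_dom .
  then show ?thesis
    using open_chart_dom openin_trans_full by blast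
qed

lemma open_chart_map_image:
  assumes "openin X A" "A \<subseteq> chart_dom c"
  shows "openin (prod_topology (top_of_set (chart_ball c)) (chart_trans c)) (chart_map c ` A)"
  using homeomorphic_imp_open_map[OF homeomorphic_chart_map] assms open_chart_dom
  by (auto simp: open_map_def openin_open_subtopology)

lemma open_chart_proj_image:
  assumes "openin X A" "A \<subseteq> chart_dom c"
  shows "openin (chart_trans c) (chart_proj c ` A)"
proof -
  have "chart_proj c ` A = snd ` (chart_map c ` A)"
    by (simp add: chart_proj_def image_image)
  then show ?thesis
    using open_map_snd open_chart_map_image[OF assms] by (metis open_map_def)
qed

lemma open_chart_map_vimage:
  assumes "openin (prod_topology (top_of_set (chart_ball c)) (chart_trans c)) W"
  shows "openin X {x \<in> chart_dom c. chart_map c x \<in> W}"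
  using openin_continuous_map_preimage[OF homeomorphic_imp_continuous_map[OF homeomorphic_chart_map] assms]
    topspace_chart_dom open_chart_dom openin_trans_full by fastforce

lemma compact_chart_proj_image:
  assumes "compactin X K" "K \<subseteq> chart_dom c"
  shows "compactin (chart_trans c) (chart_proj c ` K)"
proof -
  have "compactin (subtopology X (chart_dom c)) K"
    using assms by (simp add: compactin_subtopology)
  then show ?thesis
    using image_compactin continuous_chart_proj by metis
qed

lemma closed_chart_proj_image:
  assumes "compactin X K" "K \<subseteq> chart_dom c"
  shows "closedin (chart_trans c) (chart_proj c ` K)"
  using compactin_imp_closedin[OF Hausdorff_chart_trans[OF chart] compact_chart_proj_image[OF assms]] .

text \<open>The ball of a chart is nonempty, so each transverse coordinate is attained; in
  particular every plaque is nonempty.\<close>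

lemma plaques_eq: "plaques c = plaque_at c ` chart_proj c ` chart_dom c"
proof -
  have "chart_proj c ` chart_dom c = snd ` (chart_ball c \<times> topspace (chart_trans c))"
    unfolding chart_map_image[symmetric] chart_proj_def by (simp add: image_image)
  also have "\<dots> = topspace (chart_trans c)"
    using chart_ball_nonempty by force
  finally have "chart_proj c ` chart_dom c = topspace (chart_trans c)" .
  moreover have "{x \<in> chart_dom c. chart_map c x \<in> chart_ball c \<times> {z}} = plaque_at c z" for z
  proof -
    have "fst (chart_map c x) \<in> chart_ball c" if "x \<in> chart_dom c" for x
      using that chart_map_image by (metis image_eqI mem_Times_iff)
    then show ?thesis
      by (auto simp: plaque_at_def chart_proj_def mem_Times_iff)
  qed
  ultimately show ?thesis
    unfolding plaques_def by simp
qed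

end

lemma local_transverse_map_exists:
  assumes c: "product_chart X c" and d: "product_chart X d" and cd: "foliated_change c d"
    and x: "x \<in> chart_dom c" "x \<in> chart_dom d"
  shows "\<exists>N h. openin X N \<and> x \<in> N \<and> N \<subseteq> chart_dom c \<inter> chart_dom d \<and>
           (\<forall>p\<in>N. chart_proj d p = h (chart_proj c p))"
proof -
  obtain W g h where W: "openin (prod_topology (top_of_set (chart_ball c)) (chart_trans c)) W"
    "chart_map c x \<in> W" "W \<subseteq> chart_map c ` (chart_dom c \<inter> chart_dom d)"
    and gh: "\<forall>(b, z) \<in> W. chart_map d (inv_into (chart_dom c) (chart_map c) (b, z)) = (g (b, z), h z)"
    using bspec[OF cd[unfolded foliated_change_def], of "chart_map c x"] x by blast
  define N where "N = {p \<in> chart_dom c. chart_map c p \<in> W}"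
  have "openin X N"
    unfolding N_def using open_chart_map_vimage[OF c W(1)] .
  moreover have "x \<in> N"
    using x W by (simp add: N_def)
  moreover have "N \<subseteq> chart_dom d"
  proof
    fix p assume "p \<in> N"
    then have p: "p \<in> chart_dom c" "chart_map c p \<in> chart_map c ` (chart_dom c \<inter> chart_dom d)"
      using W(3) by (auto simp: N_def)
    then obtain p' where p': "p' \<in> chart_dom c" "p' \<in> chart_dom d" "chart_map c p = chart_map c p'"
      by blast
    then have "p = p'"
      using p(1) inj_on_chart_map[OF c] by (meson inj_onD)
    with p' show "p \<in> chart_dom d" by simp
  qed
  moreover have "chart_proj d p = h (chart_proj c p)" if "p \<in> N" for p
  proof -
    obtain b z where bz: "chart_map c p = (b, z)"
      by (cases "chart_map c p")
    have "inv_into (chart_dom c) (chart_map c) (b, z) = p"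
      using that inv_into_f_f[OF inj_on_chart_map[OF c], of p] bz by (simp add: N_def)
    then show ?thesis
      using gh that bz by (auto simp: N_def chart_proj_def)
  qed
  ultimately show ?thesis
    unfolding N_def by blast
qed

text \<open>The maximal atlas compares its charts only with those of \<open>\<A>\<close>, so two of
  its charts are compared through a chart of \<open>\<A>\<close> around \<open>x\<close>.\<close>

lemma local_transverse_map:
  assumes A: "foliated_atlas X \<A>" and c: "c \<in> foliated_charts X \<A>" and d: "d \<in> foliated_charts X \<A>"
    and x: "x \<in> chart_dom c" "x \<in> chart_dom d"
  obtains N h where "openin X N" "x \<in> N" "N \<subseteq> chart_dom c \<inter> chart_dom d"
    "\<And>p. p \<in> N \<Longrightarrow> chart_proj d p = h (chart_proj c p)"
proof -
  have pc: "product_chart X c" and pd: "product_chart X d"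
    using c d by (auto simp: foliated_charts_def)
  have "x \<in> topspace X"
    using chart_dom_subset_topspace[OF pc] x by blast
  then obtain a where a: "a \<in> \<A>" "x \<in> chart_dom a"
    using A unfolding foliated_atlas_def by blast
  have pa: "product_chart X a"
    using A a unfolding foliated_atlas_def by blast
  obtain N1 h1 where 1: "openin X N1" "x \<in> N1" "N1 \<subseteq> chart_dom c \<inter> chart_dom a"
    "\<forall>p\<in>N1. chart_proj a p = h1 (chart_proj c p)"
    using local_transverse_map_exists[OF pc pa _ x(1) a(2)] c a by (auto simp: foliated_charts_def)
  obtain N2 h2 where 2: "openin X N2" "x \<in> N2" "N2 \<subseteq> chart_dom a \<inter> chart_dom d"
    "\<forall>p\<in>N2. chart_proj d p = h2 (chart_proj a p)"
    using local_transverse_map_exists[OF pa pd _ a(2) x(2)] d a by (auto simp: foliated_charts_def)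
  show thesis
    by (rule that[of "N1 \<inter> N2" "h2 \<circ> h1"]) (use 1 2 in auto)
qed

section \<open>Zero-one laws for saturated sets\<close>

lemma residual_in_mono: "residual_in X S \<Longrightarrow> S \<subseteq> S' \<Longrightarrow> residual_in X S'"
  unfolding residual_in_def by (meson subset_trans)

lemma residual_in_Inter:
  fixes S :: "nat \<Rightarrow> 'a set"
  assumes "\<And>n. residual_in X (S n)"
  shows "residual_in X (\<Inter>n. S n)"
proof -
  obtain G where G: "\<And>n. countable (G n) \<and> (\<forall>A\<in>G n. openin X A \<and> dense_subset X A) \<and>
      topspace X \<inter> \<Inter>(G n) \<subseteq> S n"
    using assms unfolding residual_in_def by metis
  show ?thesis
    unfolding residual_in_def
  proof (intro exI conjI)
    show "countable (\<Union>n. G n)"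
      using G by simp
    show "\<forall>A\<in>\<Union>n. G n. openin X A \<and> dense_subset X A"
      using G by simp
    have "topspace X \<inter> \<Inter>(\<Union>n. G n) \<subseteq> S n" for n
    proof -
      have "topspace X \<inter> \<Inter>(\<Union>n. G n) \<subseteq> topspace X \<inter> \<Inter>(G n)"
        by auto
      then show ?thesis
        using G[of n] by (meson subset_trans)
    qed
    then show "topspace X \<inter> \<Inter>(\<Union>n. G n) \<subseteq> (\<Inter>n. S n)"
      by (rule INT_greatest)
  qed
qed

lemma residual_in_Int:
  assumes "residual_in X S" "residual_in X S'"
  shows "residual_in X (S \<inter> S')"
proof -
  obtain G H where "countable G" "\<forall>A\<in>G. openin X A \<and> dense_subset X A" "topspace X \<inter> \<Inter>G \<subseteq> S"
    "countable H" "\<forall>A\<in>H. openin X A \<and> dense_subset X A" "topspace X \<inter> \<Inter>H \<subseteq> S'"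
    using assms unfolding residual_in_def by blast
  then show ?thesis
    unfolding residual_in_def by (intro exI[of _ "G \<union> H"]) auto
qed

lemma dense_subset_iff:
  "dense_subset X S \<longleftrightarrow> (\<forall>A. openin X A \<and> A \<noteq> {} \<longrightarrow> S \<inter> A \<noteq> {})"
  unfolding dense_subset_def by (metis dense_intersects_open)

lemma residual_in_open_dense: "openin X A \<Longrightarrow> dense_subset X A \<Longrightarrow> residual_in X A"
  unfolding residual_in_def by (intro exI[of _ "{A}"]) auto

lemma meager_in_mono: "meager_in X S \<Longrightarrow> S' \<subseteq> S \<Longrightarrow> meager_in X S'"
  unfolding meager_in_def using residual_in_mono by (metis Diff_mono subset_refl)

text \<open>Otherwise the empty set would be residual, against the Baire theorem for compact
  Hausdorff spaces.\<close>

lemma not_meager_and_residual: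
  assumes "compact_space X" "Hausdorff_space X" "topspace X \<noteq> {}"
    and "meager_in X S" "residual_in X S"
  shows False
proof -
  have "residual_in X (S \<inter> (topspace X - S))"
    using residual_in_Int assms(4,5) unfolding meager_in_def by blast
  then obtain G where G: "countable G" "\<forall>A\<in>G. openin X A \<and> dense_subset X A" "topspace X \<inter> \<Inter>G = {}"
    unfolding residual_in_def by auto
  have "X closure_of \<Inter>G = topspace X"
  proof (rule Baire_category)
    show "completely_metrizable_space X \<or> locally_compact_space X \<and> regular_space X"
      using assms compact_imp_locally_compact_space compact_Hausdorff_imp_regular_space by blast
  qed (use G in \<open>auto simp: dense_subset_def\<close>)
  then show False
    using G(3) assms(3) by (metis closure_of_eq_empty_gen disjnt_def)
qed

lemma nowhere_dense_Union_meager: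
  fixes G :: "nat \<Rightarrow> 'a set"
  assumes "\<And>n A. openin X A \<Longrightarrow> A \<subseteq> X closure_of G n \<Longrightarrow> A = {}"
  shows "meager_in X (\<Union>n. G n \<inter> topspace X)"
  unfolding meager_in_def residual_in_def
proof (intro exI conjI ballI)
  let ?\<G> = "range (\<lambda>n. topspace X - X closure_of G n)"
  show "countable ?\<G>" by simp
  show "topspace X \<inter> \<Inter>?\<G> \<subseteq> topspace X - (\<Union>n. G n \<inter> topspace X)"
    using closure_of_subset_Int[of X] by fastforce
  fix A assume "A \<in> ?\<G>"
  then obtain n where n: "A = topspace X - X closure_of G n" by blast
  show "openin X A"
    unfolding n by (rule openin_diff[OF openin_topspace closedin_closure_of])
  show "dense_subset X A"
    unfolding dense_subset_iff n
  proof (intro allI impI)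
    fix B assume B: "openin X B \<and> B \<noteq> {}"
    then have "\<not> B \<subseteq> X closure_of G n"
      using assms by metis
    moreover have "B \<subseteq> topspace X"
      using B openin_subset by metis
    ultimately show "(topspace X - X closure_of G n) \<inter> B \<noteq> {}"
      by blast
  qed
qed

text \<open>Abstract form of the leaf equivalence relation: \<open>E ^^ d\<close> consists of the
  pairs joined by exactly \<open>d\<close> steps, and the classes of \<open>E\<^sup>*\<close> are
  the leaves.\<close>

locale open_relation =
  fixes X :: "'a topology" and E :: "('a \<times> 'a) set"
  assumes symE: "sym E" and E_subset: "E \<subseteq> topspace X \<times> topspace X"
    and open_Image: "openin X A \<Longrightarrow> openin X (E `` A)"
begin

lemma sym_relpow: "(x, y) \<in> E ^^ d \<Longrightarrow> (y, x) \<in> E ^^ d"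
proof (induction d arbitrary: y)
  case (Suc d)
  then obtain z where "(x, z) \<in> E ^^ d" "(z, y) \<in> E" by auto
  then show ?case
    using Suc.IH symE by (meson relpow_Suc_I2 symD)
qed auto

lemma sym_orbit: "(x, y) \<in> E\<^sup>* \<Longrightarrow> (y, x) \<in> E\<^sup>*"
  using sym_relpow by (meson relpow_imp_rtrancl rtrancl_imp_relpow)

lemma orbit_in_topspace: "(x, y) \<in> E\<^sup>* \<Longrightarrow> x \<in> topspace X \<Longrightarrow> y \<in> topspace X"
  by (induction rule: rtrancl_induct) (use E_subset in auto)

lemma relpow_in_topspace: "x \<in> topspace X \<Longrightarrow> (x, y) \<in> E ^^ k \<Longrightarrow> y \<in> topspace X"
  using orbit_in_topspace relpow_imp_rtrancl by metis

lemma open_relpow_Image: "openin X A \<Longrightarrow> openin X ((E ^^ d) `` A)"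
proof (induction d)
  case (Suc d)
  have "(E ^^ Suc d) `` A = E `` ((E ^^ d) `` A)"
    by auto
  then show ?case
    using Suc open_Image by metis
qed simp

lemma open_saturation:
  assumes "openin X A"
  shows "openin X (E\<^sup>* `` A)"
proof -
  have "E\<^sup>* `` A = (\<Union>d. (E ^^ d) `` A)"
    by (auto simp: rtrancl_is_UN_relpow)
  then show ?thesis
    using open_relpow_Image assms by (auto intro: openin_Union)
qed

end

text \<open>
  In the application \<open>E\<close> relates the points with a common plaque, and \<open>a k x\<close> is the number
  of plaques meeting the ball of radius \<open>k\<close> around \<open>x\<close>.
\<close>

locale growth_system = open_relation X E
  for X :: "'a topology" and E :: "('a \<times> 'a) set" +
  fixes a :: "nat \<Rightarrow> 'a \<Rightarrow> nat"
  assumes compact: "compact_space X" and Hausdorff: "Hausdorff_space X"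
    and dense_orbit: "\<exists>x\<in>topspace X. dense_subset X (E\<^sup>* `` {x})"
    and lsc: "openin X {y \<in> topspace X. m \<le> a k y}"
    and shift: "x \<in> topspace X \<Longrightarrow> (x, y) \<in> E ^^ d \<Longrightarrow> a k y \<le> a (k + d) x"
    and a_pos: "x \<in> topspace X \<Longrightarrow> 1 \<le> a k x"
begin

lemma not_meager_residual: "meager_in X S \<Longrightarrow> \<not> residual_in X S"
  using not_meager_and_residual[OF compact Hausdorff] dense_orbit by blast

text \<open>A dense orbit meets both \<open>A\<close> and any other nonempty open set, so it leads
  from one to the other.\<close>

lemma dense_saturation:
  assumes "openin X A" "A \<noteq> {}"
  shows "dense_subset X (E\<^sup>* `` A)"
  unfolding dense_subset_iff
proof (intro allI impI)
  fix B assume B: "openin X B \<and> B \<noteq> {}"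
  obtain x where x: "dense_subset X (E\<^sup>* `` {x})"
    using dense_orbit by blast
  have "E\<^sup>* `` {x} \<inter> A \<noteq> {}" "E\<^sup>* `` {x} \<inter> B \<noteq> {}"
    using x B assms unfolding dense_subset_iff by metis+
  then obtain y z where "(x, y) \<in> E\<^sup>*" "y \<in> A" "(x, z) \<in> E\<^sup>*" "z \<in> B"
    by auto
  then show "E\<^sup>* `` A \<inter> B \<noteq> {}"
    using sym_orbit rtrancl_trans by (metis IntI Image_iff empty_iff)
qed

text \<open>In the uses below the index \<open>n\<close> supplies the multiplicative constant, and
  in two families also the degree or the rate. A single quantifier over \<open>nat\<close> keeps the
  union countable.\<close>

definition upper_set :: "(nat \<Rightarrow> nat \<Rightarrow> real) \<Rightarrow> 'a set" where
  "upper_set \<theta> = {x \<in> topspace X. \<exists>n. \<forall>k. real (a k x) \<le> \<theta> n k}"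

definition lower_set :: "(nat \<Rightarrow> nat \<Rightarrow> real) \<Rightarrow> 'a set" where
  "lower_set \<theta> = {x \<in> topspace X. \<exists>n. \<forall>k. \<theta> n k \<le> real (a k x)}"

lemma open_lower: "openin X {y \<in> topspace X. t \<le> real (a k y)}"
proof -
  have "{y \<in> topspace X. t \<le> real (a k y)} = {y \<in> topspace X. nat \<lceil>t\<rceil> \<le> a k y}"
    by (auto simp: ceiling_le_iff nat_le_iff)
  then show ?thesis
    using lsc[of "nat \<lceil>t\<rceil>" k] by simp
qed

lemma closed_upper: "closedin X {y \<in> topspace X. \<forall>k. real (a k y) \<le> t k}"
proof -
  have *: "closedin X {y \<in> topspace X. real (a k y) \<le> t k}" for k
  proof -
    \<comment> \<open>For negative \<open>t k\<close> this threshold is 0, and both sides of the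
      next equation are empty.\<close>
    have "openin X {y \<in> topspace X. nat (\<lfloor>t k\<rfloor> + 1) \<le> a k y}"
      using lsc .
    moreover have "{y \<in> topspace X. real (a k y) \<le> t k} =
        topspace X - {y \<in> topspace X. nat (\<lfloor>t k\<rfloor> + 1) \<le> a k y}"
      by (auto simp: nat_le_iff) linarith+
    ultimately show ?thesis
      using closedin_diff[OF closedin_topspace] by simp
  qed
  have "{y \<in> topspace X. \<forall>k. real (a k y) \<le> t k} = (\<Inter>k. {y \<in> topspace X. real (a k y) \<le> t k})"
    by auto
  also have "closedin X \<dots>"
    using * by (intro closedin_Inter) auto
  finally show ?thesis .
qed

lemma upper_set_saturated:
  assumes \<theta>: "\<And>n d. \<exists>n'. \<forall>k. \<theta> n (k + d) \<le> \<theta> n' k"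
    and "x \<in> upper_set \<theta>" "(x, y) \<in> E\<^sup>*"
  shows "y \<in> upper_set \<theta>"
proof -
  obtain n where n: "\<And>k. real (a k x) \<le> \<theta> n k" and x: "x \<in> topspace X"
    using assms(2) by (auto simp: upper_set_def)
  obtain d where d: "(x, y) \<in> E ^^ d"
    using assms(3) by (meson rtrancl_imp_relpow)
  obtain n' where n': "\<And>k. \<theta> n (k + d) \<le> \<theta> n' k"
    using \<theta> by blast
  have "real (a k y) \<le> \<theta> n' k" for k
    using shift[OF x d, of k] n[of "k + d"] n'[of k] by linarith
  then show ?thesis
    using orbit_in_topspace[OF assms(3) x] by (auto simp: upper_set_def)
qed

text \<open>The sets \<open>F n\<close> are closed, so one that is dense in an open set
  \<open>A\<close> contains \<open>A\<close>. Then the whole saturation of \<open>A\<close>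
  satisfies the bound; it is open and dense, and every dense orbit lies in it.\<close>

lemma upper_set_dichotomy:
  assumes \<theta>: "\<And>n d. \<exists>n'. \<forall>k. \<theta> n (k + d) \<le> \<theta> n' k"
  shows "meager_in X (upper_set \<theta>) \<or>
    residual_in X (upper_set \<theta>) \<and>
    (\<forall>x. x \<in> topspace X \<and> dense_subset X (E\<^sup>* `` {x}) \<longrightarrow> x \<in> upper_set \<theta>)"
proof -
  define F where "F n = {y \<in> topspace X. \<forall>k. real (a k y) \<le> \<theta> n k}" for n
  have F: "upper_set \<theta> = (\<Union>n. F n \<inter> topspace X)" "\<And>n. X closure_of F n = F n"
    using closed_upper by (auto simp: upper_set_def F_def closure_of_closedin)
  show ?thesis
  proof (cases "\<exists>n A. openin X A \<and> A \<subseteq> X closure_of F n \<and> A \<noteq> {}")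
    case True
    then obtain n A where A: "openin X A" "A \<subseteq> F n" "A \<noteq> {}"
      using F by blast
    have A_upper: "A \<subseteq> upper_set \<theta>"
      using A F(1) openin_subset by fastforce
    then have sat: "E\<^sup>* `` A \<subseteq> upper_set \<theta>"
      using upper_set_saturated[OF \<theta>] by blast
    have "residual_in X (upper_set \<theta>)"
      using residual_in_mono[OF residual_in_open_dense sat] open_saturation[OF A(1)]
        dense_saturation[OF A(1,3)] by metis
    moreover have "x \<in> upper_set \<theta>" if "dense_subset X (E\<^sup>* `` {x})" for x
    proof -
      have "E\<^sup>* `` {x} \<inter> A \<noteq> {}"
        using that A unfolding dense_subset_iff by metis
      then obtain y where "(x, y) \<in> E\<^sup>*" "y \<in> A"
        by auto
      then show ?thesis
        using sat sym_orbit[of x y] by auto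
    qed
    ultimately show ?thesis by simp
  next
    case False
    then show ?thesis
      using nowhere_dense_Union_meager[of X F] F(1) by auto
  qed
qed

text \<open>A bound at the radii \<open>k + d\<close> gives no information on radii below
  \<open>d\<close>. There only \<open>a_pos\<close> is available, and this is the reason for the
  clause \<open>\<theta> n' j \<le> 1\<close>.\<close>

lemma in_lower_set_if_shift:
  assumes \<theta>: "\<And>n d. \<exists>n'. (\<forall>k. \<theta> n' (k + d) \<le> \<theta> n k) \<and> (\<forall>j<d. \<theta> n' j \<le> 1)"
    and x: "x \<in> topspace X" and le: "\<And>k. \<theta> n k \<le> real (a (k + d) x)"
  shows "x \<in> lower_set \<theta>"
proof -
  obtain n' where n': "\<And>k. \<theta> n' (k + d) \<le> \<theta> n k" "\<And>j. j < d \<Longrightarrow> \<theta> n' j \<le> 1"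
    using \<theta> by blast
  have "\<theta> n' k \<le> real (a k x)" for k
  proof (cases "k < d")
    case True
    then show ?thesis
      using n'(2) a_pos[OF x, of k] by fastforce
  next
    case False
    then show ?thesis
      using n'(1)[of "k - d"] le[of "k - d"] by simp
  qed
  then show ?thesis
    using x by (auto simp: lower_set_def)
qed

lemma lower_set_saturated:
  assumes \<theta>: "\<And>n d. \<exists>n'. (\<forall>k. \<theta> n' (k + d) \<le> \<theta> n k) \<and> (\<forall>j<d. \<theta> n' j \<le> 1)"
    and "x \<in> lower_set \<theta>" "(x, y) \<in> E\<^sup>*"
  shows "y \<in> lower_set \<theta>"
proof -
  obtain n where n: "\<And>k. \<theta> n k \<le> real (a k x)" and x: "x \<in> topspace X"
    using assms(2) by (auto simp: lower_set_def)
  have y: "y \<in> topspace X"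
    using orbit_in_topspace[OF assms(3) x] .
  obtain d where d: "(y, x) \<in> E ^^ d"
    using assms(3) sym_relpow by (meson rtrancl_imp_relpow)
  have "\<theta> n k \<le> real (a (k + d) y)" for k
    using shift[OF y d, of k] n[of k] by linarith
  then show ?thesis
    by (rule in_lower_set_if_shift[OF \<theta> y])
qed

text \<open>The sets \<open>G n\<close> are only intersections of open sets, so density in
  \<open>A\<close> does not give containment. For fixed \<open>d\<close> and \<open>k\<close>,
  however, the bound with radius enlarged by \<open>d\<close> defines an open set that is dense in
  the \<open>d\<close>-step neighbourhood of \<open>A\<close>, and countably many such sets are
  intersected. About an individual point of \<open>A\<close> only the last clause remains, where the
  nearby point \<open>y\<close> may depend on \<open>k\<close>.\<close>

lemma lower_set_dichotomy:
  assumes \<theta>: "\<And>n d. \<exists>n'. (\<forall>k. \<theta> n' (k + d) \<le> \<theta> n k) \<and> (\<forall>j<d. \<theta> n' j \<le> 1)"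
  shows "meager_in X (lower_set \<theta>) \<or>
    residual_in X (lower_set \<theta>) \<and>
    (\<exists>n A. openin X A \<and> A \<noteq> {} \<and>
       (\<forall>k V. openin X V \<and> V \<inter> A \<noteq> {} \<longrightarrow> (\<exists>y\<in>V. \<theta> n k \<le> real (a k y))))"
proof -
  define G where "G n = {y \<in> topspace X. \<forall>k. \<theta> n k \<le> real (a k y)}" for n
  have G: "lower_set \<theta> = (\<Union>n. G n \<inter> topspace X)"
    by (auto simp: lower_set_def G_def)
  show ?thesis
  proof (cases "\<exists>n A. openin X A \<and> A \<subseteq> X closure_of G n \<and> A \<noteq> {}")
    case False
    then show ?thesis
      using nowhere_dense_Union_meager[of X G] G by auto
  next
    case True
    then obtain n A where A: "openin X A" "A \<subseteq> X closure_of G n" "A \<noteq> {}"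
      by blast
    have meets: "\<exists>y\<in>V. \<forall>k. \<theta> n k \<le> real (a k y)" if "openin X V" "V \<inter> A \<noteq> {}" for V
    proof -
      have "V \<inter> X closure_of G n \<noteq> {}"
        using that A by blast
      then have "V \<inter> G n \<noteq> {}"
        using openin_Int_closure_of_eq_empty[OF that(1)] by blast
      then show ?thesis
        by (auto simp: G_def)
    qed
    define B where "B d = (E ^^ d) `` A" for d
    have B: "openin X (B d)" for d
      unfolding B_def using open_relpow_Image A(1) .
    \<comment> \<open>Adding the exterior of \<open>B d\<close> makes the set dense in all of
      \<open>X\<close> and changes nothing on \<open>B d\<close>.\<close>
    define W where "W d k = {y \<in> topspace X. \<theta> n k \<le> real (a (k + d) y)} \<union>
        (topspace X - X closure_of B d)" for d k
    have W_open: "openin X (W d k)" for d k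
      unfolding W_def using open_lower by (intro openin_Un) auto
    have W_dense: "dense_subset X (W d k)" for d k
      unfolding dense_subset_iff
    proof (intro allI impI)
      fix V assume V: "openin X V \<and> V \<noteq> {}"
      show "W d k \<inter> V \<noteq> {}"
      proof (cases "V \<inter> B d = {}")
        case True
        then have "V \<inter> X closure_of B d = {}"
          using openin_Int_closure_of_eq_empty V by blast
        then show ?thesis
          using V openin_subset unfolding W_def by blast
      next
        case False
        then obtain v where v: "v \<in> V" "v \<in> B d" by blast
        then obtain u where "u \<in> A" "(v, u) \<in> E ^^ d"
          using sym_relpow unfolding B_def by blast
        \<comment> \<open>The density hypothesis is applied to the open set reached from
          \<open>V\<close> in \<open>d\<close> steps; returning to \<open>V\<close> costs
          \<open>d\<close> in the radius.\<close>
        then have "((E ^^ d) `` V) \<inter> A \<noteq> {}"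
          using v by blast
        then obtain y where y: "y \<in> (E ^^ d) `` V" "\<theta> n k \<le> real (a k y)"
          using meets[of "(E ^^ d) `` V"] open_relpow_Image V by blast
        then obtain w where w: "w \<in> V" "(w, y) \<in> E ^^ d" by blast
        then have wX: "w \<in> topspace X"
          using V openin_subset by blast
        then have "w \<in> W d k"
          using shift[OF wX w(2), of k] y(2) unfolding W_def by auto
        then show ?thesis
          using w by blast
      qed
    qed
    have in_lower: "x \<in> lower_set \<theta>" if x: "x \<in> E\<^sup>* `` A" "x \<in> topspace X" "\<And>d k. x \<in> W d k" for x
    proof -
      obtain d where d: "x \<in> B d"
        using x(1) unfolding B_def by (meson Image_iff rtrancl_imp_relpow)
      then have "x \<in> X closure_of B d"
        using closure_of_subset[OF openin_subset[OF B]] by blast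
      then have *: "\<theta> n k \<le> real (a (k + d) x)" for k
        using x(3)[of d k] unfolding W_def by auto
      show ?thesis
        by (rule in_lower_set_if_shift[OF \<theta> x(2) *])
    qed
    have "residual_in X (lower_set \<theta>)"
      unfolding residual_in_def
    proof (intro exI conjI)
      let ?\<G> = "insert (E\<^sup>* `` A) (range (\<lambda>(d, k). W d k))"
      show "countable ?\<G>" by simp
      show "\<forall>G\<in>?\<G>. openin X G \<and> dense_subset X G"
        using W_open W_dense open_saturation dense_saturation A by auto
      show "topspace X \<inter> \<Inter>?\<G> \<subseteq> lower_set \<theta>"
        using in_lower by auto
    qed
    moreover have "\<exists>y\<in>V. \<theta> n k \<le> real (a k y)" if "openin X V \<and> V \<inter> A \<noteq> {}" for k V
      using meets that by blast
    ultimately show ?thesis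
      using A(1,3) by blast
  qed
qed

end

section \<open>Plaque chains and the leaf topology\<close>

locale regular_foliation =
  fixes X :: "'a topology" and \<A> \<U> :: "('a,'n::finite,'z) fol_chart set"
  assumes foliated_space: "compact_Polish_foliated_space X \<A>"
    and regular: "regular_atlas X \<A> \<U>"
begin

lemma compact_X: "compact_space X" and Hausdorff_X: "Hausdorff_space X"
  and atlas: "foliated_atlas X \<A>"
  using foliated_space by (auto simp: compact_Polish_foliated_space_def)

lemma foliated_chart: "c \<in> \<U> \<Longrightarrow> c \<in> foliated_charts X \<A>"
  using regular by (auto simp: regular_atlas_def)

lemma chart: "c \<in> \<U> \<Longrightarrow> product_chart X c"
  by (rule foliated_chart_imp_product_chart[OF foliated_chart])

lemma dom_in_topspace: "c \<in> \<U> \<Longrightarrow> x \<in> chart_dom c \<Longrightarrow> x \<in> topspace X"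
  using chart chart_dom_subset_topspace by blast

lemma chart_at:
  assumes "x \<in> topspace X"
  obtains c where "c \<in> \<U>" "x \<in> chart_dom c"
proof -
  have "(\<Union>c\<in>\<U>. chart_dom c) = topspace X"
    using regular by (simp add: regular_atlas_def foliated_atlas_def)
  then show thesis
    using assms that by blast
qed

lemma enlarged_chart:
  assumes "c \<in> \<U>"
  obtains d where "d \<in> foliated_charts X \<A>" "chart_restriction c d" "X closure_of chart_dom c \<subseteq> chart_dom d"
proof -
  have "\<forall>c\<in>\<U>. \<exists>d\<in>foliated_charts X \<A>. chart_restriction c d \<and> X closure_of chart_dom c \<subseteq> chart_dom d"
    using regular unfolding regular_atlas_def by simp
  then show thesis
    using assms that by metis
qed

text \<open>
  Local finiteness bounds only the number of charts with nonempty domain.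
\<close>

definition charts :: "('a,'n,'z) fol_chart set" where
  "charts = {c \<in> \<U>. chart_dom c \<noteq> {}}"

lemma finite_charts: "finite charts"
proof -
  have "\<forall>x\<in>topspace X. \<exists>V. openin X V \<and> x \<in> V \<and> finite {c\<in>\<U>. chart_dom c \<inter> V \<noteq> {}}"
    using regular unfolding regular_atlas_def by simp
  then obtain V where V: "\<And>x. x \<in> topspace X \<Longrightarrow>
      openin X (V x) \<and> x \<in> V x \<and> finite {c\<in>\<U>. chart_dom c \<inter> V x \<noteq> {}}"
    using bchoice[of "topspace X" "\<lambda>x V. openin X V \<and> x \<in> V \<and> finite {c\<in>\<U>. chart_dom c \<inter> V \<noteq> {}}"]
    by blast
  have "compactin X (topspace X)"
    using compact_X by (simp add: compact_space_def)
  then obtain F where F: "finite F" "F \<subseteq> topspace X" "topspace X \<subseteq> (\<Union>x\<in>F. V x)"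
    by (rule compactin_point_cover[where V = V]) (use V in auto)
  have "charts \<subseteq> (\<Union>x\<in>F. {c\<in>\<U>. chart_dom c \<inter> V x \<noteq> {}})"
  proof
    fix c assume "c \<in> charts"
    then obtain y where y: "c \<in> \<U>" "y \<in> chart_dom c"
      by (auto simp: charts_def)
    then have "y \<in> (\<Union>x\<in>F. V x)"
      using F(3) dom_in_topspace by blast
    then show "c \<in> (\<Union>x\<in>F. {c\<in>\<U>. chart_dom c \<inter> V x \<noteq> {}})"
      using y F by auto
  qed
  moreover have "finite (\<Union>x\<in>F. {c\<in>\<U>. chart_dom c \<inter> V x \<noteq> {}})"
    using F V by blast
  ultimately show ?thesis
    by (rule finite_subset)
qed

text \<open>This is the regularity condition for the plaque of \<open>c\<close> through both points.
  It makes the transverse change of coordinates a function on the whole overlap, whereas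
  \<open>foliated_change\<close> gives one only locally.\<close>

lemma chart_transition_unique:
  assumes c: "c \<in> \<U>" "d \<in> \<U>" and x: "x \<in> chart_dom c" "x \<in> chart_dom d"
    and y: "y \<in> chart_dom c" "y \<in> chart_dom d" and eq: "chart_proj c x = chart_proj c y"
  shows "chart_proj d x = chart_proj d y"
proof -
  let ?P = "plaque_at c (chart_proj c x)" and ?Q = "plaque_at d (chart_proj d x)"
    and ?Q' = "plaque_at d (chart_proj d y)"
  have sub: "plaque_at e z \<subseteq> X closure_of plaque_at e z" if "e \<in> \<U>" for e z
    using that dom_in_topspace by (intro closure_of_subset) (auto simp: plaque_at_def)
  have mem: "x \<in> ?P" "x \<in> ?Q" "y \<in> ?P" "y \<in> ?Q'"
    using x y eq by (auto simp: plaque_at_def)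
  have plq: "?P \<in> plaques c" "?Q \<in> plaques d" "?Q' \<in> plaques d"
    using plaques_eq[OF chart] c x y by auto
  have "X closure_of ?P \<inter> X closure_of ?Q \<noteq> {}" "X closure_of ?P \<inter> X closure_of ?Q' \<noteq> {}"
    using sub[OF c(1)] sub[OF c(2)] mem by blast+
  moreover have "\<forall>c\<in>\<U>. \<forall>d\<in>\<U>. \<forall>P\<in>plaques c. \<forall>Q\<in>plaques d. \<forall>Q'\<in>plaques d.
        X closure_of P \<inter> X closure_of Q \<noteq> {} \<and> X closure_of P \<inter> X closure_of Q' \<noteq> {}
        \<longrightarrow> Q = Q'"
    using regular unfolding regular_atlas_def by simp
  ultimately have "?Q = ?Q'"
    using c plq by blast
  then show ?thesis
    using mem by (auto simp: plaque_at_def)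
qed

definition plaque_rel :: "('a \<times> 'a) set" ("E") where
  "E = {(x, y). \<exists>c\<in>\<U>. x \<in> chart_dom c \<and> y \<in> chart_dom c \<and> chart_proj c x = chart_proj c y}"

lemma plaque_relI:
  "c \<in> \<U> \<Longrightarrow> x \<in> chart_dom c \<Longrightarrow> y \<in> chart_dom c \<Longrightarrow> chart_proj c x = chart_proj c y \<Longrightarrow> (x, y) \<in> E"
  by (auto simp: plaque_rel_def)

lemma plaque_relE:
  assumes "(x, y) \<in> E"
  obtains c where "c \<in> \<U>" "x \<in> chart_dom c" "y \<in> chart_dom c" "chart_proj c x = chart_proj c y"
  using assms by (auto simp: plaque_rel_def)

lemma sym_plaque_rel: "sym E"
  by (auto simp: sym_def plaque_rel_def)

lemma plaque_rel_subset: "E \<subseteq> topspace X \<times> topspace X"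
  using dom_in_topspace by (auto simp: plaque_rel_def)

lemma plaque_rel_refl: "x \<in> topspace X \<Longrightarrow> (x, x) \<in> E"
  using chart_at plaque_relI by metis

text \<open>Inside one chart the union of the plaques meeting \<open>A\<close> is the preimage of
  the projection of \<open>A\<close>, and chart projections are continuous and open.\<close>

lemma open_plaque_rel_Image:
  assumes "openin X A"
  shows "openin X (E `` A)"
proof -
  have eq: "E `` A = (\<Union>c\<in>\<U>. {y \<in> chart_dom c. chart_proj c y \<in> chart_proj c ` (A \<inter> chart_dom c)})"
  proof (intro set_eqI iffI)
    fix y assume "y \<in> E `` A"
    then obtain x c where "x \<in> A" "c \<in> \<U>" "x \<in> chart_dom c" "y \<in> chart_dom c"
      "chart_proj c x = chart_proj c y"
      by (auto elim: plaque_relE)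
    then show "y \<in> (\<Union>c\<in>\<U>. {y \<in> chart_dom c. chart_proj c y \<in> chart_proj c ` (A \<inter> chart_dom c)})"
      by (auto intro!: bexI[of _ c] image_eqI[of _ _ x])
  next
    fix y assume "y \<in> (\<Union>c\<in>\<U>. {y \<in> chart_dom c. chart_proj c y \<in> chart_proj c ` (A \<inter> chart_dom c)})"
    then obtain x c where "x \<in> A" "c \<in> \<U>" "x \<in> chart_dom c" "y \<in> chart_dom c"
      "chart_proj c x = chart_proj c y"
      by auto
    then show "y \<in> E `` A"
      by (auto intro: plaque_relI)
  qed
  have "openin X {y \<in> chart_dom c. chart_proj c y \<in> chart_proj c ` (A \<inter> chart_dom c)}" if "c \<in> \<U>" for c
    by (intro open_chart_proj_vimage[OF chart[OF that]] open_chart_proj_image[OF chart[OF that]]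
        openin_Int assms open_chart_dom[OF chart[OF that]]) simp
  then show ?thesis
    unfolding eq by (intro openin_Union) auto
qed

sublocale open_relation X E
  using sym_plaque_rel plaque_rel_subset open_plaque_rel_Image by unfold_locales

text \<open>Chains can be padded with trivial steps, since the charts cover the space and
  \<open>E\<close> is therefore reflexive on it.\<close>

lemma relpow_mono:
  assumes "x \<in> topspace X" "(x, y) \<in> E ^^ j" "j \<le> k"
  shows "(x, y) \<in> E ^^ k"
proof -
  have "(x, y) \<in> E ^^ (j + i)" for i
  proof (induction i)
    case (Suc i)
    then show ?case
      using plaque_rel_refl relpow_in_topspace[OF assms(1)] by auto
  qed (use assms in simp)
  then show ?thesis
    using assms(3) by (metis le_iff_add)
qed

abbreviation "leaf_top \<equiv> leaf_topology X \<A>"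

lemma openin_leaf_plaque_at:
  assumes "c \<in> foliated_charts X \<A>"
  shows "openin leaf_top (plaque_at c z)"
proof (cases "z \<in> chart_proj c ` chart_dom c")
  case True
  then have "plaque_at c z \<in> atlas_plaques (foliated_charts X \<A>)"
    using assms plaques_eq[OF foliated_chart_imp_product_chart[OF assms]]
    unfolding atlas_plaques_def by blast
  then show ?thesis
    unfolding leaf_topology_def by (rule topology_generated_by_Basis)
next
  case False
  then have "plaque_at c z = {}"
    by (auto simp: plaque_at_def)
  then show ?thesis by simp
qed

lemma topspace_leaf_top: "topspace leaf_top = topspace X"
proof
  show "topspace leaf_top \<subseteq> topspace X"
    using plaques_eq chart_dom_subset_topspace foliated_chart_imp_product_chart
    by (fastforce simp: leaf_topology_def atlas_plaques_def plaque_at_def)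
  show "topspace X \<subseteq> topspace leaf_top"
  proof
    fix x assume "x \<in> topspace X"
    then obtain c where c: "c \<in> \<U>" "x \<in> chart_dom c"
      by (rule chart_at)
    then have "x \<in> plaque_at c (chart_proj c x)"
      by (simp add: plaque_at_def)
    then show "x \<in> topspace leaf_top"
      using openin_subset[OF openin_leaf_plaque_at[OF foliated_chart[OF c(1)]]] by blast
  qed
qed

text \<open>The plaque is parametrized by a ball. Continuity into the leaf topology is tested on the
  generating plaques, where it holds because along a plaque of \<open>c\<close> the transverse
  coordinate of any other foliated chart is locally constant.\<close>

lemma connectedin_plaque_at:
  assumes c: "c \<in> \<U>"
  shows "connectedin leaf_top (plaque_at c z)"
proof (cases "z \<in> topspace (chart_trans c)")
  case False
  then have "plaque_at c z = {}"
    using chart_proj_in_trans[OF chart[OF c]] by (auto simp: plaque_at_def)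
  then show ?thesis by simp
next
  case True
  note pc = chart[OF c]
  define g where "g b = inv_into (chart_dom c) (chart_map c) (b, z)" for b
  have g: "g b \<in> chart_dom c" "chart_map c (g b) = (b, z)" if "b \<in> chart_ball c" for b
    using that True chart_map_image[OF pc] unfolding g_def
    by (simp_all add: inv_into_into f_inv_into_f)
  have g_eq: "g b = p" if "p \<in> chart_dom c" "chart_map c p = (b, z)" for b p
    using inv_into_f_f[OF inj_on_chart_map[OF pc] that(1)] that(2) by (simp add: g_def)
  have img: "plaque_at c z = g ` chart_ball c"
  proof
    show "g ` chart_ball c \<subseteq> plaque_at c z"
      using g by (auto simp: plaque_at_def chart_proj_def)
    show "plaque_at c z \<subseteq> g ` chart_ball c"
    proof
      fix p assume "p \<in> plaque_at c z"
      then have p: "p \<in> chart_dom c" "snd (chart_map c p) = z"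
        by (auto simp: plaque_at_def chart_proj_def)
      then have "chart_map c p \<in> chart_ball c \<times> topspace (chart_trans c)"
        using chart_map_image[OF pc] by blast
      then have "fst (chart_map c p) \<in> chart_ball c" "chart_map c p = (fst (chart_map c p), z)"
        using p(2) by auto
      then show "p \<in> g ` chart_ball c"
        using g_eq[OF p(1)] by (metis image_eqI)
    qed
  qed
  have "continuous_map (top_of_set (chart_ball c)) leaf_top g"
    unfolding leaf_topology_def continuous_on_generated_topo_iff
  proof (intro conjI allI impI)
    show "g ` topspace (top_of_set (chart_ball c)) \<subseteq> \<Union> (atlas_plaques (foliated_charts X \<A>))"
      using topspace_leaf_top g dom_in_topspace[OF c] by (auto simp: leaf_topology_def)
    fix Q assume "Q \<in> atlas_plaques (foliated_charts X \<A>)"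
    then obtain d where d: "d \<in> foliated_charts X \<A>" and "Q \<in> plaques d"
      by (auto simp: atlas_plaques_def)
    then obtain w where Q: "Q = plaque_at d w"
      using plaques_eq[OF foliated_chart_imp_product_chart[OF d]] by auto
    show "openin (top_of_set (chart_ball c)) (g -` Q \<inter> topspace (top_of_set (chart_ball c)))"
    proof (subst openin_subopen, intro ballI)
      fix b assume "b \<in> g -` Q \<inter> topspace (top_of_set (chart_ball c))"
      then have b: "b \<in> chart_ball c" "g b \<in> Q"
        by auto
      then have gb: "g b \<in> chart_dom d" "chart_proj d (g b) = w"
        by (auto simp: Q plaque_at_def)
      obtain N h where N: "openin X N" "g b \<in> N" "N \<subseteq> chart_dom c \<inter> chart_dom d"
        and h: "\<And>p. p \<in> N \<Longrightarrow> chart_proj d p = h (chart_proj c p)"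
        using local_transverse_map[OF atlas foliated_chart[OF c] d g(1)[OF b(1)] gb(1)] by metis
      \<comment> \<open>On \<open>N\<close> the coordinate of \<open>d\<close> depends only on that
        of \<open>c\<close>, which has the constant value \<open>z\<close> along the plaque.\<close>
      define O' where "O' = {b' \<in> chart_ball c. (b', z) \<in> chart_map c ` N}"
      have "continuous_map (top_of_set (chart_ball c)) (prod_topology (top_of_set (chart_ball c)) (chart_trans c))
          (\<lambda>b. (b, z))"
        using True by (simp add: continuous_map_pairwise comp_def)
      then have "openin (top_of_set (chart_ball c)) O'"
        using openin_continuous_map_preimage[OF _ open_chart_map_image[OF pc N(1)]] N(3)
        unfolding O'_def by fastforce
      moreover have "b \<in> O'"
        using b g[OF b(1)] N(2) unfolding O'_def by (metis (mono_tags, lifting) image_eqI mem_Collect_eq)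
      moreover have "O' \<subseteq> g -` Q \<inter> topspace (top_of_set (chart_ball c))"
      proof
        fix b' assume b': "b' \<in> O'"
        then obtain p where p: "p \<in> N" "chart_map c p = (b', z)"
          by (auto simp: O'_def)
        then have "g b' = p"
          using g_eq N(3) by blast
        moreover have "chart_proj c p = chart_proj c (g b)"
          using p g[OF b(1)] by (simp add: chart_proj_def)
        ultimately have "chart_proj d (g b') = w"
          using h p(1) N(2) gb(2) by metis
        then show "b' \<in> g -` Q \<inter> topspace (top_of_set (chart_ball c))"
          using b' \<open>g b' = p\<close> p(1) N(3) by (auto simp: Q plaque_at_def O'_def)
      qed
      ultimately show "\<exists>T. openin (top_of_set (chart_ball c)) T \<and> b \<in> T \<and>
          T \<subseteq> g -` Q \<inter> topspace (top_of_set (chart_ball c))"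
        by blast
    qed
  qed
  moreover have "connectedin (top_of_set (chart_ball c)) (chart_ball c)"
    using convex_connected[OF convex_chart_ball[OF pc]] by (simp add: connectedin_subtopology)
  ultimately show ?thesis
    unfolding img by (rule connectedin_continuous_map_image)
qed

text \<open>Plaques are connected, so chains stay in a leaf. Conversely, an orbit and its complement
  are both unions of plaques and hence open in the leaf topology, so no connected set meets
  both.\<close>

lemma leaf_through_eq:
  assumes x: "x \<in> topspace X"
  shows "leaf_through X \<A> x = E\<^sup>* `` {x}"
proof
  have plaque_sub: "\<exists>T. openin leaf_top T \<and> y \<in> T \<and> T \<subseteq> E `` {y}" if yX: "y \<in> topspace X" for y
  proof -
    obtain c where c: "c \<in> \<U>" "y \<in> chart_dom c"
      by (rule chart_at[OF yX])
    then show ?thesis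
      using openin_leaf_plaque_at[OF foliated_chart[OF c(1)], of "chart_proj c y"]
      by (intro exI[of _ "plaque_at c (chart_proj c y)"]) (auto simp: plaque_at_def intro: plaque_relI)
  qed
  show "E\<^sup>* `` {x} \<subseteq> leaf_through X \<A> x"
  proof (clarsimp simp: leaf_through_def)
    fix y assume "(x, y) \<in> E\<^sup>*"
    then show "connected_component_of leaf_top x y"
    proof (induction rule: rtrancl_induct)
      case base
      then show ?case
        using x topspace_leaf_top by (simp add: connected_component_of_refl)
    next
      case (step y z)
      then obtain c where c: "c \<in> \<U>" "y \<in> plaque_at c (chart_proj c y)" "z \<in> plaque_at c (chart_proj c y)"
        by (metis (mono_tags, lifting) mem_Collect_eq plaque_at_def plaque_relE)
      then have "connected_component_of leaf_top y z"
        using connectedin_plaque_at unfolding connected_component_of_def by blast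
      then show ?case
        using step by (meson connected_component_of_trans)
    qed
  qed
  show "leaf_through X \<A> x \<subseteq> E\<^sup>* `` {x}"
  proof
    fix y assume "y \<in> leaf_through X \<A> x"
    then obtain T where T: "connectedin leaf_top T" "x \<in> T" "y \<in> T"
      by (auto simp: leaf_through_def connected_component_of_def)
    let ?S = "E\<^sup>* `` {x}"
    have sub: "?S \<subseteq> topspace X"
      using x relpow_in_topspace by (auto dest!: rtrancl_imp_relpow)
    have "openin leaf_top ?S"
    proof (subst openin_subopen, intro ballI)
      fix y assume y: "y \<in> ?S"
      then obtain T where "openin leaf_top T" "y \<in> T" "T \<subseteq> E `` {y}"
        using plaque_sub sub by blast
      moreover have "E `` {y} \<subseteq> ?S"
        using y by (auto intro: rtrancl.rtrancl_into_rtrancl)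
      ultimately show "\<exists>T. openin leaf_top T \<and> y \<in> T \<and> T \<subseteq> ?S"
        by blast
    qed
    moreover have "openin leaf_top (topspace X - ?S)"
    proof (subst openin_subopen, intro ballI)
      fix y assume y: "y \<in> topspace X - ?S"
      then obtain T where T: "openin leaf_top T" "y \<in> T" "T \<subseteq> E `` {y}"
        using plaque_sub by blast
      moreover have "E `` {y} \<inter> ?S = {}"
      proof -
        have "(x, y) \<in> E\<^sup>*" if "(y, w) \<in> E" "(x, w) \<in> E\<^sup>*" for w
          using that sym_plaque_rel by (meson rtrancl.rtrancl_into_rtrancl symD)
        then show ?thesis
          using y by auto
      qed
      moreover have "T \<subseteq> topspace X"
        using openin_subset[OF T(1)] topspace_leaf_top by simp
      ultimately show "\<exists>T. openin leaf_top T \<and> y \<in> T \<and> T \<subseteq> topspace X - ?S"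
        by blast
    qed
    moreover have "T \<subseteq> ?S \<union> (topspace X - ?S)"
      using connectedin_subset_topspace[OF T(1)] topspace_leaf_top by auto
    moreover have "?S \<inter> T \<noteq> {}"
      using T(2) by blast
    ultimately have "(topspace X - ?S) \<inter> T = {}"
      using T(1) unfolding connectedin by blast
    then show "y \<in> ?S"
      using T(3) connectedin_subset_topspace[OF T(1)] topspace_leaf_top by blast
  qed
qed

lemma leaves_eq: "leaves X \<A> = (\<lambda>x. E\<^sup>* `` {x}) ` topspace X"
  using leaf_through_eq unfolding leaves_def connected_components_of_def leaf_through_def
  by (simp add: topspace_leaf_top)

end

lemma separate_finite:
  assumes "Hausdorff_space Y" "finite F" "F \<subseteq> topspace Y"
  shows "\<exists>V. (\<forall>p\<in>F. openin Y (V p) \<and> p \<in> V p) \<and> (\<forall>p\<in>F. \<forall>q\<in>F. p \<noteq> q \<longrightarrow> V p \<inter> V q = {})"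
proof -
  have "\<forall>p\<in>F. \<forall>q\<in>F. \<exists>U W. p \<noteq> q \<longrightarrow> openin Y U \<and> openin Y W \<and> p \<in> U \<and> q \<in> W \<and> disjnt U W"
    using assms(1,3) unfolding Hausdorff_space_def by (metis subsetD)
  then obtain U W where UW: "\<And>p q. p \<in> F \<Longrightarrow> q \<in> F \<Longrightarrow> p \<noteq> q \<Longrightarrow>
      openin Y (U p q) \<and> openin Y (W p q) \<and> p \<in> U p q \<and> q \<in> W p q \<and> disjnt (U p q) (W p q)"
    by metis
  \<comment> \<open>The sets separating \<open>p\<close> from \<open>q\<close> were chosen for
    ordered pairs; \<open>V p\<close> respects both orders, so that \<open>V p\<close> and
    \<open>V q\<close> lie in the two sides of the same separation.\<close>
  define V where "V p = topspace Y \<inter> (\<Inter>q\<in>F - {p}. U p q \<inter> W q p)" for p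
  have "openin Y (V p) \<and> p \<in> V p" if p: "p \<in> F" for p
  proof
    show "p \<in> V p"
      using p assms(3) UW by (auto simp: V_def)
    show "openin Y (V p)"
    proof (cases "F - {p} = {}")
      case True
      then show ?thesis
        unfolding V_def True by simp
    next
      case False
      have "openin Y (\<Inter>q\<in>F - {p}. U p q \<inter> W q p)"
        using False assms(2) UW p by (intro openin_Inter) auto
      then show ?thesis
        unfolding V_def by blast
    qed
  qed
  moreover have "V p \<inter> V q = {}" if "p \<in> F" "q \<in> F" "p \<noteq> q" for p q
  proof -
    have "V p \<subseteq> U p q" "V q \<subseteq> W p q"
      using that by (auto simp: V_def)
    then show ?thesis
      using UW[OF that] by (auto simp: disjnt_def)
  qed
  ultimately show ?thesis
    by blast
qed

section \<open>Plaque distance and counting of plaques\<close>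

context regular_foliation
begin

text \<open>Plaques are collected one at a time, starting from one through \<open>x\<close>. While
  some are left, one of them meets the union collected so far, as otherwise the connected union
  would split into two leaf-open parts. Each new plaque costs one step.\<close>

lemma relpow_of_connected_plaques:
  assumes fin: "finite \<P>" and sub: "\<P> \<subseteq> atlas_plaques \<U>" and conn: "connectedin leaf_top (\<Union>\<P>)"
    and x: "x \<in> \<Union>\<P>" and y: "y \<in> \<Union>\<P>"
  shows "(x, y) \<in> E ^^ card \<P>"
proof -
  have plaque: "\<exists>c\<in>\<U>. \<exists>z. P = plaque_at c z \<and> P \<noteq> {}" if P: "P \<in> \<P>" for P
  proof -
    obtain c where c: "c \<in> \<U>" "P \<in> plaques c"
      using P sub by (auto simp: atlas_plaques_def)
    then obtain p where "p \<in> chart_dom c" "P = plaque_at c (chart_proj c p)"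
      using plaques_eq[OF chart] by auto
    then show ?thesis
      using c(1) by (auto simp: plaque_at_def)
  qed
  have rel: "(p, q) \<in> E" if "P \<in> \<P>" "p \<in> P" "q \<in> P" for P p q
    using plaque[OF that(1)] that(2,3) by (auto simp: plaque_at_def intro: plaque_relI)
  have opn: "openin leaf_top (\<Union>\<Q>)" if \<Q>: "\<Q> \<subseteq> \<P>" for \<Q>
  proof (intro openin_Union)
    fix P assume "P \<in> \<Q>"
    then obtain c z where "c \<in> \<U>" "P = plaque_at c z"
      using plaque[of P] \<Q> by auto
    then show "openin leaf_top P"
      using openin_leaf_plaque_at[OF foliated_chart] by simp
  qed
  have xX: "x \<in> topspace X"
    using x connectedin_subset_topspace[OF conn] topspace_leaf_top by auto
  have grow: "\<exists>\<Q>\<subseteq>\<P>. card \<Q> = Suc j \<and> (\<forall>y\<in>\<Union>\<Q>. (x, y) \<in> E ^^ Suc j)" if "j < card \<P>" for j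
    using that
  proof (induction j)
    case 0
    obtain P where P: "P \<in> \<P>" "x \<in> P"
      using x by blast
    then have "\<forall>y\<in>P. (x, y) \<in> E ^^ Suc 0"
      using rel by simp
    then show ?case
      using P by (intro exI[of _ "{P}"]) auto
  next
    case (Suc j)
    then obtain \<Q> where \<Q>: "\<Q> \<subseteq> \<P>" "card \<Q> = Suc j" "\<And>y. y \<in> \<Union>\<Q> \<Longrightarrow> (x, y) \<in> E ^^ Suc j"
      by (metis Suc_lessD)
    have "finite \<Q>"
      using \<Q>(1) fin finite_subset by blast
    have "\<exists>P\<in>\<P> - \<Q>. P \<inter> \<Union>\<Q> \<noteq> {}"
    proof (rule ccontr)
      assume "\<not> ?thesis"
      then have disj: "\<Union>\<Q> \<inter> \<Union>(\<P> - \<Q>) = {}"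
        by blast
      have "\<Q> \<noteq> {}" "\<P> - \<Q> \<noteq> {}"
        using \<Q>(1,2) Suc.prems by auto
      then have "\<Union>\<Q> \<noteq> {}" "\<Union>(\<P> - \<Q>) \<noteq> {}"
        using plaque \<Q>(1) by blast+
      moreover have sub: "\<Union>\<Q> \<subseteq> \<Union>\<P>" "\<Union>(\<P> - \<Q>) \<subseteq> \<Union>\<P>"
        using \<Q>(1) by blast+
      ultimately have "\<Union>\<Q> \<inter> \<Union>\<P> \<noteq> {}" "\<Union>(\<P> - \<Q>) \<inter> \<Union>\<P> \<noteq> {}"
        by (simp_all add: Int_absorb2)
      moreover have "\<Union>\<P> \<subseteq> \<Union>\<Q> \<union> \<Union>(\<P> - \<Q>)" "\<Union>\<Q> \<inter> \<Union>(\<P> - \<Q>) \<inter> \<Union>\<P> = {}"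
        using disj by auto
      ultimately have "\<exists>E1 E2. openin leaf_top E1 \<and> openin leaf_top E2 \<and> \<Union>\<P> \<subseteq> E1 \<union> E2 \<and>
          E1 \<inter> E2 \<inter> \<Union>\<P> = {} \<and> E1 \<inter> \<Union>\<P> \<noteq> {} \<and> E2 \<inter> \<Union>\<P> \<noteq> {}"
        using opn[OF \<Q>(1)] opn[of "\<P> - \<Q>"] by (metis Diff_subset)
      then show False
        using conn unfolding connectedin by blast
    qed
    then obtain P q where P: "P \<in> \<P>" "P \<notin> \<Q>" "q \<in> P" "q \<in> \<Union>\<Q>"
      by blast
    have "(x, y) \<in> E ^^ Suc (Suc j)" if "y \<in> \<Union>(insert P \<Q>)" for y
    proof (cases "y \<in> P")
      case True
      then show ?thesis
        using \<Q>(3)[OF P(4)] rel[OF P(1,3)] by auto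
    next
      case False
      then have "(x, y) \<in> E ^^ Suc j"
        using that \<Q>(3) by blast
      then show ?thesis
        using relpow_mono[OF xX] by (meson lessI less_imp_le)
    qed
    moreover have "card (insert P \<Q>) = Suc (Suc j)"
      using P(2) \<Q>(2) \<open>finite \<Q>\<close> by simp
    ultimately show ?case
      using P(1) \<Q>(1) by (intro exI[of _ "insert P \<Q>"]) blast
  qed
  have "0 < card \<P>"
    using x fin by (auto simp: card_gt_0_iff)
  then obtain \<Q> where "\<Q> \<subseteq> \<P>" "card \<Q> = card \<P>" "\<forall>y\<in>\<Union>\<Q>. (x, y) \<in> E ^^ card \<P>"
    using grow[of "card \<P> - 1"] by auto
  then show ?thesis
    using y card_subset_eq[OF fin] by blast
qed

text \<open>The cardinality is only bounded above because a chain may return to the same plaque. The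
  number of steps is positive because a chain without steps supplies no plaque.\<close>

lemma connected_plaques_of_relpow:
  assumes "x \<in> topspace X" "(x, y) \<in> E ^^ Suc k"
  shows "\<exists>\<P>. finite \<P> \<and> \<P> \<subseteq> atlas_plaques \<U> \<and> connectedin leaf_top (\<Union>\<P>) \<and>
    x \<in> \<Union>\<P> \<and> y \<in> \<Union>\<P> \<and> card \<P> \<le> Suc k"
  using assms(2)
proof (induction k arbitrary: y)
  case 0
  then obtain c where c: "c \<in> \<U>" "x \<in> chart_dom c" "y \<in> chart_dom c" "chart_proj c x = chart_proj c y"
    by (auto elim: plaque_relE)
  let ?P = "plaque_at c (chart_proj c x)"
  have "?P \<in> atlas_plaques \<U>"
    using c plaques_eq[OF chart[OF c(1)]] by (auto simp: atlas_plaques_def)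
  moreover have "x \<in> ?P" "y \<in> ?P"
    using c by (auto simp: plaque_at_def)
  ultimately show ?case
    using connectedin_plaque_at[OF c(1)] by (intro exI[of _ "{?P}"]) auto
next
  case (Suc k)
  then obtain w where w: "(x, w) \<in> E ^^ Suc k" "(w, y) \<in> E"
    by auto
  then obtain c where c: "c \<in> \<U>" "w \<in> chart_dom c" "y \<in> chart_dom c" "chart_proj c w = chart_proj c y"
    by (auto elim: plaque_relE)
  obtain \<P> where \<P>: "finite \<P>" "\<P> \<subseteq> atlas_plaques \<U>" "connectedin leaf_top (\<Union>\<P>)"
    "x \<in> \<Union>\<P>" "w \<in> \<Union>\<P>" "card \<P> \<le> Suc k"
    using Suc.IH[OF w(1)] by blast
  let ?P = "plaque_at c (chart_proj c w)"
  have P: "?P \<in> atlas_plaques \<U>"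
    using c plaques_eq[OF chart[OF c(1)]] by (auto simp: atlas_plaques_def)
  have mem: "w \<in> ?P" "y \<in> ?P"
    using c by (auto simp: plaque_at_def)
  have "connectedin leaf_top (?P \<union> \<Union>\<P>)"
    using connectedin_plaque_at[OF c(1)] \<P>(3,5) mem(1) by (intro connectedin_Un) auto
  moreover have "card (insert ?P \<P>) \<le> Suc (Suc k)"
    using \<P>(1,6) by (simp add: card_insert_if)
  moreover have "insert ?P \<P> \<subseteq> atlas_plaques \<U>" "finite (insert ?P \<P>)"
    using P \<P>(1,2) by simp_all
  moreover have "x \<in> \<Union>(insert ?P \<P>)" "y \<in> \<Union>(insert ?P \<P>)"
    using \<P>(4) mem(2) by simp_all
  ultimately show ?case
    by (metis Union_insert)
qed

text \<open>The two preceding lemmas convert minimal connected families and chains into each other.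
  The points lie in one leaf, so the set of cardinalities is nonempty and its infimum is
  attained.\<close>

lemma plaque_dist_le_iff:
  assumes x: "x \<in> topspace X" and xy: "(x, y) \<in> E\<^sup>*"
  shows "plaque_dist X \<A> \<U> x y \<le> j \<longleftrightarrow> (x, y) \<in> E ^^ j"
proof (cases "x = y")
  case True
  then show ?thesis
    using relpow_mono[OF x, of x 0 j] by (simp add: plaque_dist_def)
next
  case False
  define C where "C = {card \<P> | \<P>. finite \<P> \<and> \<P> \<subseteq> atlas_plaques \<U> \<and>
                           connectedin leaf_top (\<Union>\<P>) \<and> x \<in> \<Union>\<P> \<and> y \<in> \<Union>\<P>}"
  have dist: "plaque_dist X \<A> \<U> x y = Inf C"
    using False by (simp add: plaque_dist_def C_def)
  have small: "\<exists>m\<in>C. m \<le> i" if i: "(x, y) \<in> E ^^ i" for i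
  proof -
    obtain i' where i': "i = Suc i'"
      using False i by (cases i) auto
    obtain \<P> where "finite \<P>" "\<P> \<subseteq> atlas_plaques \<U>" "connectedin leaf_top (\<Union>\<P>)"
      "x \<in> \<Union>\<P>" "y \<in> \<Union>\<P>" "card \<P> \<le> i"
      using connected_plaques_of_relpow[OF x i[unfolded i']] i' by auto
    then have "card \<P> \<in> C"
      unfolding C_def by (intro CollectI exI[of _ \<P>]) simp
    then show ?thesis
      using \<open>card \<P> \<le> i\<close> by (rule bexI[rotated])
  qed
  show ?thesis
  proof
    assume "(x, y) \<in> E ^^ j"
    then obtain m where "m \<in> C" "m \<le> j"
      using small by blast
    then show "plaque_dist X \<A> \<U> x y \<le> j"
      unfolding dist using wellorder_Inf_le1[of m C] by (meson order_trans)
  next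
    assume le: "plaque_dist X \<A> \<U> x y \<le> j"
    have "C \<noteq> {}"
      using small xy rtrancl_imp_relpow by blast
    then have "Inf C \<in> C"
      by (rule Inf_nat_def1)
    then obtain \<P> where "Inf C = card \<P>" "finite \<P>" "\<P> \<subseteq> atlas_plaques \<U>"
      "connectedin leaf_top (\<Union>\<P>)" "x \<in> \<Union>\<P>" "y \<in> \<Union>\<P>"
      unfolding C_def by blast
    then have "(x, y) \<in> E ^^ plaque_dist X \<A> \<U> x y"
      unfolding dist using relpow_of_connected_plaques by metis
    then show "(x, y) \<in> E ^^ j"
      using relpow_mono[OF x _ le] by blast
  qed
qed

lemma plaque_ball_eq:
  assumes x: "x \<in> topspace X" and r: "0 < r"
  shows "plaque_ball X \<A> \<U> x r = (E ^^ (nat \<lceil>r\<rceil> - 1)) `` {x}"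
proof -
  have *: "real d < r \<longleftrightarrow> d \<le> nat \<lceil>r\<rceil> - 1" for d
    using r by linarith
  have "plaque_ball X \<A> \<U> x r = {y. (x, y) \<in> E\<^sup>* \<and> (x, y) \<in> E ^^ (nat \<lceil>r\<rceil> - 1)}"
    unfolding plaque_ball_def leaf_through_eq[OF x] * using plaque_dist_le_iff[OF x] by auto
  then show ?thesis
    by (auto intro: relpow_imp_rtrancl)
qed

text \<open>
  Plaques are counted as pairs of a chart and a transverse coordinate, because two charts may
  share a plaque along one leaf and not along the neighbouring leaves. This changes the counts by
  a factor at most the number of charts.
\<close>

definition plaques_meeting :: "'a set \<Rightarrow> (('a,'n,'z) fol_chart \<times> 'z) set" where
  "plaques_meeting S = {(c, chart_proj c y) | c y. c \<in> \<U> \<and> y \<in> chart_dom c \<and> y \<in> S}"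

definition plaque_count :: "nat \<Rightarrow> 'a \<Rightarrow> nat" where
  "plaque_count k x = card (plaques_meeting ((E ^^ k) `` {x}))"

text \<open>A plaque of \<open>e\<close> meets at most one plaque of \<open>c\<close>, by
  \<open>chart_transition_unique\<close>. Hence a plaque of \<open>c\<close> through a point of
  \<open>S\<close> is determined by \<open>c\<close> and a member of \<open>F\<close> containing
  that point; \<open>nxt\<close> finds it from any common point.\<close>

lemma plaques_meeting_covered:
  assumes F: "finite F"
    and cov: "\<And>y. y \<in> S \<Longrightarrow> \<exists>(e, w)\<in>F. e \<in> \<U> \<and> y \<in> chart_dom e \<and> chart_proj e y = w"
  shows "finite (plaques_meeting S)" "card (plaques_meeting S) \<le> card F * card charts"
proof -
  define nxt where "nxt = (\<lambda>((e :: ('a,'n,'z) fol_chart, w :: 'z), c :: ('a,'n,'z) fol_chart). (c, chart_proj c (SOME p. p \<in> chart_dom e \<and> p \<in> chart_dom c \<and> chart_proj e p = w)))"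
  have "plaques_meeting S \<subseteq> nxt ` (F \<times> charts)"
  proof
    fix t assume "t \<in> plaques_meeting S"
    then obtain c y where cy: "t = (c, chart_proj c y)" "c \<in> \<U>" "y \<in> chart_dom c" "y \<in> S"
      by (auto simp: plaques_meeting_def)
    obtain e where e: "(e, chart_proj e y) \<in> F" "e \<in> \<U>" "y \<in> chart_dom e"
      using cov[OF cy(4)] by auto
    define p where "p = (SOME p. p \<in> chart_dom e \<and> p \<in> chart_dom c \<and> chart_proj e p = chart_proj e y)"
    have "p \<in> chart_dom e \<and> p \<in> chart_dom c \<and> chart_proj e p = chart_proj e y"
      unfolding p_def by (rule someI[of _ y]) (use e cy in auto)
    then have "chart_proj c p = chart_proj c y"
      using chart_transition_unique[of e c p y] e cy by blast
    then have "t = nxt ((e, chart_proj e y), c)"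
      by (simp add: nxt_def p_def[symmetric] cy)
    moreover have "c \<in> charts"
      using cy by (auto simp: charts_def)
    ultimately show "t \<in> nxt ` (F \<times> charts)"
      using e(1) by blast
  qed
  note sub = this
  have fin: "finite (F \<times> charts)"
    using F finite_charts by simp
  show "finite (plaques_meeting S)"
    using fin sub by (rule finite_surj)
  have "card (plaques_meeting S) \<le> card (F \<times> charts)"
    using fin sub by (rule surj_card_le)
  then show "card (plaques_meeting S) \<le> card F * card charts"
    by (simp add: card_cartesian_product)
qed

text \<open>Each step multiplies the count by at most the number of charts. The resulting
  exponential bound later gives the finiteness of the limits in the definitions of exponential and
  quasi-exponential growth.\<close>

lemma finite_plaques_meeting_ball:
  assumes x: "x \<in> topspace X"
  shows "finite (plaques_meeting ((E ^^ k) `` {x}))" "plaque_count k x \<le> card charts ^ Suc k"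
proof -
  have "finite (plaques_meeting ((E ^^ k) `` {x})) \<and> plaque_count k x \<le> card charts ^ Suc k"
  proof (induction k)
    case 0
    obtain c where c: "c \<in> \<U>" "x \<in> chart_dom c"
      using x by (rule chart_at)
    show ?case
      using plaques_meeting_covered[of "{(c, chart_proj c x)}" "{x}"] c by (simp add: plaque_count_def)
  next
    case (Suc k)
    let ?F = "plaques_meeting ((E ^^ k) `` {x})"
    have "\<exists>(e, w)\<in>?F. e \<in> \<U> \<and> y \<in> chart_dom e \<and> chart_proj e y = w" if "y \<in> (E ^^ Suc k) `` {x}" for y
    proof -
      obtain w where w: "(x, w) \<in> E ^^ k" "(w, y) \<in> E"
        using \<open>y \<in> (E ^^ Suc k) `` {x}\<close> by auto
      then obtain c where c: "c \<in> \<U>" "w \<in> chart_dom c" "y \<in> chart_dom c" "chart_proj c w = chart_proj c y"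
        by (auto elim: plaque_relE)
      then have "(c, chart_proj c y) \<in> ?F"
        using w(1) by (auto simp: plaques_meeting_def) metis
      then show ?thesis
        using c by blast
    qed
    note cov = plaques_meeting_covered[OF _ this]
    have "plaque_count (Suc k) x \<le> plaque_count k x * card charts"
      using cov(2)[of "(E ^^ Suc k) `` {x}"] Suc unfolding plaque_count_def by blast
    also have "\<dots> \<le> card charts ^ Suc k * card charts"
      using Suc by simp
    finally show ?case
      using cov(1)[of "(E ^^ Suc k) `` {x}"] Suc by (auto simp: mult.commute)
  qed
  then show "finite (plaques_meeting ((E ^^ k) `` {x}))" "plaque_count k x \<le> card charts ^ Suc k"
    by auto
qed

lemma plaque_count_shift:
  assumes x: "x \<in> topspace X" and xy: "(x, y) \<in> E ^^ d"
  shows "plaque_count k y \<le> plaque_count (k + d) x"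
proof -
  have "(E ^^ k) `` {y} \<subseteq> (E ^^ (k + d)) `` {x}"
    using xy by (auto simp: add.commute[of k d] relpow_add)
  then have "plaques_meeting ((E ^^ k) `` {y}) \<subseteq> plaques_meeting ((E ^^ (k + d)) `` {x})"
    unfolding plaques_meeting_def by blast
  then show ?thesis
    unfolding plaque_count_def using card_mono[OF finite_plaques_meeting_ball(1)[OF x]] by blast
qed

lemma plaque_count_mono: "x \<in> topspace X \<Longrightarrow> j \<le> k \<Longrightarrow> plaque_count j x \<le> plaque_count k x"
  using plaque_count_shift[OF _ relpow_mono[of x x 0 "k - j"], of j] by simp

lemma plaque_count_pos:
  assumes x: "x \<in> topspace X"
  shows "1 \<le> plaque_count k x"
proof -
  obtain c where c: "c \<in> \<U>" "x \<in> chart_dom c"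
    using x by (rule chart_at)
  then have "(c, chart_proj c x) \<in> plaques_meeting ((E ^^ k) `` {x})"
    using relpow_mono[OF x, of x 0 k] by (auto simp: plaques_meeting_def)
  then show ?thesis
    using finite_plaques_meeting_ball(1)[OF x, of k] unfolding plaque_count_def
    by (metis card_gt_0_iff empty_iff less_eq_Suc_le One_nat_def)
qed

lemma plaque_growth_bounds:
  assumes x: "x \<in> topspace X" and r: "0 < r"
  shows "plaque_growth X \<A> \<U> x r \<le> plaque_count (nat \<lceil>r\<rceil> - 1) x"
    and "plaque_count (nat \<lceil>r\<rceil> - 1) x \<le> plaque_growth X \<A> \<U> x r * card charts"
proof -
  define S where "S = (E ^^ (nat \<lceil>r\<rceil> - 1)) `` {x}"
  define Q where "Q = {P \<in> atlas_plaques \<U>. P \<inter> S \<noteq> {}}"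
  have growth: "plaque_growth X \<A> \<U> x r = card Q"
    unfolding plaque_growth_def plaque_ball_eq[OF x r] Q_def S_def ..
  have count: "plaque_count (nat \<lceil>r\<rceil> - 1) x = card (plaques_meeting S)"
    by (simp add: plaque_count_def S_def)
  have fin: "finite (plaques_meeting S)"
    unfolding S_def using finite_plaques_meeting_ball(1)[OF x] .
  have Q_eq: "Q = (\<lambda>(c, z). plaque_at c z) ` plaques_meeting S"
  proof
    show "Q \<subseteq> (\<lambda>(c, z). plaque_at c z) ` plaques_meeting S"
    proof
      fix P assume P: "P \<in> Q"
      then obtain c where c: "c \<in> \<U>" "P \<in> plaques c"
        by (auto simp: Q_def atlas_plaques_def)
      then obtain p where p: "P = plaque_at c (chart_proj c p)"
        using plaques_eq[OF chart] by auto
      obtain y where "y \<in> P" "y \<in> S"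
        using P by (auto simp: Q_def)
      then have "y \<in> chart_dom c" "P = plaque_at c (chart_proj c y)"
        using p by (auto simp: plaque_at_def)
      then show "P \<in> (\<lambda>(c, z). plaque_at c z) ` plaques_meeting S"
        using c(1) \<open>y \<in> S\<close> by (force simp: plaques_meeting_def)
    qed
    show "(\<lambda>(c, z). plaque_at c z) ` plaques_meeting S \<subseteq> Q"
    proof clarify
      fix c z assume "(c, z) \<in> plaques_meeting S"
      then obtain y where y: "z = chart_proj c y" "c \<in> \<U>" "y \<in> chart_dom c" "y \<in> S"
        by (auto simp: plaques_meeting_def)
      then have "plaque_at c z \<in> plaques c"
        using plaques_eq[OF chart[OF y(2)]] by auto
      then show "plaque_at c z \<in> Q"
        using y by (auto simp: Q_def atlas_plaques_def plaque_at_def)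
    qed
  qed
  show "plaque_growth X \<A> \<U> x r \<le> plaque_count (nat \<lceil>r\<rceil> - 1) x"
    unfolding growth count Q_eq using fin by (rule card_image_le)
  \<comment> \<open>A nonempty plaque and its chart determine the transverse coordinate, so at most
    \<open>card charts\<close> pairs yield the same plaque.\<close>
  let ?f = "\<lambda>(c, z). (plaque_at c z, c)"
  have "inj_on ?f (plaques_meeting S)"
    by (auto simp: inj_on_def plaques_meeting_def plaque_at_def)
  moreover have "?f ` plaques_meeting S \<subseteq> Q \<times> charts"
    unfolding Q_eq by (auto simp: plaques_meeting_def charts_def)
  moreover have "finite (Q \<times> charts)"
    unfolding Q_eq using fin finite_charts by simp
  ultimately have "card (plaques_meeting S) \<le> card (Q \<times> charts)"
    by (rule card_inj_on_le)
  then show "plaque_count (nat \<lceil>r\<rceil> - 1) x \<le> plaque_growth X \<A> \<U> x r * card charts"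
    unfolding growth count by (simp add: card_cartesian_product)
qed

section \<open>The transversal and lower semicontinuity of the count\<close>

abbreviation "T \<equiv> transversal \<U>"

lemma openin_transversal:
  "openin T V \<longleftrightarrow> V \<subseteq> topspace T \<and> (\<forall>c\<in>\<U>. openin (chart_trans c) {z. (c, z) \<in> V})"
  by (simp add: transversal_def openin_sum_topology)

lemma topspace_transversal: "topspace T = {(c, z). c \<in> \<U> \<and> z \<in> topspace (chart_trans c)}"
  by (auto simp: transversal_def)

lemma openin_transversal_slice:
  assumes "c \<in> \<U>" "openin (chart_trans c) V"
  shows "openin T ({c} \<times> V)"
proof -
  have "{z. (c', z) \<in> {c} \<times> V} = (if c' = c then V else {})" for c'
    by auto
  then show ?thesis
    using assms openin_subset[OF assms(2)] by (auto simp: openin_transversal topspace_transversal)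
qed

lemma Hausdorff_transversal: "Hausdorff_space T"
  unfolding Hausdorff_space_def
proof (intro allI impI)
  fix s t assume st: "s \<in> topspace T \<and> t \<in> topspace T \<and> s \<noteq> t"
  obtain c z d w where s: "s = (c, z)" and t: "t = (d, w)"
    by (cases s, cases t)
  have c: "c \<in> \<U>" "z \<in> topspace (chart_trans c)" "d \<in> \<U>" "w \<in> topspace (chart_trans d)"
    using st s t by (auto simp: topspace_transversal)
  note box = openin_transversal_slice
  show "\<exists>U V. openin T U \<and> openin T V \<and> s \<in> U \<and> t \<in> V \<and> disjnt U V"
  proof (cases "c = d")
    case False
    then show ?thesis
      using box[OF c(1) openin_topspace] box[OF c(3) openin_topspace] c s t
      by (intro exI[of _ "{c} \<times> topspace (chart_trans c)"] exI[of _ "{d} \<times> topspace (chart_trans d)"])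
        (auto simp: disjnt_def)
  next
    case True
    then have "z \<noteq> w"
      using st s t by simp
    then obtain U V where "openin (chart_trans c) U" "openin (chart_trans c) V" "z \<in> U" "w \<in> V" "disjnt U V"
      using Hausdorff_chart_trans[OF chart[OF c(1)]] c True unfolding Hausdorff_space_def by metis
    then show ?thesis
      using box[OF c(1)] s t True by (intro exI[of _ "{c} \<times> U"] exI[of _ "{c} \<times> V"]) (auto simp: disjnt_def)
  qed
qed

lemma open_vimage_transversal:
  assumes "c \<in> \<U>" "openin T V"
  shows "openin X {x \<in> chart_dom c. (c, chart_proj c x) \<in> V}"
  using open_chart_proj_vimage[OF chart[OF assms(1)], of "{z. (c, z) \<in> V}"] assms
  by (simp add: openin_transversal)

lemma plaque_in_transversal: "c \<in> \<U> \<Longrightarrow> x \<in> chart_dom c \<Longrightarrow> (c, chart_proj c x) \<in> topspace T"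
  using chart_proj_in_trans[OF chart] by (simp add: topspace_transversal)

text \<open>The finitely many plaques counted at \<open>x\<close> have disjoint neighbourhoods in
  the transversal. A point near \<open>x\<close> still reaches a plaque in each of them, and
  disjointness keeps these plaques distinct.\<close>

lemma plaque_count_lsc: "openin X {y \<in> topspace X. m \<le> plaque_count k y}"
proof (subst openin_subopen, intro ballI)
  fix x assume "x \<in> {y \<in> topspace X. m \<le> plaque_count k y}"
  then have x: "x \<in> topspace X" "m \<le> plaque_count k x"
    by auto
  define F where "F = plaques_meeting ((E ^^ k) `` {x})"
  have F: "finite F" "F \<subseteq> topspace T"
    using finite_plaques_meeting_ball(1)[OF x(1)] plaque_in_transversal
    by (auto simp: F_def plaques_meeting_def)
  then obtain V where V: "\<And>p. p \<in> F \<Longrightarrow> openin T (V p) \<and> p \<in> V p"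
    "\<And>p q. p \<in> F \<Longrightarrow> q \<in> F \<Longrightarrow> p \<noteq> q \<Longrightarrow> V p \<inter> V q = {}"
    using separate_finite[OF Hausdorff_transversal F] by metis
  \<comment> \<open>By symmetry of \<open>E\<close> these are the points from which \<open>k\<close>
    steps lead to a plaque in \<open>V t\<close>; written as an image, the set is visibly
    open.\<close>
  define W where "W t = (E ^^ k) `` {y \<in> chart_dom (fst t). (fst t, chart_proj (fst t) y) \<in> V t}" for t
  have W: "openin X (W t) \<and> x \<in> W t" if t: "t \<in> F" for t
  proof
    obtain c y where cy: "t = (c, chart_proj c y)" "c \<in> \<U>" "y \<in> chart_dom c" "(x, y) \<in> E ^^ k"
      using t by (auto simp: F_def plaques_meeting_def)
    then show "openin X (W t)"
      unfolding W_def using V(1)[OF t] by (intro open_relpow_Image open_vimage_transversal) auto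
    show "x \<in> W t"
      unfolding W_def using cy sym_relpow V(1)[OF t] by auto
  qed
  define O' where "O' = topspace X \<inter> (\<Inter>t\<in>F. W t)"
  have "F \<noteq> {}"
    using plaque_count_pos[OF x(1), of k] by (auto simp: F_def plaque_count_def)
  then have "openin X O'"
    unfolding O'_def using F(1) W by (intro openin_Int openin_Inter) auto
  moreover have "x \<in> O'"
    using x W by (auto simp: O'_def)
  moreover have "m \<le> plaque_count k y" if y: "y \<in> O'" for y
  proof -
    have yX: "y \<in> topspace X"
      using y by (simp add: O'_def)
    have "\<exists>s. s \<in> plaques_meeting ((E ^^ k) `` {y}) \<and> s \<in> V t" if t: "t \<in> F" for t
    proof -
      have "y \<in> W t"
        using y t by (simp add: O'_def)
      then obtain y' where y': "y' \<in> chart_dom (fst t)" "(fst t, chart_proj (fst t) y') \<in> V t" "(y', y) \<in> E ^^ k"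
        by (auto simp: W_def)
      moreover have "fst t \<in> \<U>"
        using t by (auto simp: F_def plaques_meeting_def)
      ultimately have "(fst t, chart_proj (fst t) y') \<in> plaques_meeting ((E ^^ k) `` {y})"
        using sym_relpow unfolding plaques_meeting_def by blast
      then show ?thesis
        using y'(2) by blast
    qed
    then obtain s where s: "\<And>t. t \<in> F \<Longrightarrow> s t \<in> plaques_meeting ((E ^^ k) `` {y}) \<and> s t \<in> V t"
      by metis
    have "inj_on s F"
      using s V(2) by (intro inj_onI) (metis disjoint_iff)
    moreover have "s ` F \<subseteq> plaques_meeting ((E ^^ k) `` {y})"
      using s by blast
    ultimately have "card F \<le> plaque_count k y"
      unfolding plaque_count_def using finite_plaques_meeting_ball(1)[OF yX] by (rule card_inj_on_le)
    then show ?thesis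
      using x(2) by (simp add: F_def plaque_count_def)
  qed
  ultimately show "\<exists>S. openin X S \<and> x \<in> S \<and> S \<subseteq> {y \<in> topspace X. m \<le> plaque_count k y}"
    by (intro exI[of _ O']) (auto simp: O'_def)
qed

end

section \<open>Holonomy\<close>

text \<open>Graphs of homeomorphisms between open subsets of \<open>T\<close>. Openness of images in
  both directions includes openness of the domain and the range.\<close>

definition local_homeo :: "'t topology \<Rightarrow> ('t \<times> 't) set \<Rightarrow> bool" where
  "local_homeo T f \<longleftrightarrow> f \<subseteq> topspace T \<times> topspace T \<and> single_valued f \<and> single_valued (f\<inverse>) \<and>
     (\<forall>V. openin T V \<longrightarrow> openin T (f `` V) \<and> openin T (f\<inverse> `` V))"

lemma restriction_eqI:
  "(\<And>p p'. p \<in> V \<Longrightarrow> (p, p') \<in> f \<longleftrightarrow> (p, p') \<in> g) \<Longrightarrow> f \<inter> V \<times> UNIV = g \<inter> V \<times> UNIV"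
  by blast

lemma local_homeo_Id: "local_homeo T (Id_on (topspace T))"
proof -
  have "Id_on (topspace T) `` V = V \<and> (Id_on (topspace T))\<inverse> `` V = V" if "openin T V" for V
    using openin_subset[OF that] by auto
  then show ?thesis
    unfolding local_homeo_def by (auto simp: single_valued_def)
qed

lemma local_homeo_comp: "local_homeo T f \<Longrightarrow> local_homeo T g \<Longrightarrow> local_homeo T (f O g)"
  unfolding local_homeo_def converse_relcomp
  by (intro conjI) (auto intro: single_valued_relcomp simp: relcomp_Image)

lemma local_homeo_converse: "local_homeo T f \<Longrightarrow> local_homeo T (f\<inverse>)"
  unfolding local_homeo_def by auto

lemma local_homeo_restrict:
  assumes "local_homeo T f" "openin T V"
  shows "local_homeo T (f \<inter> V \<times> UNIV)"
proof -
  have "(f \<inter> V \<times> UNIV) `` W = f `` (V \<inter> W)" "(f \<inter> V \<times> UNIV)\<inverse> `` W = V \<inter> f\<inverse> `` W" for W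
    by auto
  moreover have "single_valued (f \<inter> V \<times> UNIV)" "single_valued ((f \<inter> V \<times> UNIV)\<inverse>)"
    using assms(1) by (auto simp: local_homeo_def single_valued_def)
  ultimately show ?thesis
    using assms unfolding local_homeo_def by (auto simp: openin_Int)
qed

lemma local_homeo_Union:
  assumes "\<And>f. f \<in> \<C> \<Longrightarrow> local_homeo T f" "single_valued (\<Union>\<C>)" "single_valued ((\<Union>\<C>)\<inverse>)"
  shows "local_homeo T (\<Union>\<C>)"
proof -
  have "(\<Union>\<C>) `` V = (\<Union>f\<in>\<C>. f `` V)" "(\<Union>\<C>)\<inverse> `` V = (\<Union>f\<in>\<C>. f\<inverse> `` V)" for V
    by auto
  moreover have "\<Union>\<C> \<subseteq> topspace T \<times> topspace T"
    using assms(1) unfolding local_homeo_def by (intro Union_least) simp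
  moreover have "openin T (\<Union>f\<in>\<C>. f `` V)" "openin T (\<Union>f\<in>\<C>. f\<inverse> `` V)" if "openin T V" for V
    using assms(1) that unfolding local_homeo_def by (intro openin_Union; auto)+
  ultimately show ?thesis
    using assms(2,3) unfolding local_homeo_def by simp
qed

lemma pseudogroup_local_homeo:
  assumes "\<And>f. f \<in> G \<Longrightarrow> local_homeo T f" and "f \<in> generated_pseudogroup T G"
  shows "local_homeo T f"
  using assms(2)
  by (induction rule: generated_pseudogroup.induct)
    (simp_all add: assms(1) local_homeo_Id local_homeo_comp local_homeo_converse local_homeo_restrict
      local_homeo_Union)

lemma open_Domain_local_homeo:
  assumes "local_homeo T f"
  shows "openin T (Domain f)"
proof -
  have "Domain f = f\<inverse> `` topspace T"
    using assms unfolding local_homeo_def by auto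
  then show ?thesis
    using assms unfolding local_homeo_def by auto
qed

text \<open>Restriction and gluing create no new germs, so a family closed under composition and
  inversion already has all germs of the pseudogroup. The point is to take \<open>W\<close>
  countable.\<close>

lemma pseudogroup_locally_generated:
  assumes lh: "\<And>f. f \<in> W \<Longrightarrow> local_homeo T f"
    and W: "G \<subseteq> W" "Id_on (topspace T) \<in> W" "\<And>f g. f \<in> W \<Longrightarrow> g \<in> W \<Longrightarrow> f O g \<in> W"
      "\<And>f. f \<in> W \<Longrightarrow> f\<inverse> \<in> W"
    and f: "f \<in> generated_pseudogroup T G" "(q, q') \<in> f"
  shows "\<exists>w\<in>W. \<exists>V. openin T V \<and> q \<in> V \<and> f \<inter> V \<times> UNIV = w \<inter> V \<times> UNIV"
proof -
  have lhG: "local_homeo T f" if "f \<in> generated_pseudogroup T G" for f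
    using pseudogroup_local_homeo[OF _ that] lh W(1) by blast
  show ?thesis
    using f
  proof (induction arbitrary: q q' rule: generated_pseudogroup.induct)
    case (generator f)
    then show ?case
      using W(1) lh[of f] by (intro bexI[of _ f] exI[of _ "topspace T"]) (auto simp: local_homeo_def)
  next
    case identity
    then show ?case
      using W(2) by (intro bexI[of _ "Id_on (topspace T)"] exI[of _ "topspace T"]) auto
  next
    case (composition f g)
    then obtain p where p: "(q, p) \<in> f" "(p, q') \<in> g" by blast
    obtain w V where w: "w \<in> W" "openin T V" "q \<in> V" "f \<inter> V \<times> UNIV = w \<inter> V \<times> UNIV"
      using composition.IH(1)[OF p(1)] by blast
    obtain w' V' where w': "w' \<in> W" "openin T V'" "p \<in> V'" "g \<inter> V' \<times> UNIV = w' \<inter> V' \<times> UNIV"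
      using composition.IH(2)[OF p(2)] by blast
    \<comment> \<open>Here \<open>f\<close> agrees with \<open>w\<close> and sends the point to
      where \<open>g\<close> agrees with \<open>w'\<close>.\<close>
    let ?V = "V \<inter> f\<inverse> `` V'"
    have "openin T ?V"
      using w(2) w'(2) lhG[OF composition.hyps(1)] unfolding local_homeo_def by blast
    moreover have "q \<in> ?V"
      using w(3) w'(3) p(1) by blast
    moreover have "(f O g) \<inter> ?V \<times> UNIV = (w O w') \<inter> ?V \<times> UNIV"
    proof -
      have fw: "(a, b) \<in> f \<longleftrightarrow> (a, b) \<in> w" if "a \<in> V" for a b
        using w(4) that by blast
      have gw: "(a, b) \<in> g \<longleftrightarrow> (a, b) \<in> w'" if "a \<in> V'" for a b
        using w'(4) that by blast
      have im: "b \<in> V'" if "a \<in> f\<inverse> `` V'" "(a, b) \<in> f" for a b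
        using that lhG[OF composition.hyps(1)] unfolding local_homeo_def single_valued_def by blast
      have "(a, b) \<in> f O g \<longleftrightarrow> (a, b) \<in> w O w'" if "a \<in> ?V" for a b
      proof
        assume "(a, b) \<in> f O g"
        then obtain c where c: "(a, c) \<in> f" "(c, b) \<in> g" by blast
        then have "(a, c) \<in> w" "(c, b) \<in> w'"
          using fw gw im that by blast+
        then show "(a, b) \<in> w O w'" by blast
      next
        assume "(a, b) \<in> w O w'"
        then obtain c where c: "(a, c) \<in> w" "(c, b) \<in> w'" by blast
        then have "(a, c) \<in> f" using fw that by blast
        moreover then have "(c, b) \<in> g" using c gw im that by blast
        ultimately show "(a, b) \<in> f O g" by blast
      qed
      then show ?thesis by blast
    qed
    ultimately show ?case
      using W(3)[OF w(1) w'(1)] by blast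
  next
    case (inversion f)
    then obtain w V where w: "w \<in> W" "openin T V" "q' \<in> V" "f \<inter> V \<times> UNIV = w \<inter> V \<times> UNIV"
      by blast
    have sv: "single_valued (f\<inverse>)" "single_valued (w\<inverse>)"
      using lhG[OF inversion.hyps] lh[OF w(1)] unfolding local_homeo_def by auto
    have fw: "(a, b) \<in> f \<longleftrightarrow> (a, b) \<in> w" if "a \<in> V" for a b
      using w(4) that by blast
    have "openin T (f `` V)"
      using lhG[OF inversion.hyps] w(2) unfolding local_homeo_def by blast
    moreover have "q \<in> f `` V"
      using inversion.prems w(3) by blast
    moreover have "(b, a) \<in> f\<inverse> \<longleftrightarrow> (b, a) \<in> w\<inverse>" if b: "b \<in> f `` V" for a b
    proof -
      obtain p where p: "p \<in> V" "(p, b) \<in> f"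
        using b by blast
      then have "(p, b) \<in> w" using fw by blast
      then show ?thesis
        using p sv unfolding single_valued_def by blast
    qed
    then have "f\<inverse> \<inter> (f `` V) \<times> UNIV = w\<inverse> \<inter> (f `` V) \<times> UNIV"
      by blast
    ultimately show ?case
      using W(4)[OF w(1)] by blast
  next
    case (restriction f V)
    then obtain w V' where w: "w \<in> W" "openin T V'" "q \<in> V'" "f \<inter> V' \<times> UNIV = w \<inter> V' \<times> UNIV"
      by blast
    have "q \<in> V' \<inter> V"
      using w(3) restriction.prems by blast
    moreover have "(f \<inter> V \<times> UNIV) \<inter> (V' \<inter> V) \<times> UNIV = w \<inter> (V' \<inter> V) \<times> UNIV"
      using w(4) by blast
    ultimately show ?case
      using w(1) openin_Int[OF w(2) restriction.hyps(2)] by blast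
  next
    case (gluing \<C>)
    then obtain f where f: "f \<in> \<C>" "(q, q') \<in> f" by blast
    then obtain w V where w: "w \<in> W" "openin T V" "q \<in> V" "f \<inter> V \<times> UNIV = w \<inter> V \<times> UNIV"
      using gluing.IH by blast
    \<comment> \<open>On the domain of \<open>f\<close> the glued map has only the values of
      \<open>f\<close>, because it is single-valued.\<close>
    have "openin T (V \<inter> Domain f)"
      using w(2) open_Domain_local_homeo[OF lhG] gluing.hyps(1) f(1) by blast
    moreover have "q \<in> V \<inter> Domain f"
      using w(3) f(2) by blast
    moreover have "\<Union>\<C> \<inter> (V \<inter> Domain f) \<times> UNIV = w \<inter> (V \<inter> Domain f) \<times> UNIV"
    proof -
      have "(a, b) \<in> \<Union>\<C> \<longleftrightarrow> (a, b) \<in> f" if "a \<in> Domain f" for a b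
        using that f(1) gluing.hyps(2) unfolding single_valued_def by blast
      then show ?thesis
        using w(4) by blast
    qed
    ultimately show ?case
      using w(1) by blast
  qed
qed

text \<open>
  The complement of this set is nowhere dense, since the fixed point set of a local
  homeomorphism is closed in its domain.
\<close>

definition regular_points :: "'t topology \<Rightarrow> ('t \<times> 't) set \<Rightarrow> 't set" where
  "regular_points T f = T interior_of {q. (q, q) \<in> f} \<union> (topspace T - T closure_of {q. (q, q) \<in> f})"

lemma open_regular_points: "openin T (regular_points T f)"
  unfolding regular_points_def by (intro openin_Un openin_diff) auto

lemma dense_regular_points:
  assumes f: "local_homeo T f" and T: "Hausdorff_space T"
  shows "dense_subset T (regular_points T f)"
  unfolding dense_subset_iff
proof (intro allI impI)
  fix A assume A: "openin T A \<and> A \<noteq> {}"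
  let ?F = "{q. (q, q) \<in> f}"
  show "regular_points T f \<inter> A \<noteq> {}"
  proof (cases "A \<subseteq> T closure_of ?F")
    case False
    then show ?thesis
      using A openin_subset[of T A] unfolding regular_points_def by blast
  next
    case True
    then have "A \<inter> T closure_of ?F \<noteq> {}"
      using A by blast
    then have "A \<inter> ?F \<noteq> {}"
      using openin_Int_closure_of_eq_empty A by metis
    then obtain p where p: "p \<in> A" "(p, p) \<in> f"
      by blast
    have "A \<inter> Domain f \<subseteq> ?F"
    proof
      fix q assume q: "q \<in> A \<inter> Domain f"
      then obtain q' where q': "(q, q') \<in> f"
        by blast
      show "q \<in> ?F"
      proof (rule ccontr)
        assume "q \<notin> ?F"
        then have "q \<noteq> q'" "q \<in> topspace T" "q' \<in> topspace T"
          using q' f unfolding local_homeo_def by auto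
        then obtain U V where UV: "openin T U" "openin T V" "q \<in> U" "q' \<in> V" "disjnt U V"
          using T unfolding Hausdorff_space_def by metis
        \<comment> \<open>If \<open>q\<close> were moved, \<open>f\<close> would carry this
          neighbourhood of \<open>q\<close> into a set disjoint from \<open>U\<close>, so it could
          contain no fixed point; but \<open>q\<close> is a limit of fixed points.\<close>
        let ?N = "U \<inter> f\<inverse> `` V \<inter> A"
        have "openin T ?N"
          using UV A f unfolding local_homeo_def by blast
        moreover have "q \<in> ?N"
          using UV q q' by blast
        moreover have "q \<in> T closure_of ?F"
          using True q by blast
        ultimately have "?N \<inter> ?F \<noteq> {}"
          using openin_Int_closure_of_eq_empty by blast
        then obtain s v where "s \<in> U" "(s, s) \<in> f" "(s, v) \<in> f" "v \<in> V"
          by blast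
        moreover have "single_valued f"
          using f unfolding local_homeo_def by simp
        ultimately have "s = v"
          by (meson single_valuedD)
        then show False
          using UV(5) \<open>s \<in> U\<close> \<open>v \<in> V\<close> by (auto simp: disjnt_def)
      qed
    qed
    moreover have "openin T (A \<inter> Domain f)"
      using A open_Domain_local_homeo[OF f] by blast
    ultimately have "A \<inter> Domain f \<subseteq> T interior_of ?F"
      by (rule interior_of_maximal)
    then show ?thesis
      using p unfolding regular_points_def by blast
  qed
qed

text \<open>A fixed point cannot lie in the exterior part of \<open>regular_points\<close>, so it is
  interior to the fixed point set.\<close>

lemma regular_points_trivial_germ:
  assumes f: "local_homeo T f" and q: "q \<in> regular_points T f" "(q, q) \<in> f"
  shows "\<exists>V. openin T V \<and> q \<in> V \<and> f \<inter> V \<times> UNIV = Id_on (topspace T) \<inter> V \<times> UNIV"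
proof (intro exI conjI)
  let ?V = "T interior_of {q. (q, q) \<in> f}"
  show "openin T ?V" by simp
  have "{q. (q, q) \<in> f} \<subseteq> topspace T"
    using f unfolding local_homeo_def by blast
  then have "{q. (q, q) \<in> f} \<subseteq> T closure_of {q. (q, q) \<in> f}"
    by (rule closure_of_subset)
  then show "q \<in> ?V"
    using q unfolding regular_points_def by blast
  have "?V \<subseteq> {q. (q, q) \<in> f}"
    by (rule interior_of_subset)
  then show "f \<inter> ?V \<times> UNIV = Id_on (topspace T) \<inter> ?V \<times> UNIV"
    using f unfolding local_homeo_def single_valued_def by blast
qed

section \<open>Germs of holonomy and generic triviality\<close>

context regular_foliation
begin

abbreviation "H \<equiv> holonomy_pseudogroup \<U>"

abbreviation "transitions \<equiv> {transition c d | c d. c \<in> \<U> \<and> d \<in> \<U>}"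

lemma transition_iff:
  "(s, t) \<in> transition c d \<longleftrightarrow> (\<exists>x. x \<in> chart_dom c \<and> x \<in> chart_dom d \<and>
     s = (c, chart_proj c x) \<and> t = (d, chart_proj d x))"
  unfolding transition_def by auto

lemma converse_transition: "(transition c d)\<inverse> = transition d c"
  by (auto simp: transition_iff)

lemma single_valued_transition: "c \<in> \<U> \<Longrightarrow> d \<in> \<U> \<Longrightarrow> single_valued (transition c d)"
  unfolding single_valued_def transition_iff using chart_transition_unique[of c d]
  by (metis prod.inject)

lemma open_transition_Image:
  assumes c: "c \<in> \<U>" and d: "d \<in> \<U>" and V: "openin T V"
  shows "openin T (transition c d `` V)"
proof -
  let ?A = "{x \<in> chart_dom c. (c, chart_proj c x) \<in> V} \<inter> chart_dom d"
  have "transition c d `` V = {d} \<times> chart_proj d ` ?A"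
    by (auto simp: transition_def)
  moreover have "openin (chart_trans d) (chart_proj d ` ?A)"
    using open_vimage_transversal[OF c V] open_chart_dom[OF chart[OF d]]
    by (intro open_chart_proj_image[OF chart[OF d]]) auto
  ultimately show ?thesis
    using openin_transversal_slice[OF d] by simp
qed

lemma local_homeo_transition:
  assumes "c \<in> \<U>" "d \<in> \<U>"
  shows "local_homeo T (transition c d)"
  unfolding local_homeo_def converse_transition
  using assms open_transition_Image single_valued_transition plaque_in_transversal
  by (auto simp: transition_iff)

lemma H_local_homeo: "f \<in> H \<Longrightarrow> local_homeo T f"
  unfolding holonomy_pseudogroup_def
  by (rule pseudogroup_local_homeo) (auto intro: local_homeo_transition)

lemma transition_in_H: "c \<in> \<U> \<Longrightarrow> d \<in> \<U> \<Longrightarrow> transition c d \<in> H"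
  unfolding holonomy_pseudogroup_def by (rule generated_pseudogroup.generator) blast

lemma comp_in_H: "f \<in> H \<Longrightarrow> g \<in> H \<Longrightarrow> f O g \<in> H"
  unfolding holonomy_pseudogroup_def by (rule generated_pseudogroup.composition)

lemma converse_in_H: "f \<in> H \<Longrightarrow> f\<inverse> \<in> H"
  unfolding holonomy_pseudogroup_def by (rule generated_pseudogroup.inversion)

text \<open>The converse of a transition is a transition, so composites of transitions have all
  germs of \<open>H\<close>, and there are only countably many of them.\<close>

definition words :: "((('a,'n,'z) fol_chart \<times> 'z) \<times> (('a,'n,'z) fol_chart \<times> 'z)) set set" where
  "words = (\<lambda>ws. foldr (O) ws (Id_on (topspace T))) ` lists transitions"

lemma countable_words: "countable words"
proof -
  \<comment> \<open>\<open>\<U>\<close> may contain infinitely many charts with empty domain; all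
    their transitions are the empty relation.\<close>
  have "transitions \<subseteq> insert {} ((\<lambda>(c, d). transition c d) ` (charts \<times> charts))"
    by (fastforce simp: transition_def charts_def)
  then have "finite transitions"
    using finite_charts by (meson finite_SigmaI finite_imageI finite_insert finite_subset)
  then show ?thesis
    unfolding words_def using countable_lists countable_finite by blast
qed

lemma local_homeo_words: "w \<in> words \<Longrightarrow> local_homeo T w"
proof -
  have "local_homeo T (foldr (O) ws (Id_on (topspace T)))" if "ws \<in> lists transitions" for ws
    using that by (induction ws)
      (auto intro!: local_homeo_comp local_homeo_transition simp: local_homeo_Id)
  then show "w \<in> words \<Longrightarrow> local_homeo T w"
    unfolding words_def by blast
qed

lemma words_comp: "v \<in> words \<Longrightarrow> w \<in> words \<Longrightarrow> v O w \<in> words"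
proof -
  have *: "foldr (O) ws (Id_on (topspace T)) O w = foldr (O) ws w" if "w \<subseteq> topspace T \<times> topspace T" for w ws
  proof (induction ws)
    case Nil
    then show ?case using that by auto
  qed (simp add: O_assoc)
  assume "v \<in> words" and w: "w \<in> words"
  then obtain ws vs where "ws \<in> lists transitions" "v = foldr (O) ws (Id_on (topspace T))"
    and "vs \<in> lists transitions" "w = foldr (O) vs (Id_on (topspace T))"
    unfolding words_def by blast
  moreover have "w \<subseteq> topspace T \<times> topspace T"
    using local_homeo_words[OF w] unfolding local_homeo_def by blast
  ultimately have "v O w = foldr (O) (ws @ vs) (Id_on (topspace T))" "ws @ vs \<in> lists transitions"
    using * by auto
  then show "v O w \<in> words"
    unfolding words_def by blast
qed

lemma transition_in_words:
  assumes "f \<in> transitions"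
  shows "f \<in> words"
proof -
  have "f \<subseteq> topspace T \<times> topspace T"
    using assms local_homeo_transition unfolding local_homeo_def by blast
  then have "f = foldr (O) [f] (Id_on (topspace T))"
    by auto
  moreover have "[f] \<in> lists transitions"
    using assms by simp
  ultimately show ?thesis
    unfolding words_def by blast
qed

lemma Id_in_words: "Id_on (topspace T) \<in> words"
  unfolding words_def by (rule image_eqI[of _ _ "[]"]) auto

lemma words_converse: "w \<in> words \<Longrightarrow> w\<inverse> \<in> words"
proof -
  have "(foldr (O) ws (Id_on (topspace T)))\<inverse> \<in> words" if "ws \<in> lists transitions" for ws
    using that
  proof (induction ws)
    case Nil
    then show ?case
      using Id_in_words by simp
  next
    case (Cons f ws)
    then obtain c d where f: "f = transition c d" and cd: "c \<in> \<U>" "d \<in> \<U>"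
      by auto
    have "f\<inverse> \<in> transitions"
      unfolding f converse_transition using cd by blast
    then show ?case
      using Cons words_comp transition_in_words by (simp add: converse_relcomp)
  qed
  then show "w \<in> words \<Longrightarrow> w\<inverse> \<in> words"
    unfolding words_def by blast
qed

lemma H_locally_word:
  assumes "f \<in> H" "(q, q') \<in> f"
  shows "\<exists>w\<in>words. \<exists>V. openin T V \<and> q \<in> V \<and> f \<inter> V \<times> UNIV = w \<inter> V \<times> UNIV"
  using pseudogroup_locally_generated[OF local_homeo_words _ Id_in_words words_comp words_converse
      assms(1)[unfolded holonomy_pseudogroup_def] assms(2)] transition_in_words by blast

definition trivial_germs :: "('a,'n,'z) fol_chart \<times> 'z \<Rightarrow> bool" where
  "trivial_germs q \<longleftrightarrow> (\<forall>f\<in>H. (q, q) \<in> f \<longrightarrow>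
     (\<exists>V. openin T V \<and> q \<in> V \<and> f \<inter> V \<times> UNIV = Id_on (topspace T) \<inter> V \<times> UNIV))"

lemma trivial_germsD:
  assumes "trivial_germs q" "f \<in> H" "(q, q) \<in> f"
  obtains V where "openin T V" "q \<in> V" "f \<inter> V \<times> UNIV = Id_on (topspace T) \<inter> V \<times> UNIV"
  using bspec[OF assms(1)[unfolded trivial_germs_def] assms(2)] assms(3) that by auto

text \<open>A germ is encoded as the class of all members of \<open>H\<close> that agree with a
  given one near \<open>q\<close>, so two classes coincide exactly when their representatives agree
  near \<open>q\<close>.\<close>

lemma germ_group_trivial_iff:
  assumes q: "q \<in> topspace T"
  shows "germ_group T H q = {germ_in T H q (Id_on (topspace T))} \<longleftrightarrow> trivial_germs q"
proof
  assume *: "germ_group T H q = {germ_in T H q (Id_on (topspace T))}"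
  show "trivial_germs q"
    unfolding trivial_germs_def
  proof (intro ballI impI)
    fix f assume f: "f \<in> H" "(q, q) \<in> f"
    then have "germ_in T H q f = germ_in T H q (Id_on (topspace T))"
      using * unfolding germ_group_def by blast
    moreover have "f \<in> germ_in T H q f"
      using f(1) q unfolding germ_in_def by blast
    ultimately show "\<exists>V. openin T V \<and> q \<in> V \<and> f \<inter> V \<times> UNIV = Id_on (topspace T) \<inter> V \<times> UNIV"
      unfolding germ_in_def by auto
  qed
next
  assume *: "trivial_germs q"
  have "germ_in T H q f = germ_in T H q (Id_on (topspace T))" if f: "f \<in> H" "(q, q) \<in> f" for f
  proof -
    obtain V where V: "openin T V" "q \<in> V" "f \<inter> V \<times> UNIV = Id_on (topspace T) \<inter> V \<times> UNIV"
      by (rule trivial_germsD[OF * f])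
    have move: "\<exists>W. openin T W \<and> q \<in> W \<and> h' \<inter> W \<times> UNIV = g \<inter> W \<times> UNIV"
      if h: "h \<inter> V \<times> UNIV = h' \<inter> V \<times> UNIV" and W: "openin T W" "q \<in> W" "h \<inter> W \<times> UNIV = g \<inter> W \<times> UNIV"
      for g h h' W
    proof (intro exI conjI)
      show "openin T (V \<inter> W)" "q \<in> V \<inter> W"
        using V W by auto
      have "(a, b) \<in> h' \<longleftrightarrow> (a, b) \<in> g" if "a \<in> V \<inter> W" for a b
        using h W(3) that by (metis IntD1 IntD2 IntI SigmaI UNIV_I)
      then show "h' \<inter> (V \<inter> W) \<times> UNIV = g \<inter> (V \<inter> W) \<times> UNIV"
        by auto
    qed
    have "(\<exists>W. openin T W \<and> q \<in> W \<and> f \<inter> W \<times> UNIV = g \<inter> W \<times> UNIV) \<longleftrightarrow>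
        (\<exists>W. openin T W \<and> q \<in> W \<and> Id_on (topspace T) \<inter> W \<times> UNIV = g \<inter> W \<times> UNIV)" for g
      using move[OF V(3)] move[OF V(3)[symmetric]] by (intro iffI; elim exE conjE) assumption+
    then show ?thesis
      unfolding germ_in_def by simp
  qed
  moreover have "Id_on (topspace T) \<in> H" "(q, q) \<in> Id_on (topspace T)"
    using q unfolding holonomy_pseudogroup_def by (auto intro: generated_pseudogroup.identity)
  ultimately show "germ_group T H q = {germ_in T H q (Id_on (topspace T))}"
    unfolding germ_group_def by blast
qed

text \<open>Conjugation by \<open>g\<close> turns a map fixing \<open>q'\<close> into one fixing
  \<open>q\<close>, and the identity near \<open>q\<close> is carried back to the identity near
  \<open>q'\<close>.\<close>

lemma trivial_germs_transport:
  assumes g: "g \<in> H" "(q, q') \<in> g" and q: "trivial_germs q"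
  shows "trivial_germs q'"
  unfolding trivial_germs_def
proof (intro ballI impI)
  fix f assume f: "f \<in> H" "(q', q') \<in> f"
  have "g O f O g\<inverse> \<in> H"
    using f g by (intro comp_in_H converse_in_H)
  moreover have "(q, q) \<in> g O f O g\<inverse>"
    using f g by blast
  ultimately obtain V where V: "openin T V" "q \<in> V"
    "(g O f O g\<inverse>) \<inter> V \<times> UNIV = Id_on (topspace T) \<inter> V \<times> UNIV"
    by (rule trivial_germsD[OF q])
  have lh: "local_homeo T g" "local_homeo T f"
    using H_local_homeo f g by auto
  have fixed: "(p', p') \<in> f" if p': "p' \<in> g `` V" for p'
  proof -
    obtain p where p: "p \<in> V" "(p, p') \<in> g"
      using p' by blast
    then have "(p, p) \<in> g O f O g\<inverse>"
      using V(3) openin_subset[OF V(1)] by blast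
    then obtain s t where "(p, s) \<in> g" "(s, t) \<in> f" "(p, t) \<in> g"
      by blast
    moreover have "single_valued g"
      using lh(1) by (simp add: local_homeo_def)
    ultimately have "s = p'" "t = p'"
      using p(2) by (meson single_valuedD)+
    then show ?thesis
      using \<open>(s, t) \<in> f\<close> by simp
  qed
  have "openin T (g `` V)"
    using V(1) lh(1) unfolding local_homeo_def by blast
  moreover have "q' \<in> g `` V"
    using V(2) g(2) by blast
  moreover have "f \<inter> (g `` V) \<times> UNIV = Id_on (topspace T) \<inter> (g `` V) \<times> UNIV"
  proof -
    have "(p, p') \<in> f \<longleftrightarrow> (p, p') \<in> Id_on (topspace T)" if "p \<in> g `` V" for p p'
    proof -
      have "p \<in> topspace T"
        using lh(2) fixed[OF that] unfolding local_homeo_def by auto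
      moreover have "single_valued f"
        using lh(2) by (simp add: local_homeo_def)
      then have "(p, p') \<in> f \<longleftrightarrow> p' = p"
        using fixed[OF that] by (meson single_valuedD)
      ultimately show ?thesis by auto
    qed
    then show ?thesis by (rule restriction_eqI)
  qed
  ultimately show "\<exists>V. openin T V \<and> q' \<in> V \<and> f \<inter> V \<times> UNIV = Id_on (topspace T) \<inter> V \<times> UNIV"
    by blast
qed

text \<open>Within a plaque of one chart the transverse coordinate is constant; at each change of
  chart along the chain a transition is composed.\<close>

lemma holonomy_along_leaf:
  assumes "(x, y) \<in> E\<^sup>*" "c \<in> \<U>" "x \<in> chart_dom c" "d \<in> \<U>" "y \<in> chart_dom d"
  shows "\<exists>g\<in>H. ((c, chart_proj c x), (d, chart_proj d y)) \<in> g"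
  using assms(1,4,5)
proof (induction arbitrary: d rule: rtrancl_induct)
  case base
  then show ?case
    using assms(2,3) transition_in_H by (intro bexI[of _ "transition c d"]) (auto simp: transition_iff)
next
  case (step y z)
  obtain e where e: "e \<in> \<U>" "y \<in> chart_dom e" "z \<in> chart_dom e" "chart_proj e y = chart_proj e z"
    using step.hyps(2) by (rule plaque_relE)
  obtain g where g: "g \<in> H" "((c, chart_proj c x), (e, chart_proj e y)) \<in> g"
    using step.IH[OF e(1,2)] by blast
  have "((e, chart_proj e y), (d, chart_proj d z)) \<in> transition e d"
    using e step.prems by (auto simp: transition_iff)
  then show ?case
    using g comp_in_H[OF g(1) transition_in_H[OF e(1) step.prems(1)]] by blast
qed

definition no_holonomy_points :: "'a set" where
  "no_holonomy_points = {x \<in> topspace X. \<forall>c\<in>\<U>. x \<in> chart_dom c \<longrightarrow> trivial_germs (c, chart_proj c x)}"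

lemma leaf_without_holonomy_iff:
  assumes x: "x \<in> topspace X"
  shows "leaf_without_holonomy \<U> (E\<^sup>* `` {x}) \<longleftrightarrow> x \<in> no_holonomy_points"
proof -
  have "leaf_without_holonomy \<U> (E\<^sup>* `` {x}) \<longleftrightarrow>
      (\<forall>y. (x, y) \<in> E\<^sup>* \<longrightarrow> (\<forall>c\<in>\<U>. y \<in> chart_dom c \<longrightarrow> trivial_germs (c, chart_proj c y)))"
    unfolding leaf_without_holonomy_def using germ_group_trivial_iff plaque_in_transversal by auto
  also have "\<dots> \<longleftrightarrow> x \<in> no_holonomy_points"
  proof
    assume "x \<in> no_holonomy_points"
    obtain c where c: "c \<in> \<U>" "x \<in> chart_dom c"
      using x by (rule chart_at)
    have "trivial_germs (d, chart_proj d y)" if "(x, y) \<in> E\<^sup>*" "d \<in> \<U>" "y \<in> chart_dom d" for d y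
      using holonomy_along_leaf[OF that(1) c that(2,3)] trivial_germs_transport c
        \<open>x \<in> no_holonomy_points\<close> unfolding no_holonomy_points_def by blast
    then show "\<forall>y. (x, y) \<in> E\<^sup>* \<longrightarrow> (\<forall>c\<in>\<U>. y \<in> chart_dom c \<longrightarrow> trivial_germs (c, chart_proj c y))"
      by blast
  qed (use x in \<open>auto simp: no_holonomy_points_def\<close>)
  finally show ?thesis .
qed

text \<open>Every germ in \<open>H\<close> is the germ of a word, and a word fixing a regular point
  is the identity near it. So it suffices that, for each of the countably many pairs of a chart and
  a word, the transverse coordinate is a regular point.\<close>

lemma residual_no_holonomy_points: "residual_in X no_holonomy_points"
proof -
  \<comment> \<open>The exterior of the chart domain is added to obtain density in all of
    \<open>X\<close>.\<close>
  define G where "G c w = {x \<in> chart_dom c. (c, chart_proj c x) \<in> regular_points T w} \<union>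
      (topspace X - X closure_of chart_dom c)" for c w
  have G_open: "openin X (G c w)" if "c \<in> \<U>" for c w
    unfolding G_def using open_vimage_transversal[OF that open_regular_points]
    by (intro openin_Un openin_diff) auto
  have G_dense: "dense_subset X (G c w)" if c: "c \<in> \<U>" and w: "w \<in> words" for c w
    unfolding dense_subset_iff
  proof (intro allI impI)
    fix A assume A: "openin X A \<and> A \<noteq> {}"
    show "G c w \<inter> A \<noteq> {}"
    proof (cases "A \<inter> chart_dom c = {}")
      case True
      then have "A \<inter> X closure_of chart_dom c = {}"
        using A openin_Int_closure_of_eq_empty by metis
      then show ?thesis
        using A openin_subset[of X A] unfolding G_def by blast
    next
      case False
      have "openin (chart_trans c) (chart_proj c ` (A \<inter> chart_dom c))"
        using A open_chart_dom[OF chart[OF c]] by (intro open_chart_proj_image[OF chart[OF c]]) auto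
      then have "openin T ({c} \<times> chart_proj c ` (A \<inter> chart_dom c))"
        by (rule openin_transversal_slice[OF c])
      \<comment> \<open>Chart projections are open, so density in the transversal gives density in
        the chart.\<close>
      then have "regular_points T w \<inter> ({c} \<times> chart_proj c ` (A \<inter> chart_dom c)) \<noteq> {}"
        using dense_regular_points[OF local_homeo_words[OF w] Hausdorff_transversal] False
        unfolding dense_subset_iff by simp
      then show ?thesis
        unfolding G_def by auto
    qed
  qed
  show ?thesis
    unfolding residual_in_def
  proof (intro exI conjI)
    let ?\<G> = "(\<lambda>(c, w). G c w) ` (charts \<times> words)"
    show "countable ?\<G>"
      using finite_charts countable_words by (intro countable_image countable_SIGMA) (auto intro: countable_finite)
    show "\<forall>A\<in>?\<G>. openin X A \<and> dense_subset X A"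
      using G_open G_dense by (auto simp: charts_def)
    show "topspace X \<inter> \<Inter>?\<G> \<subseteq> no_holonomy_points"
    proof
      fix x assume x: "x \<in> topspace X \<inter> \<Inter>?\<G>"
      have "trivial_germs (c, chart_proj c x)" if c: "c \<in> \<U>" "x \<in> chart_dom c" for c
        unfolding trivial_germs_def
      proof (intro ballI impI)
        let ?q = "(c, chart_proj c x)"
        fix f assume f: "f \<in> H" "(?q, ?q) \<in> f"
        obtain w V where w: "w \<in> words" "openin T V" "?q \<in> V" "f \<inter> V \<times> UNIV = w \<inter> V \<times> UNIV"
          using H_locally_word[OF f] by blast
        have "(?q, ?q) \<in> w"
          using f(2) w(3,4) by blast
        moreover have "x \<in> G c w"
          using x c w(1) by (auto simp: charts_def)
        then have "?q \<in> regular_points T w"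
          using c closure_of_subset[OF chart_dom_subset_topspace[OF chart[OF c(1)]]]
          unfolding G_def by blast
        ultimately obtain V' where V': "openin T V'" "?q \<in> V'"
          "w \<inter> V' \<times> UNIV = Id_on (topspace T) \<inter> V' \<times> UNIV"
          using regular_points_trivial_germ[OF local_homeo_words[OF w(1)], of ?q] by auto
        show "\<exists>V. openin T V \<and> ?q \<in> V \<and> f \<inter> V \<times> UNIV = Id_on (topspace T) \<inter> V \<times> UNIV"
        proof (intro exI conjI)
          show "openin T (V \<inter> V')" "?q \<in> V \<inter> V'"
            using w V' by auto
          have "f \<inter> (V \<inter> V') \<times> UNIV = (f \<inter> V \<times> UNIV) \<inter> V' \<times> UNIV"
            by auto
          also have "\<dots> = (w \<inter> V' \<times> UNIV) \<inter> V \<times> UNIV"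
            unfolding w(4) by auto
          also have "\<dots> = Id_on (topspace T) \<inter> (V \<inter> V') \<times> UNIV"
            unfolding V'(3) by auto
          finally show "f \<inter> (V \<inter> V') \<times> UNIV = Id_on (topspace T) \<inter> (V \<inter> V') \<times> UNIV" .
        qed
      qed
      then show "x \<in> no_holonomy_points"
        using x by (auto simp: no_holonomy_points_def)
    qed
  qed
qed

end

section \<open>Semicontinuity along leaves without holonomy\<close>

context regular_foliation
begin

text \<open>
  The plaques of \<open>c\<close> may accumulate on the boundary of \<open>chart_dom c\<close>, so a limit of chains
  of plaques need not be a chain of plaques. Steps inside relatively compact pieces of the chart domains
  do converge to pairs of points with a common plaque.
\<close>

definition shrinking :: "(('a,'n,'z) fol_chart \<times> 'a set) set \<Rightarrow> bool" where
  "shrinking J \<longleftrightarrow> finite J \<and> topspace X \<subseteq> (\<Union>(e, O')\<in>J. O') \<and>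
     (\<forall>(e, O')\<in>J. e \<in> \<U> \<and> openin X O' \<and> X closure_of O' \<subseteq> chart_dom e)"

definition short_step :: "(('a,'n,'z) fol_chart \<times> 'a set) set \<Rightarrow> ('a \<times> 'a) set" where
  "short_step J = {(x, y). \<exists>(e, O')\<in>J. x \<in> O' \<and> y \<in> O' \<and> chart_proj e x = chart_proj e y}"

lemma short_stepI:
  "(e, O') \<in> J \<Longrightarrow> x \<in> O' \<Longrightarrow> y \<in> O' \<Longrightarrow> chart_proj e x = chart_proj e y \<Longrightarrow> (x, y) \<in> short_step J"
  unfolding short_step_def by blast

text \<open>Members of \<open>I\<close> are holonomy maps tagged with the chart in which they end.
  Each is realized by a chain starting at \<open>x\<close> itself; hence the number of their
  distinct values at \<open>x\<close> is at most \<open>plaque_count k x\<close>.\<close>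

definition transports ::
  "nat \<Rightarrow> ('a,'n,'z) fol_chart \<Rightarrow> 'a \<Rightarrow>
   (('a,'n,'z) fol_chart \<times> ((('a,'n,'z) fol_chart \<times> 'z) \<times> (('a,'n,'z) fol_chart \<times> 'z)) set) set \<Rightarrow> bool" where
  "transports k c x I \<longleftrightarrow> finite I \<and> (\<forall>(e, f)\<in>I. e \<in> \<U> \<and> f \<in> H \<and>
     (\<exists>x'. x' \<in> chart_dom e \<and> (x, x') \<in> E ^^ k \<and> ((c, chart_proj c x), (e, chart_proj e x')) \<in> f))"

definition reached_by ::
  "('a,'n,'z) fol_chart \<Rightarrow> 'a \<Rightarrow> 'a \<Rightarrow>
   (('a,'n,'z) fol_chart \<times> ((('a,'n,'z) fol_chart \<times> 'z) \<times> (('a,'n,'z) fol_chart \<times> 'z)) set) set \<Rightarrow> bool" where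
  "reached_by c y y' I \<longleftrightarrow> (\<exists>(e, f)\<in>I. y' \<in> chart_dom e \<and> ((c, chart_proj c y), (e, chart_proj e y')) \<in> f)"

lemma shrinking_exists: "\<exists>J. shrinking J"
proof -
  have nb: "neighbourhood_base_of (closedin X) X"
    using compact_Hausdorff_imp_regular_space[OF compact_X Hausdorff_X]
    by (simp add: neighbourhood_base_of_closedin)
  have "\<exists>e O'. e \<in> \<U> \<and> openin X O' \<and> x \<in> O' \<and> X closure_of O' \<subseteq> chart_dom e" if x: "x \<in> topspace X" for x
  proof -
    obtain e where e: "e \<in> \<U>" "x \<in> chart_dom e"
      using x by (rule chart_at)
    obtain O' K where "openin X O'" "closedin X K" "x \<in> O'" "O' \<subseteq> K" "K \<subseteq> chart_dom e"
      using nb open_chart_dom[OF chart[OF e(1)]] e(2) unfolding neighbourhood_base_of by metis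
    then have "X closure_of O' \<subseteq> chart_dom e"
      by (meson closure_of_minimal order_trans)
    then show ?thesis
      using e(1) \<open>openin X O'\<close> \<open>x \<in> O'\<close> by blast
  qed
  then obtain e O' where eO: "\<And>x. x \<in> topspace X \<Longrightarrow>
      e x \<in> \<U> \<and> openin X (O' x) \<and> x \<in> O' x \<and> X closure_of O' x \<subseteq> chart_dom (e x)"
    by metis
  have "compactin X (topspace X)"
    using compact_X by (simp add: compact_space_def)
  then obtain F where F: "finite F" "F \<subseteq> topspace X" "topspace X \<subseteq> (\<Union>x\<in>F. O' x)"
    by (rule compactin_point_cover[where V = O']) (use eO in auto)
  have "shrinking ((\<lambda>x. (e x, O' x)) ` F)"
    unfolding shrinking_def using F eO by auto
  then show ?thesis ..
qed

context
  fixes J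
  assumes J: "shrinking J"
begin

lemma short_step_refl: "x \<in> topspace X \<Longrightarrow> (x, x) \<in> short_step J"
  using J unfolding shrinking_def short_step_def by fastforce

lemma short_step_subset: "short_step J \<subseteq> topspace X \<times> topspace X"
  using J openin_subset unfolding shrinking_def short_step_def by fastforce

lemma short_step_relpow_mono:
  assumes x: "x \<in> topspace X" and xy: "(x, y) \<in> short_step J ^^ j" and "j \<le> k"
  shows "(x, y) \<in> short_step J ^^ k"
proof -
  have y: "y \<in> topspace X"
    using x xy short_step_subset by (cases j) auto
  have "(x, y) \<in> short_step J ^^ (j + i)" for i
    by (induction i) (use xy short_step_refl[OF y] in auto)
  then show ?thesis
    using assms(3) by (metis le_iff_add)
qed

text \<open>A box around \<open>x\<close> in the coordinates of \<open>d\<close> fits into a single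
  piece \<open>O'\<close>, and within it a common coordinate in \<open>d\<close> forces one in
  \<open>e\<close>. The chart \<open>d\<close> ranges over the maximal atlas because the lemma is
  applied to the enlargements of the charts in \<open>\<U>\<close>.\<close>

lemma short_step_neighbourhood:
  assumes d: "d \<in> foliated_charts X \<A>" and x: "x \<in> chart_dom d"
  shows "\<exists>A \<epsilon>. openin X A \<and> x \<in> A \<and> 0 < \<epsilon> \<and> A \<subseteq> chart_dom d \<and>
    (\<forall>p\<in>A. \<forall>p'\<in>chart_dom d. chart_proj d p' = chart_proj d p \<longrightarrow>
      dist (fst (chart_map d p)) (fst (chart_map d p')) < \<epsilon> \<longrightarrow> (p, p') \<in> short_step J)"
proof -
  note pd = foliated_chart_imp_product_chart[OF d]
  have "x \<in> topspace X"
    using x chart_dom_subset_topspace[OF pd] by blast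
  then obtain e O' where eO: "(e, O') \<in> J" "x \<in> O'"
    using J unfolding shrinking_def by auto
  then have e: "e \<in> \<U>" "openin X O'" "X closure_of O' \<subseteq> chart_dom e"
    using J unfolding shrinking_def by auto
  then have "x \<in> chart_dom e"
    using closure_of_subset[OF openin_subset[OF e(2)]] eO(2) by blast
  then obtain N h where N: "openin X N" "x \<in> N" "N \<subseteq> chart_dom d \<inter> chart_dom e"
    and h: "\<And>p. p \<in> N \<Longrightarrow> chart_proj e p = h (chart_proj d p)"
    using local_transverse_map[OF atlas d foliated_chart[OF e(1)] x] by metis
  have "openin (prod_topology (top_of_set (chart_ball d)) (chart_trans d)) (chart_map d ` (N \<inter> O'))"
    using N e(2) by (intro open_chart_map_image[OF pd]) auto
  moreover have "(fst (chart_map d x), snd (chart_map d x)) \<in> chart_map d ` (N \<inter> O')"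
    using N(2) eO(2) by simp
  ultimately obtain U V where UV: "openin (top_of_set (chart_ball d)) U" "openin (chart_trans d) V"
    "fst (chart_map d x) \<in> U" "snd (chart_map d x) \<in> V" "U \<times> V \<subseteq> chart_map d ` (N \<inter> O')"
    unfolding openin_prod_topology_alt by meson
  have "open U"
    using UV(1) open_chart_ball[OF pd] openin_open_eq by blast
  then obtain r where r: "r > 0" "ball (fst (chart_map d x)) r \<subseteq> U"
    using UV(3) open_contains_ball by metis
  \<comment> \<open>Half the radius is kept in reserve, so that \<open>p'\<close> within
    \<open>r/2\<close> of \<open>p\<close> still lies in the box.\<close>
  define A where "A = {p \<in> chart_dom d. chart_map d p \<in> (chart_ball d \<inter> ball (fst (chart_map d x)) (r/2)) \<times> V}"
  have "openin X A"
    unfolding A_def using UV(2)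
    by (intro open_chart_map_vimage[OF pd]) (simp add: openin_prod_Times_iff openin_open_Int)
  moreover have "x \<in> A"
  proof -
    have "fst (chart_map d x) \<in> chart_ball d"
      using openin_subset[OF UV(1)] UV(3) by auto
    then show ?thesis
      using x r(1) UV(4) by (simp add: A_def mem_Times_iff)
  qed
  moreover have "(p, p') \<in> short_step J" if p: "p \<in> A" and p': "p' \<in> chart_dom d" "chart_proj d p' = chart_proj d p"
    "dist (fst (chart_map d p)) (fst (chart_map d p')) < r/2" for p p'
  proof -
    have near: "s \<in> N \<inter> O'" if s: "s \<in> chart_dom d" "fst (chart_map d s) \<in> ball (fst (chart_map d x)) r"
      "chart_proj d s \<in> V" for s
    proof -
      have "chart_map d s \<in> U \<times> V"
        using s r(2) by (auto simp: mem_Times_iff chart_proj_def)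
      then have "chart_map d s \<in> chart_map d ` (N \<inter> O')"
        by (rule subsetD[OF UV(5)])
      then obtain s' where "s' \<in> N \<inter> O'" "chart_map d s = chart_map d s'"
        by (rule imageE)
      then show ?thesis
        using inj_onD[OF inj_on_chart_map[OF pd]] s(1) N(3) by (metis IntD1 subsetD)
    qed
    have dist_p: "dist (fst (chart_map d x)) (fst (chart_map d p)) < r/2" and pV: "p \<in> chart_dom d" "chart_proj d p \<in> V"
      using p by (auto simp: A_def mem_Times_iff chart_proj_def)
    have "p \<in> N \<inter> O'"
      using dist_p pV r(1) by (intro near) auto
    moreover have "dist (fst (chart_map d x)) (fst (chart_map d p')) < r"
      using dist_p p'(3) dist_triangle[of "fst (chart_map d x)" "fst (chart_map d p')" "fst (chart_map d p)"] by simp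
    then have "p' \<in> N \<inter> O'"
      using p' pV by (intro near) auto
    ultimately show ?thesis
      using h p'(2) by (intro short_stepI[OF eO(1)]) auto
  qed
  ultimately show ?thesis
    using r(1) by (intro exI[of _ A] exI[of _ "r/2"]) (auto simp: A_def)
qed

text \<open>A Lebesgue number argument: the enlarged chart is defined on the compact closure of the
  domain, so one distance \<open>\<delta>\<close> makes a move along a plaque a short step
  everywhere. Two points of a plaque are joined by a segment in the convex ball, cut into a number
  of pieces that depends only on the radius of the ball and on \<open>\<delta>\<close>.\<close>

lemma plaque_crossed_by_short_steps:
  assumes c: "c \<in> \<U>"
  shows "\<exists>M. \<forall>y\<in>chart_dom c. \<forall>y'\<in>chart_dom c. chart_proj c y = chart_proj c y' \<longrightarrow> (y, y') \<in> short_step J ^^ M"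
proof -
  note pc = chart[OF c]
  obtain d where d: "d \<in> foliated_charts X \<A>" "chart_restriction c d" "X closure_of chart_dom c \<subseteq> chart_dom d"
    using c by (rule enlarged_chart)
  let ?K = "X closure_of chart_dom c"
  have map_eq: "chart_map d y = chart_map c y" and sub_d: "y \<in> chart_dom d" and sub_K: "y \<in> ?K"
    if "y \<in> chart_dom c" for y
    using that d(2) closure_of_subset[OF chart_dom_subset_topspace[OF pc]] by (auto simp: chart_restriction_def)
  define good where "good x A \<epsilon> \<longleftrightarrow> openin X A \<and> x \<in> A \<and> 0 < \<epsilon> \<and> A \<subseteq> chart_dom d \<and>
    (\<forall>p\<in>A. \<forall>p'\<in>chart_dom d. chart_proj d p' = chart_proj d p \<longrightarrow>
      dist (fst (chart_map d p)) (fst (chart_map d p')) < \<epsilon> \<longrightarrow> (p, p') \<in> short_step J)"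
    for x A \<epsilon>
  have "\<exists>A \<epsilon>. good x A \<epsilon>" if "x \<in> ?K" for x
  proof -
    have "x \<in> chart_dom d"
      using that d(3) by blast
    from short_step_neighbourhood[OF d(1) this] show ?thesis
      unfolding good_def .
  qed
  then have "\<forall>x. \<exists>A \<epsilon>. x \<in> ?K \<longrightarrow> good x A \<epsilon>"
    by simp
  then obtain A \<epsilon> where "\<And>x. x \<in> ?K \<Longrightarrow> good x (A x) (\<epsilon> x)"
    by metis
  note A = this[unfolded good_def]
  have "compactin X ?K"
    by (rule closedin_compact_space[OF compact_X closedin_closure_of])
  then obtain F where F: "finite F" "F \<subseteq> ?K" "?K \<subseteq> (\<Union>x\<in>F. A x)"
    by (rule compactin_point_cover[where V = A]) (use A in auto)
  \<comment> \<open>The inserted 1 keeps the minimum meaningful when \<open>F\<close> is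
    empty.\<close>
  define \<delta> where "\<delta> = Min (insert 1 (\<epsilon> ` F))"
  have \<delta>: "0 < \<delta>" "\<And>x. x \<in> F \<Longrightarrow> \<delta> \<le> \<epsilon> x"
    using F A by (auto simp: \<delta>_def)
  have step: "(p, p') \<in> short_step J"
    if p: "p \<in> ?K" "p' \<in> chart_dom d" "chart_proj d p' = chart_proj d p"
      "dist (fst (chart_map d p)) (fst (chart_map d p')) < \<delta>" for p p'
  proof -
    obtain x where x: "x \<in> F" "p \<in> A x"
      using p(1) F(3) by blast
    then have "dist (fst (chart_map d p)) (fst (chart_map d p')) < \<epsilon> x"
      using p(4) \<delta>(2) by force
    then show ?thesis
      using A[of x] x F(2) p(2,3) by blast
  qed
  obtain b\<^sub>0 r where ball: "chart_ball c = ball b\<^sub>0 r"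
    using pc unfolding product_chart_def by blast
  \<comment> \<open>The ball has diameter at most \<open>2 * r\<close>, so each of \<open>m\<close>
    equal pieces of a segment is shorter than \<open>\<delta>\<close>.\<close>
  obtain m :: nat where m: "2 * r / \<delta> < real m" "0 < m"
    using reals_Archimedean2[of "max 0 (2 * r / \<delta>)"] by auto
  have "(y, y') \<in> short_step J ^^ m"
    if y: "y \<in> chart_dom c" "y' \<in> chart_dom c" "chart_proj c y = chart_proj c y'" for y y'
  proof -
    define z where "z = chart_proj c y"
    define b where "b = fst (chart_map c y)"
    define b' where "b' = fst (chart_map c y')"
    have map_y: "chart_map c y = (b, z)" "chart_map c y' = (b', z)"
      using y(3) by (simp_all add: b_def b'_def z_def chart_proj_def prod_eq_iff)
    have bb: "b \<in> chart_ball c" "b' \<in> chart_ball c" and z: "z \<in> topspace (chart_trans c)"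
      using chart_map_image[OF pc] y(1,2) map_y by (metis imageI mem_Sigma_iff)+
    define \<beta> where "\<beta> i = (1 - real i / real m) *\<^sub>R b + (real i / real m) *\<^sub>R b'" for i
    define u where "u i = inv_into (chart_dom c) (chart_map c) (\<beta> i, z)" for i
    have \<beta>_ball: "\<beta> i \<in> chart_ball c" if "i \<le> m" for i
      unfolding \<beta>_def using that m(2) by (intro convexD[OF convex_chart_ball[OF pc] bb]) auto
    have u: "u i \<in> chart_dom c" "chart_map c (u i) = (\<beta> i, z)" if "i \<le> m" for i
      using \<beta>_ball[OF that] z chart_map_image[OF pc] unfolding u_def
      by (simp_all add: inv_into_into f_inv_into_f)
    have u_ends: "u 0 = y" "u m = y'"
      using inv_into_f_f[OF inj_on_chart_map[OF pc] y(1)] inv_into_f_f[OF inj_on_chart_map[OF pc] y(2)]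
        map_y m(2) by (simp_all add: u_def \<beta>_def)
    have "dist b b' < 2 * r"
      using bb dist_triangle2[of b b' b\<^sub>0] by (simp add: ball dist_commute)
    also have "2 * r < real m * \<delta>"
      using m(1) \<delta>(1) by (simp add: field_simps)
    finally have short: "dist b b' / real m < \<delta>"
      using m(2) by (simp add: field_simps)
    have u_step: "(u i, u (Suc i)) \<in> short_step J" if i: "i < m" for i
    proof (rule step)
      note ui = u[OF less_imp_le[OF i]] and ui' = u[OF Suc_leI[OF i]]
      show "u i \<in> ?K" "u (Suc i) \<in> chart_dom d"
        using sub_K ui(1) sub_d ui'(1) by blast+
      show "chart_proj d (u (Suc i)) = chart_proj d (u i)"
        using ui ui' map_eq by (simp add: chart_proj_def)
      have "\<beta> i - \<beta> (Suc i) = (1 / real m) *\<^sub>R (b - b')"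
        unfolding \<beta>_def using m(2)
        by (simp add: algebra_simps add_divide_distrib)
      then have "dist (\<beta> i) (\<beta> (Suc i)) = dist b b' / real m"
        by (simp add: dist_norm divide_inverse mult.commute)
      then show "dist (fst (chart_map d (u i))) (fst (chart_map d (u (Suc i)))) < \<delta>"
        using short ui ui' map_eq by simp
    qed
    have "(y, u i) \<in> short_step J ^^ i" if "i \<le> m" for i
      using that by (induction i) (use u_ends(1) u_step in auto)
    then show ?thesis
      using u_ends(2) by blast
  qed
  then show ?thesis by blast
qed

text \<open>Only finitely many charts contain points, so the number of short steps per plaque has a
  common bound. It is the factor by which \<open>plaque_count_usc\<close> enlarges the
  radius.\<close>

lemma plaque_rel_by_short_steps: "\<exists>M. \<forall>k. E ^^ k \<subseteq> short_step J ^^ (M * k)"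
proof -
  obtain M where M: "\<And>c y y'. c \<in> \<U> \<Longrightarrow> y \<in> chart_dom c \<Longrightarrow> y' \<in> chart_dom c \<Longrightarrow>
      chart_proj c y = chart_proj c y' \<Longrightarrow> (y, y') \<in> short_step J ^^ M c"
    using plaque_crossed_by_short_steps by metis
  define N where "N = Max (M ` charts)"
  have E_N: "E \<subseteq> short_step J ^^ N"
  proof clarify
    fix y y' assume "(y, y') \<in> E"
    then obtain c where c: "c \<in> \<U>" "y \<in> chart_dom c" "y' \<in> chart_dom c" "chart_proj c y = chart_proj c y'"
      by (rule plaque_relE)
    then have "c \<in> charts"
      by (auto simp: charts_def)
    then have "M c \<le> N"
      unfolding N_def using finite_charts by simp
    then show "(y, y') \<in> short_step J ^^ N"
      using short_step_relpow_mono[OF dom_in_topspace[OF c(1,2)] M[OF c]] by blast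
  qed
  have "E ^^ k \<subseteq> short_step J ^^ (N * k)" for k
  proof (induction k)
    case (Suc k)
    have "E ^^ Suc k \<subseteq> short_step J ^^ (N * k) O short_step J ^^ N"
      using Suc E_N by auto
    also have "\<dots> = short_step J ^^ (N * Suc k)"
      by (metis add.commute mult_Suc_right relpow_add)
    finally show ?case .
  qed simp
  then show ?thesis by blast
qed

text \<open>
  One short step through \<open>(e, O')\<close>: the points of \<open>X closure_of O'\<close> in the \<open>e\<close>-plaque of \<open>x\<close>
  form a compact set, so finitely many of the neighbourhoods given by the induction hypothesis
  cover it, and hence cover the corresponding sets for all \<open>y\<close> close to \<open>x\<close>.
\<close>

lemma transports_step:
  assumes IH: "\<And>x c. c \<in> \<U> \<Longrightarrow> x \<in> chart_dom c \<Longrightarrow> \<exists>V I. openin X V \<and> x \<in> V \<and> V \<subseteq> chart_dom c \<and>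
      transports k c x I \<and> (\<forall>y\<in>V. \<forall>y'. (y, y') \<in> short_step J ^^ k \<longrightarrow> reached_by c y y' I)"
    and c: "c \<in> \<U>" "x \<in> chart_dom c" and e: "(e, O') \<in> J"
  shows "\<exists>V I. openin X V \<and> x \<in> V \<and> transports (Suc k) c x I \<and>
    (\<forall>y\<in>V \<inter> chart_dom c. \<forall>w y'. y \<in> O' \<and> w \<in> O' \<and> chart_proj e y = chart_proj e w \<and>
       (w, y') \<in> short_step J ^^ k \<longrightarrow> reached_by c y y' I)"
proof -
  have eU: "e \<in> \<U>" and O_open: "openin X O'" and O_cl: "X closure_of O' \<subseteq> chart_dom e"
    using J e unfolding shrinking_def by auto
  have O_sub: "O' \<subseteq> X closure_of O'"
    using closure_of_subset[OF openin_subset[OF O_open]] .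
  show ?thesis
  proof (cases "x \<in> X closure_of O'")
    case False
    \<comment> \<open>Near such an \<open>x\<close> no step through \<open>O'\<close> begins, so the
      empty family of maps suffices.\<close>
    have "openin X (topspace X - X closure_of O')"
      by (rule openin_diff) auto
    moreover have "x \<in> topspace X - X closure_of O'"
      using False dom_in_topspace[OF c] by blast
    moreover have "transports (Suc k) c x {}"
      by (simp add: transports_def)
    ultimately show ?thesis
      using O_sub by (intro exI[of _ "topspace X - X closure_of O'"] exI[of _ "{}"]) blast
  next
    case True
    then have xe: "x \<in> chart_dom e"
      using O_cl by blast
    note pe = chart[OF eU]
    let ?z = "chart_proj e x"
    define C where "C = X closure_of O' - {p \<in> chart_dom e. chart_proj e p \<in> topspace (chart_trans e) - {?z}}"
    have "closedin (chart_trans e) {?z}"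
      using Hausdorff_chart_trans[OF pe] chart_proj_in_trans[OF pe xe]
      by (simp add: closedin_Hausdorff_sing_eq)
    then have "openin (chart_trans e) (topspace (chart_trans e) - {?z})"
      by blast
    then have "closedin X C"
      unfolding C_def by (intro closedin_diff open_chart_proj_vimage[OF pe]) auto
    then have C_compact: "compactin X C"
      by (rule closedin_compact_space[OF compact_X])
    have C_iff: "p \<in> C \<longleftrightarrow> p \<in> X closure_of O' \<and> chart_proj e p = ?z" for p
      using O_cl chart_proj_in_trans[OF pe] by (auto simp: C_def)
    have "\<exists>c' V I. c' \<in> \<U> \<and> p \<in> chart_dom c' \<and> openin X V \<and> p \<in> V \<and> V \<subseteq> chart_dom c' \<and>
      transports k c' p I \<and> (\<forall>y\<in>V. \<forall>y'. (y, y') \<in> short_step J ^^ k \<longrightarrow> reached_by c' y y' I)" if "p \<in> C" for p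
    proof -
      have "p \<in> topspace X"
        using that C_iff O_cl dom_in_topspace[OF eU] by blast
      then obtain c' where "c' \<in> \<U>" "p \<in> chart_dom c'"
        by (rule chart_at)
      then show ?thesis
        using IH[of c' p] by blast
    qed
    then obtain c' V I where cVI: "\<And>p. p \<in> C \<Longrightarrow> c' p \<in> \<U> \<and> p \<in> chart_dom (c' p) \<and> openin X (V p) \<and> p \<in> V p \<and>
      V p \<subseteq> chart_dom (c' p) \<and> transports k (c' p) p (I p) \<and>
      (\<forall>y\<in>V p. \<forall>y'. (y, y') \<in> short_step J ^^ k \<longrightarrow> reached_by (c' p) y y' (I p))"
      by metis
    obtain F where F: "finite F" "F \<subseteq> C" "C \<subseteq> (\<Union>p\<in>F. V p)"
      by (rule compactin_point_cover[OF C_compact, of V]) (use cVI in auto)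
    \<comment> \<open>Tube argument: the part missed by the chosen neighbourhoods is compact, so its
      projection is closed, and it avoids \<open>?z\<close>. For \<open>y\<close> in
      \<open>W\<close>, every point of \<open>O'\<close> with the same coordinate in
      \<open>e\<close> lies in some \<open>V p\<close>.\<close>
    let ?R = "X closure_of O' - (\<Union>p\<in>F. V p)"
    have "openin X (\<Union>p\<in>F. V p)"
      using F cVI by (intro openin_Union) auto
    then have "closedin X ?R"
      by (intro closedin_diff) auto
    then have "compactin X ?R"
      by (rule closedin_compact_space[OF compact_X])
    then have R_closed: "closedin (chart_trans e) (chart_proj e ` ?R)"
      using O_cl by (intro closed_chart_proj_image[OF pe]) auto
    define W where "W = {p \<in> chart_dom e. chart_proj e p \<in> topspace (chart_trans e) - chart_proj e ` ?R}"
    have W_open: "openin X W"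
      unfolding W_def using R_closed by (intro open_chart_proj_vimage[OF pe]) blast
    have "?z \<notin> chart_proj e ` ?R"
    proof
      assume "?z \<in> chart_proj e ` ?R"
      then obtain p where p: "p \<in> ?R" "chart_proj e p = ?z" by force
      then have "p \<in> C"
        using C_iff by blast
      then show False
        using p(1) F(3) by blast
    qed
    then have xW: "x \<in> W"
      using xe chart_proj_in_trans[OF pe xe] by (simp add: W_def)
    \<comment> \<open>The step inside \<open>e\<close> keeps the transverse coordinate, so the new
      maps pass from \<open>c\<close> to \<open>e\<close>, then to the chart at \<open>p\<close>,
      and continue with the maps supplied there.\<close>
    define K where "K = (\<Union>p\<in>F. (\<lambda>(e', f). (e', transition c e O transition e (c' p) O f)) ` I p)"
    have "transports (Suc k) c x K"
      unfolding transports_def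
    proof (intro conjI ballI)
      show "finite K"
        unfolding K_def using F cVI by (auto simp: transports_def)
      fix t assume "t \<in> K"
      then obtain p e' f where p: "p \<in> F" "(e', f) \<in> I p"
        and t: "t = (e', transition c e O transition e (c' p) O f)"
        unfolding K_def by auto
      have pC: "p \<in> C"
        using p(1) F(2) by blast
      note cVIp = cVI[OF pC]
      obtain x' where x': "e' \<in> \<U>" "f \<in> H" "x' \<in> chart_dom e'" "(p, x') \<in> E ^^ k"
        "((c' p, chart_proj (c' p) p), (e', chart_proj e' x')) \<in> f"
        using cVIp p(2) unfolding transports_def by blast
      have pe': "p \<in> chart_dom e" "chart_proj e p = ?z"
        using pC C_iff O_cl by auto
      have "(x, p) \<in> E"
        using plaque_relI[OF eU xe pe'(1)] pe'(2) by simp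
      then have "(x, x') \<in> E ^^ Suc k"
        using x'(4) by (rule relpow_Suc_I2)
      moreover have "((c, chart_proj c x), (e, ?z)) \<in> transition c e"
        using c xe by (auto simp: transition_iff)
      moreover have "((e, ?z), (c' p, chart_proj (c' p) p)) \<in> transition e (c' p)"
        using pe' cVIp by (auto simp: transition_iff)
      ultimately have "((c, chart_proj c x), (e', chart_proj e' x')) \<in> transition c e O transition e (c' p) O f"
        "(x, x') \<in> E ^^ Suc k"
        using x'(5) by blast+
      moreover have "transition c e O transition e (c' p) O f \<in> H"
        using x'(2) cVIp c eU by (intro comp_in_H transition_in_H) auto
      ultimately show "case t of (e, f) \<Rightarrow> e \<in> \<U> \<and> f \<in> H \<and>
          (\<exists>x'. x' \<in> chart_dom e \<and> (x, x') \<in> E ^^ Suc k \<and> ((c, chart_proj c x), (e, chart_proj e x')) \<in> f)"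
        unfolding t using x'(1,3) by blast
    qed
    moreover have "reached_by c y y' K"
      if y: "y \<in> W \<inter> chart_dom c" "y \<in> O'" "w \<in> O'" "chart_proj e y = chart_proj e w"
        "(w, y') \<in> short_step J ^^ k" for y w y'
    proof -
      have "w \<notin> ?R"
        using y(1,4) by (auto simp: W_def)
      then obtain p where p: "p \<in> F" "w \<in> V p"
        using y(3) O_sub by blast
      have pC: "p \<in> C"
        using p(1) F(2) by blast
      note cVIp = cVI[OF pC]
      obtain e' f where f: "(e', f) \<in> I p" "y' \<in> chart_dom e'"
        "((c' p, chart_proj (c' p) w), (e', chart_proj e' y')) \<in> f"
        using cVIp p(2) y(5) unfolding reached_by_def by blast
      have ye: "y \<in> chart_dom e" "w \<in> chart_dom e" "w \<in> chart_dom (c' p)"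
        using y O_sub O_cl cVIp p(2) by auto
      have "((c, chart_proj c y), (e, chart_proj e y)) \<in> transition c e"
        using y(1) ye by (auto simp: transition_iff)
      moreover have "((e, chart_proj e y), (c' p, chart_proj (c' p) w)) \<in> transition e (c' p)"
        using y(4) ye by (auto simp: transition_iff)
      ultimately have via: "((c, chart_proj c y), (e', chart_proj e' y')) \<in> transition c e O transition e (c' p) O f"
        using f(3) by blast
      have "(e', transition c e O transition e (c' p) O f) \<in> K"
        unfolding K_def using p(1) f(1) by (auto intro!: bexI[of _ p] image_eqI[of _ _ "(e', f)"])
      then show ?thesis
        unfolding reached_by_def by (rule bexI[rotated]) (simp only: prod.case f(2) via simp_thms)
    qed
    ultimately show ?thesis
      using W_open xW by (intro exI[of _ W] exI[of _ K]) blast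
  qed
qed

text \<open>The first short step uses one of finitely many members of \<open>J\<close>, so finitely
  many neighbourhoods are intersected and finitely many families united. The induction varies
  \<open>x\<close> and \<open>c\<close>, since the remaining steps start elsewhere.\<close>

lemma transports_exist:
  assumes "c \<in> \<U>" "x \<in> chart_dom c"
  shows "\<exists>V I. openin X V \<and> x \<in> V \<and> V \<subseteq> chart_dom c \<and> transports k c x I \<and>
    (\<forall>y\<in>V. \<forall>y'. (y, y') \<in> short_step J ^^ k \<longrightarrow> reached_by c y y' I)"
  using assms
proof (induction k arbitrary: c x)
  case 0
  have "transports 0 c x {(c, transition c c)}"
    using 0 transition_in_H by (auto simp: transports_def transition_iff)
  moreover have "reached_by c y y {(c, transition c c)}" if "y \<in> chart_dom c" for y
    using that by (auto simp: reached_by_def transition_iff)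
  ultimately show ?case
    using 0 open_chart_dom[OF chart[OF 0(1)]] by (intro exI[of _ "chart_dom c"]) auto
next
  case (Suc k)
  have "\<forall>j\<in>J. \<exists>V I. openin X V \<and> x \<in> V \<and> transports (Suc k) c x I \<and>
    (\<forall>y\<in>V \<inter> chart_dom c. \<forall>w y'. y \<in> snd j \<and> w \<in> snd j \<and> chart_proj (fst j) y = chart_proj (fst j) w \<and>
       (w, y') \<in> short_step J ^^ k \<longrightarrow> reached_by c y y' I)"
    using transports_step[OF Suc.IH Suc.prems] by (metis prod.collapse)
  then obtain V I where VI: "\<And>j. j \<in> J \<Longrightarrow> openin X (V j) \<and> x \<in> V j \<and> transports (Suc k) c x (I j) \<and>
    (\<forall>y\<in>V j \<inter> chart_dom c. \<forall>w y'. y \<in> snd j \<and> w \<in> snd j \<and> chart_proj (fst j) y = chart_proj (fst j) w \<and>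
       (w, y') \<in> short_step J ^^ k \<longrightarrow> reached_by c y y' (I j))"
    by metis
  have finJ: "finite J" "J \<noteq> {}"
    using J dom_in_topspace[OF Suc.prems] unfolding shrinking_def by auto
  define W where "W = chart_dom c \<inter> (\<Inter>j\<in>J. V j)"
  have "openin X W"
    unfolding W_def using finJ VI open_chart_dom[OF chart[OF Suc.prems(1)]]
    by (intro openin_Int openin_Inter) auto
  moreover have "x \<in> W"
    using VI Suc.prems(2) by (auto simp: W_def)
  moreover have "transports (Suc k) c x (\<Union>j\<in>J. I j)"
    unfolding transports_def
  proof (intro conjI ballI)
    show "finite (\<Union>j\<in>J. I j)"
      using finJ VI by (simp add: transports_def)
    fix t assume "t \<in> (\<Union>j\<in>J. I j)"
    then obtain j where "j \<in> J" "t \<in> I j" by blast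
    then show "case t of (e, f) \<Rightarrow> e \<in> \<U> \<and> f \<in> H \<and>
          (\<exists>x'. x' \<in> chart_dom e \<and> (x, x') \<in> E ^^ Suc k \<and> ((c, chart_proj c x), (e, chart_proj e x')) \<in> f)"
      using VI[of j] unfolding transports_def by blast
  qed
  moreover have "reached_by c y y' (\<Union>j\<in>J. I j)" if y: "y \<in> W" "(y, y') \<in> short_step J ^^ Suc k" for y y'
  proof -
    obtain w where w: "(y, w) \<in> short_step J" "(w, y') \<in> short_step J ^^ k"
      using y(2) by (meson relpow_Suc_D2)
    then obtain j where j: "j \<in> J" "y \<in> snd j" "w \<in> snd j" "chart_proj (fst j) y = chart_proj (fst j) w"
      unfolding short_step_def by auto
    have "y \<in> V j \<inter> chart_dom c"
      using y(1) j(1) by (auto simp: W_def)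
    then have "reached_by c y y' (I j)"
      using VI[OF j(1)] j w(2) by blast
    then show ?thesis
      unfolding reached_by_def using j(1) by blast
  qed
  ultimately show ?case
    by (intro exI[of _ W] exI[of _ "\<Union>j\<in>J. I j"]) (auto simp: W_def)
qed

end

text \<open>The composite \<open>f O g\<inverse>\<close> fixes \<open>q\<close>, so its germ there
  is trivial: without holonomy, equal values at \<open>q\<close> mean equal germs.\<close>

lemma trivial_germs_agree:
  assumes q: "trivial_germs q" and f: "f \<in> H" "g \<in> H" "(q, t) \<in> f" "(q, t) \<in> g"
  shows "\<exists>W. openin T W \<and> q \<in> W \<and> (\<forall>p\<in>W. \<forall>s s'. (p, s) \<in> f \<longrightarrow> (p, s') \<in> g \<longrightarrow> s = s')"
proof -
  have "f O g\<inverse> \<in> H" "(q, q) \<in> f O g\<inverse>"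
    using f by (auto intro: comp_in_H converse_in_H)
  with q obtain W where W: "openin T W" "q \<in> W" "(f O g\<inverse>) \<inter> W \<times> UNIV = Id_on (topspace T) \<inter> W \<times> UNIV"
    by (rule trivial_germsD)
  have sv: "single_valued f" "single_valued g"
    using H_local_homeo f by (auto simp: local_homeo_def)
  have "s = s'" if p: "p \<in> W" "(p, s) \<in> f" "(p, s') \<in> g" for p s s'
  proof -
    have "(p, p) \<in> Id_on (topspace T) \<inter> W \<times> UNIV"
      using p(1) openin_subset[OF W(1)] by blast
    then have "(p, p) \<in> f O g\<inverse>"
      using W(3) by blast
    then obtain v where "(p, v) \<in> f" "(p, v) \<in> g"
      by blast
    then show ?thesis
      using p sv by (metis single_valuedD)
  qed
  then show ?thesis
    using W by blast
qed

text \<open>Chains of \<open>k\<close> plaques starting near \<open>x\<close> are chains of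
  \<open>M * k\<close> short steps, so their ends are values of finitely many holonomy maps.
  Distinct values at \<open>y\<close> come from maps with distinct values at \<open>x\<close>, and
  the latter are plaques meeting the ball of radius \<open>M * k\<close>. The last factor accounts
  for plaques of other charts through the same end points. \<open>M\<close> depends neither on
  \<open>x\<close> nor on \<open>k\<close>, which is essential for growth.\<close>

lemma plaque_count_usc:
  "\<exists>M. \<forall>x\<in>no_holonomy_points. \<forall>k. \<exists>V. openin X V \<and> x \<in> V \<and>
     (\<forall>y\<in>V. plaque_count k y \<le> plaque_count (M * k) x * card charts)"
proof -
  obtain J where J: "shrinking J"
    using shrinking_exists by blast
  obtain M where M: "\<And>k. E ^^ k \<subseteq> short_step J ^^ (M * k)"
    using plaque_rel_by_short_steps[OF J] by blast
  have "\<exists>V. openin X V \<and> x \<in> V \<and> (\<forall>y\<in>V. plaque_count k y \<le> plaque_count (M * k) x * card charts)"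
    if x: "x \<in> no_holonomy_points" for x k
  proof -
    have xX: "x \<in> topspace X"
      using x by (simp add: no_holonomy_points_def)
    then obtain c where c: "c \<in> \<U>" "x \<in> chart_dom c"
      by (rule chart_at)
    have q: "trivial_germs (c, chart_proj c x)"
      using x c by (simp add: no_holonomy_points_def)
    obtain V I where V: "openin X V" "x \<in> V" "V \<subseteq> chart_dom c" and I: "transports (M * k) c x I"
      and cov: "\<And>y y'. y \<in> V \<Longrightarrow> (y, y') \<in> short_step J ^^ (M * k) \<Longrightarrow> reached_by c y y' I"
      using transports_exist[OF J c] by metis
    let ?P = "plaques_meeting ((E ^^ (M * k)) `` {x})"
    have I_val: "\<exists>t\<in>?P. ((c, chart_proj c x), t) \<in> snd i" and I_H: "snd i \<in> H" if i: "i \<in> I" for i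
    proof -
      have "\<forall>(e, f)\<in>I. e \<in> \<U> \<and> f \<in> H \<and>
          (\<exists>x'. x' \<in> chart_dom e \<and> (x, x') \<in> E ^^ (M * k) \<and> ((c, chart_proj c x), (e, chart_proj e x')) \<in> f)"
        using I unfolding transports_def by simp
      then obtain e f x' where "i = (e, f)" "e \<in> \<U>" "f \<in> H" "x' \<in> chart_dom e" "(x, x') \<in> E ^^ (M * k)"
        "((c, chart_proj c x), (e, chart_proj e x')) \<in> f"
        using i by (cases i) blast
      then show "\<exists>t\<in>?P. ((c, chart_proj c x), t) \<in> snd i" "snd i \<in> H"
        by (auto simp: plaques_meeting_def)
    qed
    then obtain val where val: "\<And>i. i \<in> I \<Longrightarrow> val i \<in> ?P \<and> ((c, chart_proj c x), val i) \<in> snd i"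
      by metis
    \<comment> \<open>Each pair of maps gets its own neighbourhood; it carries a condition only if
      both maps have the same value at \<open>x\<close>.\<close>
    have "\<forall>ij\<in>I \<times> I. \<exists>W. openin T W \<and> (c, chart_proj c x) \<in> W \<and> (val (fst ij) = val (snd ij) \<longrightarrow>
        (\<forall>p\<in>W. \<forall>s s'. (p, s) \<in> snd (fst ij) \<longrightarrow> (p, s') \<in> snd (snd ij) \<longrightarrow> s = s'))"
    proof
      fix ij assume "ij \<in> I \<times> I"
      then have ij: "fst ij \<in> I" "snd ij \<in> I" by auto
      show "\<exists>W. openin T W \<and> (c, chart_proj c x) \<in> W \<and> (val (fst ij) = val (snd ij) \<longrightarrow>
        (\<forall>p\<in>W. \<forall>s s'. (p, s) \<in> snd (fst ij) \<longrightarrow> (p, s') \<in> snd (snd ij) \<longrightarrow> s = s'))"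
      proof (cases "val (fst ij) = val (snd ij)")
        case True
        then show ?thesis
          using trivial_germs_agree[OF q I_H[OF ij(1)] I_H[OF ij(2)]] val[OF ij(1)] val[OF ij(2)]
          by metis
      next
        case False
        then show ?thesis
          using plaque_in_transversal[OF c] by blast
      qed
    qed
    then obtain W where W: "\<And>i j. i \<in> I \<Longrightarrow> j \<in> I \<Longrightarrow> openin T (W (i, j)) \<and> (c, chart_proj c x) \<in> W (i, j) \<and>
        (val i = val j \<longrightarrow> (\<forall>p\<in>W (i, j). \<forall>s s'. (p, s) \<in> snd i \<longrightarrow> (p, s') \<in> snd j \<longrightarrow> s = s'))"
      unfolding bchoice_iff by (metis SigmaI fst_conv snd_conv)
    have finI: "finite I"
      using I by (simp add: transports_def)
    define V' where "V' = V \<inter> (topspace X \<inter> \<Inter>((\<lambda>ij. {y \<in> chart_dom c. (c, chart_proj c y) \<in> W ij}) ` (I \<times> I)))"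
    have "I \<noteq> {}"
      using cov[OF V(2) short_step_relpow_mono[OF J xX, of x 0]] by (auto simp: reached_by_def)
    then have "openin X V'"
      unfolding V'_def using V(1) finI W open_vimage_transversal[OF c(1)]
      by (intro openin_Int openin_Inter) auto
    moreover have "x \<in> V'"
      unfolding V'_def using V(2) W c(2) xX by auto
    moreover have "plaque_count k y \<le> plaque_count (M * k) x * card charts" if y: "y \<in> V'" for y
    proof -
      let ?q = "(c, chart_proj c y)"
      define F where "F = {t. \<exists>i\<in>I. (?q, t) \<in> snd i}"
      have "\<forall>t\<in>F. \<exists>i. i \<in> I \<and> (?q, t) \<in> snd i"
        unfolding F_def by blast
      then obtain \<iota> where \<iota>: "\<And>t. t \<in> F \<Longrightarrow> \<iota> t \<in> I \<and> (?q, t) \<in> snd (\<iota> t)"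
        by metis
      \<comment> \<open>Two values at \<open>?q\<close> whose maps have equal values at
        \<open>x\<close> coincide, since those maps agree at \<open>?q\<close>.\<close>
      have inj: "inj_on (\<lambda>t. val (\<iota> t)) F"
      proof (rule inj_onI)
        fix t t' assume t: "t \<in> F" "t' \<in> F" "val (\<iota> t) = val (\<iota> t')"
        have "?q \<in> W (\<iota> t, \<iota> t')"
          using y \<iota>[OF t(1)] \<iota>[OF t(2)] by (auto simp: V'_def)
        then show "t = t'"
          using W[of "\<iota> t" "\<iota> t'"] \<iota>[OF t(1)] \<iota>[OF t(2)] t(3) by metis
      qed
      have im: "(\<lambda>t. val (\<iota> t)) ` F \<subseteq> ?P"
        using val \<iota> by blast
      have finP: "finite ?P"
        using finite_plaques_meeting_ball(1)[OF xX] .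
      have "finite F"
        using inj_on_finite[OF inj im finP] .
      moreover have "\<exists>(e, w)\<in>F. e \<in> \<U> \<and> y' \<in> chart_dom e \<and> chart_proj e y' = w" if y': "y' \<in> (E ^^ k) `` {y}" for y'
      proof -
        have "(y, y') \<in> short_step J ^^ (M * k)" "y \<in> V"
          using y' M y by (auto simp: V'_def)
        then obtain e f where "(e, f) \<in> I" "y' \<in> chart_dom e" "(?q, (e, chart_proj e y')) \<in> f"
          using cov[of y y'] unfolding reached_by_def by blast
        moreover then have "e \<in> \<U>"
          using I unfolding transports_def by blast
        moreover have "(e, chart_proj e y') \<in> F"
          unfolding F_def using \<open>(e, f) \<in> I\<close> \<open>(?q, (e, chart_proj e y')) \<in> f\<close>
          by (intro CollectI bexI[of _ "(e, f)"]) simp_all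
        ultimately show ?thesis
          by (intro bexI[of _ "(e, chart_proj e y')"]) simp_all
      qed
      ultimately have "plaque_count k y \<le> card F * card charts"
        unfolding plaque_count_def by (rule plaques_meeting_covered(2))
      also have "card F \<le> plaque_count (M * k) x"
        unfolding plaque_count_def using card_inj_on_le[OF inj im finP] .
      finally show ?thesis by simp
    qed
    ultimately show ?thesis
      by blast
  qed
  then show ?thesis by blast
qed

end

section \<open>Growth types in terms of integer radii\<close>

text \<open>
  The index \<open>\<lceil>r\<rceil> - 1\<close> occurs because balls are defined by the strict inequality \<open>d < r\<close>.
\<close>

locale growth_function =
  fixes u :: "real \<Rightarrow> nat" and a :: "nat \<Rightarrow> nat" and N :: nat
  assumes u_le: "0 < r \<Longrightarrow> u r \<le> a (nat \<lceil>r\<rceil> - 1)"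
    and le_u: "0 < r \<Longrightarrow> a (nat \<lceil>r\<rceil> - 1) \<le> u r * N"
    and a_pos: "1 \<le> a k" and a_le: "a k \<le> N ^ Suc k"
begin

lemma N_pos: "1 \<le> N"
  using a_pos[of 0] a_le[of 0] by simp

lemma a_le_below: "k < K \<Longrightarrow> a k \<le> N ^ Suc K"
  using a_le[of k] power_increasing[of "Suc k" "Suc K" N] N_pos
  by (meson Suc_le_mono less_imp_le order_trans)

lemma u_pos: "0 < r \<Longrightarrow> 1 \<le> u r"
  using le_u[of r] a_pos[of "nat \<lceil>r\<rceil> - 1"] by (cases "u r") auto

lemma u_Suc: "u (real (Suc k)) \<le> a k" "a k \<le> u (real (Suc k)) * N"
proof -
  have "nat \<lceil>real (Suc k)\<rceil> - 1 = k"
    by (simp only: ceiling_of_nat nat_int)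
  then show "u (real (Suc k)) \<le> a k" "a k \<le> u (real (Suc k)) * N"
    using u_le[of "real (Suc k)"] le_u[of "real (Suc k)"] by simp_all
qed

lemma radius_bounds:
  assumes "0 < r"
  shows "real (nat \<lceil>r\<rceil> - 1) \<le> r" "r \<le> real (nat \<lceil>r\<rceil> - 1) + 1"
  using assms by linarith+

lemma polynomial_growth_iff:
  "polynomial_growth u \<longleftrightarrow> (\<exists>n. \<forall>k. real (a k) \<le> (real n + 1) * (real k + 1) ^ n)"
proof
  assume "polynomial_growth u"
  then obtain C :: real where C: "Limsup at_top (\<lambda>r. ereal (ln (real (u r)) / ln r)) < ereal C"
    unfolding polynomial_growth_def using ereal_dense2 by blast
  then have "\<forall>\<^sub>F r in at_top. ereal (ln (real (u r)) / ln r) < ereal C"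
    by (rule Limsup_lessD)
  then have "\<forall>\<^sub>F r in at_top. ln (real (u r)) / ln r < C"
    by simp
  then obtain R where R: "\<And>r. r \<ge> R \<Longrightarrow> ln (real (u r)) / ln r < C"
    unfolding eventually_at_top_linorder by blast
  define K where "K = nat \<lceil>max R 2\<rceil>"
  \<comment> \<open>As exponent \<open>n\<close> must dominate \<open>C\<close>; as factor it must
    bound \<open>a\<close> below \<open>K\<close> and dominate the constant \<open>N\<close>
    relating \<open>a\<close> to \<open>u\<close>. \<open>N ^ Suc K\<close> does both of the
    latter.\<close>
  define n where "n = max (nat \<lceil>C\<rceil>) (N ^ Suc K)"
  have "real (a k) \<le> (real n + 1) * (real k + 1) ^ n" for k
  proof (cases "k < K")
    case True
    then have "a k \<le> N ^ Suc K"
      by (rule a_le_below)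
    then have "real (a k) \<le> real n + 1"
      unfolding n_def by linarith
    also have "\<dots> \<le> (real n + 1) * (real k + 1) ^ n"
      by (simp add: one_le_power)
    finally show ?thesis .
  next
    case False
    let ?r = "real (Suc k)"
    have r: "?r \<ge> R" "?r > 1"
      using False unfolding K_def by linarith+
    have up: "real (u ?r) > 0"
      using u_pos[of ?r] by simp
    have "ln (real (u ?r)) < C * ln ?r"
      using R[OF r(1)] r(2) by (simp add: field_simps)
    also have "\<dots> \<le> real n * ln ?r"
    proof (rule mult_right_mono)
      show "C \<le> real n"
        unfolding n_def by linarith
    qed (use r(2) in simp)
    also have "\<dots> = ln (?r ^ n)"
      using r(2) by (simp add: ln_realpow)
    finally have "real (u ?r) < ?r ^ n"
      using up r(2) by (subst (asm) ln_less_cancel_iff) auto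
    have "real (a k) \<le> real (u ?r) * real N"
      using u_Suc(2)[of k] by (metis of_nat_le_iff of_nat_mult)
    also have "\<dots> \<le> ?r ^ n * real N"
      using \<open>real (u ?r) < ?r ^ n\<close> by (intro mult_right_mono) auto
    also have "real N \<le> real n + 1"
    proof -
      have "N \<le> N ^ Suc K"
        using N_pos by simp
      then show ?thesis
        unfolding n_def by linarith
    qed
    finally show ?thesis
      by (simp add: mult.commute add.commute mult_left_mono)
  qed
  then show "\<exists>n. \<forall>k. real (a k) \<le> (real n + 1) * (real k + 1) ^ n"
    by blast
next
  assume "\<exists>n. \<forall>k. real (a k) \<le> (real n + 1) * (real k + 1) ^ n"
  then obtain n where n: "\<And>k. real (a k) \<le> (real n + 1) * (real k + 1) ^ n"
    by blast
  have "\<forall>\<^sub>F r::real in at_top. (ln (real n + 1) + real n * ln (r + 1)) / ln r \<le> real n + 1"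
    by real_asymp
  then have "\<forall>\<^sub>F r in at_top. ereal (ln (real (u r)) / ln r) \<le> ereal (real n + 1)"
    using eventually_gt_at_top[of 1]
  proof eventually_elim
    case (elim r)
    have "real (u r) \<le> real (a (nat \<lceil>r\<rceil> - 1))"
      using u_le[of r] elim by simp
    also have "\<dots> \<le> (real n + 1) * (real (nat \<lceil>r\<rceil> - 1) + 1) ^ n"
      by (rule n)
    also have "\<dots> \<le> (real n + 1) * (r + 1) ^ n"
      using radius_bounds(1)[of r] elim by (intro mult_left_mono power_mono) auto
    finally have "ln (real (u r)) \<le> ln ((real n + 1) * (r + 1) ^ n)"
      using u_pos[of r] elim by (intro ln_mono) auto
    also have "\<dots> = ln (real n + 1) + real n * ln (r + 1)"
      using elim by (simp add: ln_mult ln_realpow)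
    finally have "ln (real (u r)) / ln r \<le> (ln (real n + 1) + real n * ln (r + 1)) / ln r"
      using elim by (intro divide_right_mono) auto
    then show ?case
      using elim by simp
  qed
  then have "Limsup at_top (\<lambda>r. ereal (ln (real (u r)) / ln r)) \<le> ereal (real n + 1)"
    by (rule Limsup_bounded)
  then show "polynomial_growth u"
    unfolding polynomial_growth_def by (rule order_le_less_trans) simp
qed

lemma eventually_ratio_bounded: "\<forall>\<^sub>F r in at_top. ereal (ln (real (u r)) / r) \<le> ereal (2 * ln (real N))"
  using eventually_gt_at_top[of 1]
proof eventually_elim
  case (elim r)
  have "real (u r) \<le> real (N ^ Suc (nat \<lceil>r\<rceil> - 1))"
    using u_le[of r] a_le[of "nat \<lceil>r\<rceil> - 1"] elim by (meson le_trans of_nat_mono zero_less_one less_trans)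
  then have "ln (real (u r)) \<le> ln (real N ^ Suc (nat \<lceil>r\<rceil> - 1))"
    using u_pos[of r] elim by (intro ln_mono) auto
  also have "\<dots> = real (Suc (nat \<lceil>r\<rceil> - 1)) * ln (real N)"
    using N_pos by (simp add: ln_realpow del: power_Suc)
  \<comment> \<open>The integer factor is at most \<open>r + 1\<close>, and
    \<open>r > 1\<close>.\<close>
  also have "\<dots> \<le> (2 * r) * ln (real N)"
    using radius_bounds(1)[of r] elim N_pos by (intro mult_right_mono) auto
  finally show ?case
    using elim by (simp add: field_simps)
qed

lemma quasi_polynomial_growth_iff:
  "quasi_polynomial_growth u \<longleftrightarrow> (\<forall>m. \<exists>n. \<forall>k. real (a k) \<le> (real n + 1) * exp (real k / (real m + 1)))"
proof
  assume *: "quasi_polynomial_growth u"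
  show "\<forall>m. \<exists>n. \<forall>k. real (a k) \<le> (real n + 1) * exp (real k / (real m + 1))"
  proof
    fix m :: nat
    have "Limsup at_top (\<lambda>r. ereal (ln (real (u r)) / r)) < ereal (1 / (real m + 1))"
      using * unfolding quasi_polynomial_growth_def by (rule order_le_less_trans) simp
    then have "\<forall>\<^sub>F r in at_top. ereal (ln (real (u r)) / r) < ereal (1 / (real m + 1))"
      by (rule Limsup_lessD)
    then have "\<forall>\<^sub>F r in at_top. ln (real (u r)) / r < 1 / (real m + 1)"
      by simp
    then obtain R where R: "\<And>r. r \<ge> R \<Longrightarrow> ln (real (u r)) / r < 1 / (real m + 1)"
      unfolding eventually_at_top_linorder by blast
    define K where "K = nat \<lceil>max R 1\<rceil>"
    \<comment> \<open>The 3 bounds \<open>exp (1 / (real m + 1))\<close>, lost between the radius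
      \<open>k + 1\<close> and the index \<open>k\<close>; \<open>N\<close> relates \<open>a\<close>
      to \<open>u\<close>, and \<open>N ^ Suc K\<close> covers the initial radii.\<close>
    define n where "n = max (3 * N) (N ^ Suc K)"
    have "real (a k) \<le> (real n + 1) * exp (real k / (real m + 1))" for k
    proof (cases "k < K")
      case True
      then have "a k \<le> N ^ Suc K"
        by (rule a_le_below)
      then have "real (a k) \<le> real n + 1"
        unfolding n_def by linarith
      also have "\<dots> \<le> (real n + 1) * exp (real k / (real m + 1))"
        by simp
      finally show ?thesis .
    next
      case False
      let ?r = "real (Suc k)"
      have r: "?r \<ge> R" "?r > 0"
        using False unfolding K_def by linarith+
      have up: "real (u ?r) > 0"
        using u_pos[of ?r] by simp
      have "ln (real (u ?r)) < ?r / (real m + 1)"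
        using R[OF r(1)] r(2) by (simp add: field_simps)
      then have "real (u ?r) < exp (?r / (real m + 1))"
        using up by (metis exp_less_mono exp_ln)
      also have "\<dots> = exp (1 / (real m + 1)) * exp (real k / (real m + 1))"
        by (simp add: exp_add[symmetric] add_divide_distrib)
      also have "\<dots> \<le> 3 * exp (real k / (real m + 1))"
      proof -
        have "exp (1 / (real m + 1)) \<le> exp 1"
          by simp
        also have "\<dots> \<le> (3 :: real)"
          by (rule exp_le)
        finally show ?thesis
          by (rule mult_right_mono) simp
      qed
      finally have "real (u ?r) * real N \<le> (3 * exp (real k / (real m + 1))) * real N"
        by (intro mult_right_mono) auto
      moreover have "real (a k) \<le> real (u ?r) * real N"
        using u_Suc(2)[of k] by (metis of_nat_le_iff of_nat_mult)
      moreover have "(3 * exp (real k / (real m + 1))) * real N \<le> (real n + 1) * exp (real k / (real m + 1))"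
      proof -
        have "3 * real N \<le> real n + 1"
          unfolding n_def by linarith
        then show ?thesis
          using mult_right_mono[of "3 * real N" "real n + 1" "exp (real k / (real m + 1))"]
          by (simp add: mult_ac)
      qed
      ultimately show ?thesis
        by linarith
    qed
    then show "\<exists>n. \<forall>k. real (a k) \<le> (real n + 1) * exp (real k / (real m + 1))"
      by blast
  qed
next
  assume *: "\<forall>m. \<exists>n. \<forall>k. real (a k) \<le> (real n + 1) * exp (real k / (real m + 1))"
  \<comment> \<open>Half of this bound is the rate; the other half absorbs the constant
    \<open>ln (real n + 1) / r\<close>.\<close>
  have bound: "Limsup at_top (\<lambda>r. ereal (ln (real (u r)) / r)) \<le> ereal (2 / (real m + 1))" for m :: nat
  proof -
    obtain n where n: "\<And>k. real (a k) \<le> (real n + 1) * exp (real k / (real m + 1))"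
      using * by blast
    have "\<forall>\<^sub>F r::real in at_top. ln (real n + 1) / r \<le> 1 / (real m + 1)"
      by real_asymp
    then have "\<forall>\<^sub>F r in at_top. ereal (ln (real (u r)) / r) \<le> ereal (2 / (real m + 1))"
      using eventually_gt_at_top[of 0]
    proof eventually_elim
      case (elim r)
      have "real (u r) \<le> real (a (nat \<lceil>r\<rceil> - 1))"
        using u_le[of r] elim by simp
      also have "\<dots> \<le> (real n + 1) * exp (real (nat \<lceil>r\<rceil> - 1) / (real m + 1))"
        by (rule n)
      also have "\<dots> \<le> (real n + 1) * exp (r / (real m + 1))"
        using radius_bounds(1)[of r] elim by (intro mult_left_mono) (auto simp: divide_right_mono)
      finally have "ln (real (u r)) \<le> ln ((real n + 1) * exp (r / (real m + 1)))"
        using u_pos[of r] elim by (intro ln_mono) auto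
      also have "\<dots> = ln (real n + 1) + r / (real m + 1)"
        by (simp add: ln_mult)
      finally have "ln (real (u r)) / r \<le> (ln (real n + 1) + r / (real m + 1)) / r"
        using elim by (intro divide_right_mono) auto
      also have "\<dots> = ln (real n + 1) / r + 1 / (real m + 1)"
        using elim by (simp add: add_divide_distrib)
      also have "\<dots> \<le> 2 / (real m + 1)"
        using elim by (simp add: add_divide_distrib[symmetric])
      finally show ?case by simp
    qed
    then show ?thesis
      by (rule Limsup_bounded)
  qed
  have "(\<lambda>m. ereal (2 / (real m + 1))) \<longlonglongrightarrow> ereal 0"
    by (intro tendsto_ereal) real_asymp
  then have "Limsup at_top (\<lambda>r. ereal (ln (real (u r)) / r)) \<le> ereal 0"
    by (rule LIMSEQ_le_const) (use bound in blast)
  then show "quasi_polynomial_growth u"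
    by (simp add: quasi_polynomial_growth_def zero_ereal_def)
qed

text \<open>The count is at most exponential, so the limit superior is always finite and only its
  sign decides.\<close>

lemma quasi_exponential_growth_iff: "quasi_exponential_growth u \<longleftrightarrow> \<not> quasi_polynomial_growth u"
proof -
  have "Limsup at_top (\<lambda>r. ereal (ln (real (u r)) / r)) \<le> ereal (2 * ln (real N))"
    using eventually_ratio_bounded by (rule Limsup_bounded)
  then have "Limsup at_top (\<lambda>r. ereal (ln (real (u r)) / r)) < \<infinity>"
    by (rule order_le_less_trans) simp
  then show ?thesis
    unfolding quasi_exponential_growth_def quasi_polynomial_growth_def by (simp add: not_le)
qed

lemma exponential_growth_iff:
  "exponential_growth u \<longleftrightarrow> (\<exists>n. \<forall>k. exp (real k / (real n + 1)) / (real n + 1) \<le> real (a k))"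
proof -
  have "Liminf at_top (\<lambda>r. ereal (ln (real (u r)) / r)) \<le> Limsup at_top (\<lambda>r. ereal (ln (real (u r)) / r))"
    by (rule Liminf_le_Limsup) simp
  also have "\<dots> \<le> ereal (2 * ln (real N))"
    using eventually_ratio_bounded by (rule Limsup_bounded)
  finally have "Liminf at_top (\<lambda>r. ereal (ln (real (u r)) / r)) < \<infinity>"
    by (rule order_le_less_trans) simp
  then have "exponential_growth u \<longleftrightarrow> 0 < Liminf at_top (\<lambda>r. ereal (ln (real (u r)) / r))"
    by (simp add: exponential_growth_def)
  also have "\<dots> \<longleftrightarrow> (\<exists>n. \<forall>k. exp (real k / (real n + 1)) / (real n + 1) \<le> real (a k))"
  proof
    assume "0 < Liminf at_top (\<lambda>r. ereal (ln (real (u r)) / r))"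
    then obtain \<epsilon> where \<epsilon>: "0 < ereal \<epsilon>" "ereal \<epsilon> < Liminf at_top (\<lambda>r. ereal (ln (real (u r)) / r))"
      using ereal_dense2 by blast
    then have "\<forall>\<^sub>F r in at_top. ereal \<epsilon> < ereal (ln (real (u r)) / r)"
      by (intro less_LiminfD)
    then have "\<forall>\<^sub>F r in at_top. \<epsilon> < ln (real (u r)) / r"
      by simp
    then obtain R where R: "\<And>r. r \<ge> R \<Longrightarrow> \<epsilon> < ln (real (u r)) / r"
      unfolding eventually_at_top_linorder by blast
    define K where "K = nat \<lceil>max R 1\<rceil>"
    \<comment> \<open>Exceeding \<open>1 / \<epsilon>\<close> makes the rate small enough; exceeding
      \<open>exp (real K)\<close> makes the comparison function at most 1 below \<open>K\<close>,
      where only \<open>a_pos\<close> is known.\<close>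
    obtain n :: nat where n: "max (1 / \<epsilon>) (exp (real K)) < real n"
      using reals_Archimedean2 by blast
    have \<epsilon>_pos: "\<epsilon> > 0"
      using \<epsilon>(1) by simp
    have n_\<epsilon>: "1 / (real n + 1) \<le> \<epsilon>"
    proof -
      have "1 / \<epsilon> \<le> real n + 1"
        using n by simp
      then show ?thesis
        using \<epsilon>_pos by (simp add: divide_le_eq mult.commute)
    qed
    have "exp (real k / (real n + 1)) / (real n + 1) \<le> real (a k)" for k
    proof (cases "k < K")
      case True
      have "real k / (real n + 1) \<le> real k"
        by (simp add: field_simps)
      also have "\<dots> \<le> real K"
        using True by simp
      finally have "exp (real k / (real n + 1)) \<le> exp (real K)"
        by simp
      also have "\<dots> \<le> real n + 1"
        using n by simp
      finally have "exp (real k / (real n + 1)) / (real n + 1) \<le> 1"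
        by simp
      then show ?thesis
        using a_pos[of k] by linarith
    next
      case False
      let ?r = "real (Suc k)"
      have r: "?r \<ge> R" "?r > 0"
        using False unfolding K_def by linarith+
      have up: "real (u ?r) > 0"
        using u_pos[of ?r] by simp
      have "real k / (real n + 1) \<le> ?r * \<epsilon>"
      proof -
        have "real k * (1 / (real n + 1)) \<le> ?r * \<epsilon>"
          using n_\<epsilon> by (intro mult_mono) auto
        then show ?thesis by simp
      qed
      also have "\<dots> \<le> ln (real (u ?r))"
        using R[OF r(1)] r(2) by (simp add: field_simps)
      finally have "exp (real k / (real n + 1)) \<le> real (u ?r)"
        using up by (metis exp_le_cancel_iff exp_ln)
      also have "\<dots> \<le> real (a k)"
        using u_Suc(1)[of k] by simp
      finally have "exp (real k / (real n + 1)) \<le> real (a k)" .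
      moreover have "exp (real k / (real n + 1)) / (real n + 1) \<le> exp (real k / (real n + 1))"
        by (simp add: divide_le_eq)
      ultimately show ?thesis by linarith
    qed
    then show "\<exists>n. \<forall>k. exp (real k / (real n + 1)) / (real n + 1) \<le> real (a k)"
      by blast
  next
    assume "\<exists>n. \<forall>k. exp (real k / (real n + 1)) / (real n + 1) \<le> real (a k)"
    then obtain n where n: "\<And>k. exp (real k / (real n + 1)) / (real n + 1) \<le> real (a k)"
      by blast
    \<comment> \<open>The factors come from \<open>r \<le> k + 1\<close>, from the lower bound for
      \<open>a\<close>, and from passing from \<open>a\<close> to \<open>u\<close>. Half of the rate
      is then spent on \<open>ln C / r\<close>.\<close>
    define C where "C = exp (1 / (real n + 1)) * (real n + 1) * real N"
    have C: "C > 0"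
      using N_pos by (simp add: C_def)
    have "\<forall>\<^sub>F r::real in at_top. ln C / r \<le> 1 / (2 * (real n + 1))"
      by real_asymp
    then have "\<forall>\<^sub>F r in at_top. ereal (1 / (2 * (real n + 1))) \<le> ereal (ln (real (u r)) / r)"
      using eventually_gt_at_top[of 0]
    proof eventually_elim
      case (elim r)
      let ?k = "nat \<lceil>r\<rceil> - 1"
      have "exp (r / (real n + 1)) \<le> exp ((real ?k + 1) / (real n + 1))"
        using radius_bounds(2)[of r] elim by (simp add: divide_right_mono)
      also have "\<dots> = exp (1 / (real n + 1)) * exp (real ?k / (real n + 1))"
        by (simp add: exp_add[symmetric] add_divide_distrib)
      also have "exp (real ?k / (real n + 1)) \<le> real (a ?k) * (real n + 1)"
        using n[of ?k] by (simp add: field_simps)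
      also have "real (a ?k) \<le> real (u r) * real N"
        using le_u[of r] elim by (metis of_nat_le_iff of_nat_mult)
      finally have "exp (r / (real n + 1)) \<le> C * real (u r)"
        by (simp add: C_def mult_ac)
      then have "ln (exp (r / (real n + 1))) \<le> ln (C * real (u r))"
        by (intro ln_mono) auto
      then have "r / (real n + 1) \<le> ln C + ln (real (u r))"
        using C u_pos[of r] elim by (simp add: ln_mult)
      then have "(r / (real n + 1)) / r \<le> (ln C + ln (real (u r))) / r"
        using elim by (intro divide_right_mono) auto
      then have "1 / (real n + 1) \<le> ln C / r + ln (real (u r)) / r"
        using elim by (simp add: add_divide_distrib)
      moreover have "1 / (real n + 1) = 1 / (2 * (real n + 1)) + 1 / (2 * (real n + 1))"
        by (simp add: field_simps)
      ultimately show ?case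
        using elim by simp
    qed
    then have "ereal (1 / (2 * (real n + 1))) \<le> Liminf at_top (\<lambda>r. ereal (ln (real (u r)) / r))"
      by (rule Liminf_bounded)
    moreover have "0 < ereal (1 / (2 * (real n + 1)))"
      by simp
    ultimately show "0 < Liminf at_top (\<lambda>r. ereal (ln (real (u r)) / r))"
      by (metis order_less_le_trans)
  qed
  finally show ?thesis .
qed

text \<open>The complementary property, an infinite limit inferior, is the one expressible by lower
  bounds: \<open>a\<close> dominates every power up to a constant.\<close>

lemma pseudo_quasi_polynomial_growth_iff:
  "pseudo_quasi_polynomial_growth u \<longleftrightarrow>
     \<not> (\<forall>m. \<exists>n. \<forall>k. (real k + 1) ^ m / (real n + 1) \<le> real (a k))"
proof -
  have "\<not> pseudo_quasi_polynomial_growth u \<longleftrightarrow> Liminf at_top (\<lambda>r. ereal (ln (real (u r)) / ln r)) = \<infinity>"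
    unfolding pseudo_quasi_polynomial_growth_def by simp
  also have "\<dots> \<longleftrightarrow> (\<forall>m. \<exists>n. \<forall>k. (real k + 1) ^ m / (real n + 1) \<le> real (a k))"
  proof
    assume *: "Liminf at_top (\<lambda>r. ereal (ln (real (u r)) / ln r)) = \<infinity>"
    show "\<forall>m. \<exists>n. \<forall>k. (real k + 1) ^ m / (real n + 1) \<le> real (a k)"
    proof
      fix m :: nat
      have "ereal (real m) < Liminf at_top (\<lambda>r. ereal (ln (real (u r)) / ln r))"
        unfolding * by simp
      then have "\<forall>\<^sub>F r in at_top. ereal (real m) < ereal (ln (real (u r)) / ln r)"
        by (rule less_LiminfD)
      then have "\<forall>\<^sub>F r in at_top. real m < ln (real (u r)) / ln r"
        by simp
      then obtain R where R: "\<And>r. r \<ge> R \<Longrightarrow> real m < ln (real (u r)) / ln r"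
        unfolding eventually_at_top_linorder by blast
      define K where "K = nat \<lceil>max R 2\<rceil>"
      \<comment> \<open>Makes the comparison function at most 1 below \<open>K\<close>.\<close>
      define n where "n = (K + 1) ^ m"
      have "(real k + 1) ^ m / (real n + 1) \<le> real (a k)" for k
      proof (cases "k < K")
        case True
        then have "(real k + 1) ^ m \<le> (real K + 1) ^ m"
          by (intro power_mono) auto
        also have "\<dots> \<le> real n + 1"
          by (simp add: n_def add.commute)
        finally have "(real k + 1) ^ m / (real n + 1) \<le> 1"
          by simp
        then show ?thesis
          using a_pos[of k] by linarith
      next
        case False
        let ?r = "real (Suc k)"
        have r: "?r \<ge> R" "?r > 1"
          using False unfolding K_def by linarith+
        have up: "real (u ?r) > 0"
          using u_pos[of ?r] by simp
        have "ln (?r ^ m) = real m * ln ?r"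
          using r(2) by (simp add: ln_realpow)
        also have "\<dots> \<le> ln (real (u ?r))"
          using R[OF r(1)] r(2) by (simp add: field_simps)
        finally have "?r ^ m \<le> real (u ?r)"
          using up r(2) by (subst (asm) ln_le_cancel_iff) auto
        also have "\<dots> \<le> real (a k)"
          using u_Suc(1)[of k] by simp
        finally have "(real k + 1) ^ m \<le> real (a k)"
          by (simp add: add.commute)
        moreover have "(real k + 1) ^ m / (real n + 1) \<le> (real k + 1) ^ m"
          by (simp add: divide_le_eq)
        ultimately show ?thesis by linarith
      qed
      then show "\<exists>n. \<forall>k. (real k + 1) ^ m / (real n + 1) \<le> real (a k)"
        by blast
    qed
  next
    assume *: "\<forall>m. \<exists>n. \<forall>k. (real k + 1) ^ m / (real n + 1) \<le> real (a k)"
    have bound: "ereal (real m) \<le> Liminf at_top (\<lambda>r. ereal (ln (real (u r)) / ln r))" for m :: nat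
    proof -
      \<comment> \<open>One degree more than \<open>m\<close> is used, to absorb
        \<open>ln C / ln r\<close>.\<close>
      obtain n where n: "\<And>k. (real k + 1) ^ Suc m / (real n + 1) \<le> real (a k)"
        using * by blast
      define C where "C = (real n + 1) * real N"
      have C: "C > 0"
        using N_pos by (simp add: C_def)
      have "\<forall>\<^sub>F r::real in at_top. ln C / ln r \<le> 1"
        by real_asymp
      then have "\<forall>\<^sub>F r in at_top. ereal (real m) \<le> ereal (ln (real (u r)) / ln r)"
        using eventually_gt_at_top[of 1]
      proof eventually_elim
        case (elim r)
        let ?k = "nat \<lceil>r\<rceil> - 1"
        have "r ^ Suc m \<le> (real ?k + 1) ^ Suc m"
          using radius_bounds(2)[of r] elim by (intro power_mono) auto
        also have "\<dots> \<le> real (a ?k) * (real n + 1)"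
          using n[of ?k] by (simp add: field_simps)
        also have "real (a ?k) \<le> real (u r) * real N"
          using le_u[of r] elim by (metis less_trans of_nat_le_iff of_nat_mult zero_less_one)
        finally have "r ^ Suc m \<le> C * real (u r)"
          by (simp add: C_def mult_ac)
        then have "ln (r ^ Suc m) \<le> ln (C * real (u r))"
          using elim by (intro ln_mono) auto
        then have "real (Suc m) * ln r \<le> ln C + ln (real (u r))"
          using C u_pos[of r] elim by (simp add: ln_mult ln_realpow del: power_Suc)
        then have "(real (Suc m) * ln r) / ln r \<le> (ln C + ln (real (u r))) / ln r"
          using elim by (intro divide_right_mono) auto
        then have "real m + 1 \<le> ln C / ln r + ln (real (u r)) / ln r"
          using elim by (simp add: add_divide_distrib)
        then have "real m \<le> ln (real (u r)) / ln r"
          using elim(1) by linarith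
        then show ?case
          by simp
      qed
      then show ?thesis
        by (rule Liminf_bounded)
    qed
    show "Liminf at_top (\<lambda>r. ereal (ln (real (u r)) / ln r)) = \<infinity>"
    proof (rule ereal_top)
      fix B :: real
      obtain m :: nat where "B \<le> real m"
        using real_arch_simple by blast
      then show "ereal B \<le> Liminf at_top (\<lambda>r. ereal (ln (real (u r)) / ln r))"
        using bound[of m] by (meson ereal_less_eq(3) order_trans)
    qed
  qed
  finally show ?thesis by blast
qed

end

section \<open>The generic growth type\<close>

lemma polynomial_bound_shift:
  "\<exists>n'. \<forall>k. (real n + 1) * (real (k + d) + 1) ^ n \<le> (real n' + 1) * (real k + 1) ^ n'"
proof (intro exI allI)
  fix k
  \<comment> \<open>From \<open>k + d + 1 \<le> (d + 1) * (k + 1)\<close>; this coefficient also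
    exceeds \<open>n\<close>, so it can serve as the exponent too.\<close>
  let ?n' = "(n + 1) * (d + 1) ^ n"
  have "n \<le> (n + 1) * 1"
    by simp
  also have "\<dots> \<le> ?n'"
    by (intro mult_le_mono2) simp
  finally have "n \<le> ?n'" .
  have "(real (k + d) + 1) ^ n \<le> ((real d + 1) * (real k + 1)) ^ n"
    by (intro power_mono) (auto simp: algebra_simps)
  then have "(real n + 1) * (real (k + d) + 1) ^ n \<le> (real n + 1) * ((real d + 1) * (real k + 1)) ^ n"
    by (intro mult_left_mono) auto
  also have "\<dots> = real ?n' * (real k + 1) ^ n"
    unfolding power_mult_distrib by (simp add: algebra_simps)
  also have "\<dots> \<le> (real ?n' + 1) * (real k + 1) ^ ?n'"
    using \<open>n \<le> ?n'\<close> by (intro mult_mono power_increasing) auto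
  finally show "(real n + 1) * (real (k + d) + 1) ^ n \<le> (real ?n' + 1) * (real k + 1) ^ ?n'" .
qed

lemma exponential_upper_bound_shift:
  "\<exists>n'. \<forall>k. (real n + 1) * exp (real (k + d) / (real m + 1)) \<le> (real n' + 1) * exp (real k / (real m + 1))"
proof -
  obtain n' :: nat where n': "(real n + 1) * exp (real d / (real m + 1)) \<le> real n'"
    using real_arch_simple by blast
  have "(real n + 1) * exp (real (k + d) / (real m + 1)) \<le> (real n' + 1) * exp (real k / (real m + 1))" for k
  proof -
    have "(real n + 1) * exp (real (k + d) / (real m + 1))
        = ((real n + 1) * exp (real d / (real m + 1))) * exp (real k / (real m + 1))"
      by (simp add: exp_add[symmetric] add_divide_distrib mult_ac)
    also have "\<dots> \<le> (real n' + 1) * exp (real k / (real m + 1))"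
      using n' by (intro mult_right_mono) auto
    finally show ?thesis .
  qed
  then show ?thesis by blast
qed

lemma exponential_lower_bound_shift:
  "\<exists>n'. (\<forall>k. exp (real (k + d) / (real n' + 1)) / (real n' + 1) \<le> exp (real k / (real n + 1)) / (real n + 1)) \<and>
    (\<forall>j<d. exp (real j / (real n' + 1)) / (real n' + 1) \<le> 1)"
proof -
  \<comment> \<open>A larger index lowers both rate and constant. The factor
    \<open>exp (real d)\<close> pays for the shift and brings the values at radii below
    \<open>d\<close> under 1.\<close>
  obtain n' :: nat where n': "(real n + 1) * exp (real d) \<le> real n'"
    using real_arch_simple by blast
  have "1 * exp (real d) \<le> (real n + 1) * exp (real d)"
    by (rule mult_right_mono) simp_all
  then have d_le: "exp (real d) \<le> real n' + 1"
    using n' by linarith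
  have "real n + 1 \<le> (real n + 1) * exp (real d)"
    using mult_left_mono[of 1 "exp (real d)" "real n + 1"] by simp
  then have n_le: "real n + 1 \<le> real n' + 1"
    using n' by linarith
  have shrink: "real j / (real n' + 1) \<le> real j" for j
    by (simp add: field_simps)
  have "exp (real (k + d) / (real n' + 1)) / (real n' + 1) \<le> exp (real k / (real n + 1)) / (real n + 1)" for k
  proof -
    have "exp (real (k + d) / (real n' + 1)) = exp (real k / (real n' + 1)) * exp (real d / (real n' + 1))"
      by (simp add: exp_add[symmetric] add_divide_distrib)
    also have "\<dots> \<le> exp (real k / (real n + 1)) * exp (real d)"
      using n_le shrink by (intro mult_mono) (auto simp: divide_left_mono)
    finally have "exp (real (k + d) / (real n' + 1)) * (real n + 1)
        \<le> exp (real k / (real n + 1)) * exp (real d) * (real n + 1)"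
      by (intro mult_right_mono) auto
    also have "\<dots> = exp (real k / (real n + 1)) * ((real n + 1) * exp (real d))"
      by simp
    also have "\<dots> \<le> exp (real k / (real n + 1)) * (real n' + 1)"
      using n' by (intro mult_left_mono) auto
    finally show ?thesis
      by (simp add: divide_le_eq pos_le_divide_eq mult_ac)
  qed
  moreover have "exp (real j / (real n' + 1)) / (real n' + 1) \<le> 1" if "j < d" for j
  proof -
    have "real j / (real n' + 1) \<le> real d"
      using shrink[of j] that by linarith
    then have "exp (real j / (real n' + 1)) \<le> exp (real d)"
      by (rule exp_le_cancel_iff[THEN iffD2])
    also note d_le
    finally show ?thesis
      by (subst divide_le_eq_1_pos) simp_all
  qed
  ultimately show ?thesis by blast
qed

lemma polynomial_lower_bound_shift:
  "\<exists>n'. (\<forall>k. (real (k + d) + 1) ^ m / (real n' + 1) \<le> (real k + 1) ^ m / (real n + 1)) \<and>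
    (\<forall>j<d. (real j + 1) ^ m / (real n' + 1) \<le> 1)"
proof (intro exI conjI allI impI)
  \<comment> \<open>The factor \<open>(d + 1) ^ m\<close> pays for the shift and bounds the powers
    at radii below \<open>d\<close>.\<close>
  let ?n' = "(n + 1) * (d + 1) ^ m"
  have "(real d + 1) ^ m \<le> (real n + 1) * (real d + 1) ^ m"
    using mult_right_mono[of 1 "real n + 1" "(real d + 1) ^ m"] by simp
  moreover have "real ?n' = (real n + 1) * (real d + 1) ^ m"
    by (simp add: algebra_simps)
  ultimately have d_le: "(real d + 1) ^ m \<le> real ?n' + 1"
    by linarith
  show "(real (k + d) + 1) ^ m / (real ?n' + 1) \<le> (real k + 1) ^ m / (real n + 1)" for k
  proof -
    have "(real (k + d) + 1) ^ m \<le> ((real d + 1) * (real k + 1)) ^ m"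
      by (intro power_mono) (auto simp: algebra_simps)
    then have "(real (k + d) + 1) ^ m * (real n + 1) \<le> ((real d + 1) * (real k + 1)) ^ m * (real n + 1)"
      by (intro mult_right_mono) auto
    also have "\<dots> = real ?n' * (real k + 1) ^ m"
      unfolding power_mult_distrib by (simp add: algebra_simps)
    also have "\<dots> \<le> (real ?n' + 1) * (real k + 1) ^ m"
      by (intro mult_right_mono) auto
    finally have "(real (k + d) + 1) ^ m * (real n + 1) \<le> (real k + 1) ^ m * (real ?n' + 1)"
      by (simp add: mult.commute)
    then have "(real (k + d) + 1) ^ m \<le> (real k + 1) ^ m / (real n + 1) * (real ?n' + 1)"
      by (subst times_divide_eq_left, subst pos_le_divide_eq) simp_all
    then show ?thesis
      by (intro mult_imp_div_pos_le) (use of_nat_0_le_iff[of ?n'] in linarith)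
  qed
  show "(real j + 1) ^ m / (real ?n' + 1) \<le> 1" if "j < d" for j
  proof (rule mult_imp_div_pos_le)
    have "(real j + 1) ^ m \<le> (real d + 1) ^ m"
      using that by (intro power_mono) auto
    from order_trans[OF this d_le] show "(real j + 1) ^ m \<le> 1 * (real ?n' + 1)"
      by (simp only: mult_1)
  qed (use of_nat_0_le_iff[of ?n'] in linarith)
qed

section \<open>Growth classes of leaves as saturated sets, and the generic type\<close>

locale transitive_regular_foliation = regular_foliation X \<A> \<U>
  for X :: "'a topology" and \<A> \<U> :: "('a,'n::finite,'z) fol_chart set" +
  assumes transitive: "transitive_foliation X \<A>"
begin

sublocale growth_system X E plaque_count
proof
  obtain L where L: "L \<in> leaves X \<A>" "dense_subset X L"
    using transitive unfolding transitive_foliation_def by blast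
  then show "\<exists>x\<in>topspace X. dense_subset X (E\<^sup>* `` {x})"
    unfolding leaves_eq by auto
qed (use compact_X Hausdorff_X plaque_count_lsc plaque_count_shift plaque_count_pos in auto)

abbreviation "growth \<equiv> plaque_growth X \<A> \<U>"

abbreviation "growth_leaves \<equiv> leaves_without_holonomy_with_growth X \<A> \<U>"

abbreviation "dense_leaves \<equiv> dense_leaves_without_holonomy X \<A> \<U>"

lemma growth_function_at: "x \<in> topspace X \<Longrightarrow> growth_function (growth x) (\<lambda>k. plaque_count k x) (card charts)"
  by unfold_locales (use plaque_growth_bounds plaque_count_pos finite_plaques_meeting_ball(2) in auto)

lemma orbit_eq: "(x, y) \<in> E\<^sup>* \<Longrightarrow> E\<^sup>* `` {x} = E\<^sup>* `` {y}"
  using sym_orbit by (auto intro: rtrancl_trans)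

lemma no_holonomy_points_saturated:
  assumes "x \<in> no_holonomy_points" "(x, y) \<in> E\<^sup>*"
  shows "y \<in> no_holonomy_points"
proof -
  have "x \<in> topspace X"
    using assms(1) by (simp add: no_holonomy_points_def)
  then show ?thesis
    using assms leaf_without_holonomy_iff orbit_eq[OF assms(2)] orbit_in_topspace by metis
qed

text \<open>Saturation of \<open>Q\<close> makes the growth property independent of the base point,
  so the quantifier over the leaf collapses to one point.\<close>

lemma growth_leaves_eq:
  assumes \<Gamma>: "\<And>x. x \<in> topspace X \<Longrightarrow> \<Gamma> (growth x) \<longleftrightarrow> x \<in> Q"
    and Q: "\<And>x y. x \<in> Q \<Longrightarrow> (x, y) \<in> E\<^sup>* \<Longrightarrow> y \<in> Q"
  shows "growth_leaves \<Gamma> = no_holonomy_points \<inter> Q"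
proof (intro set_eqI iffI)
  fix y assume "y \<in> growth_leaves \<Gamma>"
  then obtain x where x: "x \<in> topspace X" "leaf_without_holonomy \<U> (E\<^sup>* `` {x})"
    "\<forall>w\<in>E\<^sup>* `` {x}. \<Gamma> (growth w)" "(x, y) \<in> E\<^sup>*"
    unfolding leaves_without_holonomy_with_growth_def leaves_eq by auto
  then have "y \<in> topspace X" "\<Gamma> (growth y)"
    using orbit_in_topspace by auto
  then show "y \<in> no_holonomy_points \<inter> Q"
    using x leaf_without_holonomy_iff no_holonomy_points_saturated \<Gamma> by blast
next
  fix y assume y: "y \<in> no_holonomy_points \<inter> Q"
  then have yX: "y \<in> topspace X"
    by (simp add: no_holonomy_points_def)
  have "\<Gamma> (growth w)" if "w \<in> E\<^sup>* `` {y}" for w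
    using that y Q \<Gamma> orbit_in_topspace[OF _ yX] by blast
  then have "E\<^sup>* `` {y} \<in> {L \<in> leaves X \<A>. leaf_without_holonomy \<U> L \<and> (\<forall>x\<in>L. \<Gamma> (growth x))}"
    using y yX leaf_without_holonomy_iff unfolding leaves_eq by blast
  then show "y \<in> growth_leaves \<Gamma>"
    unfolding leaves_without_holonomy_with_growth_def by blast
qed

lemma dense_leavesE:
  assumes "x \<in> dense_leaves"
  shows "x \<in> topspace X" "x \<in> no_holonomy_points" "dense_subset X (E\<^sup>* `` {x})"
proof -
  obtain y where y: "y \<in> topspace X" "leaf_without_holonomy \<U> (E\<^sup>* `` {y})"
    "dense_subset X (E\<^sup>* `` {y})" "(y, x) \<in> E\<^sup>*"
    using assms unfolding dense_leaves_without_holonomy_def leaves_eq by auto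
  then show "x \<in> topspace X" "x \<in> no_holonomy_points" "dense_subset X (E\<^sup>* `` {x})"
    using orbit_in_topspace orbit_eq[OF y(4)] leaf_without_holonomy_iff no_holonomy_points_saturated
    by metis+
qed

lemma dichotomy_no_holonomy:
  assumes "meager_in X Q \<or> residual_in X Q"
  shows "meager_in X (no_holonomy_points \<inter> Q) \<or> residual_in X (no_holonomy_points \<inter> Q)"
  using assms meager_in_mono residual_in_Int[OF residual_no_holonomy_points] by blast

lemma dichotomy_complement:
  assumes "Q \<subseteq> topspace X" "meager_in X Q \<or> residual_in X Q"
  shows "meager_in X (topspace X - Q) \<or> residual_in X (topspace X - Q)"
  using assms unfolding meager_in_def by (auto simp: double_diff)

text \<open>The points without holonomy are themselves residual, so restricting to them loses
  nothing generically.\<close>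

lemma residual_if_meager_complement:
  assumes "meager_in X (no_holonomy_points \<inter> (topspace X - Q))"
  shows "residual_in X Q"
proof (rule residual_in_mono)
  show "residual_in X (no_holonomy_points \<inter> (topspace X - no_holonomy_points \<inter> (topspace X - Q)))"
    using assms residual_in_Int[OF residual_no_holonomy_points] unfolding meager_in_def by blast
  show "no_holonomy_points \<inter> (topspace X - no_holonomy_points \<inter> (topspace X - Q)) \<subseteq> Q"
    by blast
qed

definition "poly_upper = upper_set (\<lambda>n k. (real n + 1) * (real k + 1) ^ n)"

definition "exp_lower = lower_set (\<lambda>n k. exp (real k / (real n + 1)) / (real n + 1))"

definition "exp_upper m = upper_set (\<lambda>n k. (real n + 1) * exp (real k / (real m + 1)))"

definition "poly_lower m = lower_set (\<lambda>n k. (real k + 1) ^ m / (real n + 1))"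

lemmas poly_upper_dichotomy = upper_set_dichotomy[OF polynomial_bound_shift, folded poly_upper_def]

lemma exp_upper_dichotomy: "meager_in X (exp_upper m) \<or> residual_in X (exp_upper m) \<and>
    (\<forall>x. x \<in> topspace X \<and> dense_subset X (E\<^sup>* `` {x}) \<longrightarrow> x \<in> exp_upper m)"
  unfolding exp_upper_def by (rule upper_set_dichotomy[OF exponential_upper_bound_shift])

lemmas exp_lower_dichotomy = lower_set_dichotomy[OF exponential_lower_bound_shift, folded exp_lower_def]

lemmas poly_lower_dichotomy = lower_set_dichotomy[OF polynomial_lower_bound_shift, folded poly_lower_def]

lemmas poly_upper_saturated = upper_set_saturated[OF polynomial_bound_shift, folded poly_upper_def]

lemma exp_upper_saturated: "x \<in> exp_upper m \<Longrightarrow> (x, y) \<in> E\<^sup>* \<Longrightarrow> y \<in> exp_upper m"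
  unfolding exp_upper_def by (rule upper_set_saturated[OF exponential_upper_bound_shift])

lemmas exp_lower_saturated = lower_set_saturated[OF exponential_lower_bound_shift, folded exp_lower_def]

lemmas poly_lower_saturated = lower_set_saturated[OF polynomial_lower_bound_shift, folded poly_lower_def]

lemma exp_upper_Inter_saturated: "x \<in> (\<Inter>m. exp_upper m) \<Longrightarrow> (x, y) \<in> E\<^sup>* \<Longrightarrow> y \<in> (\<Inter>m. exp_upper m)"
  using exp_upper_saturated[of x _ y] by auto

lemma poly_lower_Inter_saturated: "x \<in> (\<Inter>m. poly_lower m) \<Longrightarrow> (x, y) \<in> E\<^sup>* \<Longrightarrow> y \<in> (\<Inter>m. poly_lower m)"
  using poly_lower_saturated[of x _ y] by auto

lemma polynomial_leaves: "growth_leaves polynomial_growth = no_holonomy_points \<inter> poly_upper"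
proof (rule growth_leaves_eq)
  fix x assume "x \<in> topspace X"
  then show "polynomial_growth (growth x) \<longleftrightarrow> x \<in> poly_upper"
    using growth_function.polynomial_growth_iff[OF growth_function_at]
    by (simp add: poly_upper_def upper_set_def)
qed (rule poly_upper_saturated)

lemma exponential_leaves: "growth_leaves exponential_growth = no_holonomy_points \<inter> exp_lower"
proof (rule growth_leaves_eq)
  fix x assume "x \<in> topspace X"
  then show "exponential_growth (growth x) \<longleftrightarrow> x \<in> exp_lower"
    using growth_function.exponential_growth_iff[OF growth_function_at]
    by (simp add: exp_lower_def lower_set_def)
qed (rule exp_lower_saturated)

lemma quasi_polynomial_iff:
  "x \<in> topspace X \<Longrightarrow> quasi_polynomial_growth (growth x) \<longleftrightarrow> x \<in> (\<Inter>m. exp_upper m)"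
  using growth_function.quasi_polynomial_growth_iff[OF growth_function_at]
  by (simp add: exp_upper_def upper_set_def)

lemma quasi_polynomial_leaves:
  "growth_leaves quasi_polynomial_growth = no_holonomy_points \<inter> (\<Inter>m. exp_upper m)"
  by (rule growth_leaves_eq[OF quasi_polynomial_iff exp_upper_Inter_saturated])

lemma quasi_exponential_leaves:
  "growth_leaves quasi_exponential_growth = no_holonomy_points \<inter> (topspace X - (\<Inter>m. exp_upper m))"
proof (rule growth_leaves_eq)
  fix x assume "x \<in> topspace X"
  then show "quasi_exponential_growth (growth x) \<longleftrightarrow> x \<in> topspace X - (\<Inter>m. exp_upper m)"
    using growth_function.quasi_exponential_growth_iff[OF growth_function_at] quasi_polynomial_iff by blast
next
  fix x y assume x: "x \<in> topspace X - (\<Inter>m. exp_upper m)" "(x, y) \<in> E\<^sup>*"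
  then have "y \<in> topspace X" "(y, x) \<in> E\<^sup>*"
    using orbit_in_topspace sym_orbit by auto
  then show "y \<in> topspace X - (\<Inter>m. exp_upper m)"
    using x(1) exp_upper_Inter_saturated[of y x] by auto
qed

lemma pseudo_quasi_polynomial_leaves:
  "growth_leaves pseudo_quasi_polynomial_growth = no_holonomy_points \<inter> (topspace X - (\<Inter>m. poly_lower m))"
proof (rule growth_leaves_eq)
  fix x assume "x \<in> topspace X"
  then show "pseudo_quasi_polynomial_growth (growth x) \<longleftrightarrow> x \<in> topspace X - (\<Inter>m. poly_lower m)"
    using growth_function.pseudo_quasi_polynomial_growth_iff[OF growth_function_at]
    by (simp add: poly_lower_def lower_set_def)
next
  fix x y assume x: "x \<in> topspace X - (\<Inter>m. poly_lower m)" "(x, y) \<in> E\<^sup>*"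
  then have "y \<in> topspace X" "(y, x) \<in> E\<^sup>*"
    using orbit_in_topspace sym_orbit by auto
  then show "y \<in> topspace X - (\<Inter>m. poly_lower m)"
    using x(1) poly_lower_Inter_saturated[of y x] by auto
qed

text \<open>Either all sets are residual, and countable intersections preserve this, or one of them
  is meager and the intersection with it.\<close>

lemma Inter_dichotomy:
  fixes Q :: "nat \<Rightarrow> 'a set"
  assumes "\<And>m. meager_in X (Q m) \<or> residual_in X (Q m)"
  shows "meager_in X (\<Inter>m. Q m) \<or> residual_in X (\<Inter>m. Q m)"
proof (cases "\<forall>m. residual_in X (Q m)")
  case True
  then show ?thesis
    using residual_in_Inter by blast
next
  case False
  then obtain m where "meager_in X (Q m)"
    using assms by blast
  then show ?thesis
    using meager_in_mono by (metis INT_lower UNIV_I)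
qed

text \<open>Each set of the intersection is residual, hence not meager, and
  \<open>upper_set_dichotomy\<close> then places every dense orbit in it.\<close>

lemma dense_leaves_in_exp_upper:
  assumes "residual_in X (\<Inter>m. exp_upper m)"
  shows "dense_leaves \<subseteq> (\<Inter>m. exp_upper m)"
proof
  fix x assume x: "x \<in> dense_leaves"
  have "x \<in> exp_upper m" for m
  proof -
    have "residual_in X (exp_upper m)"
      by (rule residual_in_mono[OF assms INT_lower]) simp
    then show ?thesis
      using exp_upper_dichotomy[of m] not_meager_residual[of "exp_upper m"] dense_leavesE[OF x] by auto
  qed
  then show "x \<in> (\<Inter>m. exp_upper m)"
    by blast
qed

text \<open>A dense leaf meets the open set \<open>A\<close> at some \<open>y\<close>. For each
  \<open>k\<close> the bound holds at points arbitrarily close to \<open>y\<close>, and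
  \<open>plaque_count_usc\<close> carries it to \<open>y\<close> with radius \<open>M * k\<close>.
  The linear change of radius costs a power bound only a constant.\<close>

lemma dense_leaves_in_poly_lower:
  assumes "residual_in X (\<Inter>m. poly_lower m)"
  shows "dense_leaves \<subseteq> (\<Inter>m. poly_lower m)"
proof
  fix x assume x: "x \<in> dense_leaves"
  obtain M where M: "\<And>y k. y \<in> no_holonomy_points \<Longrightarrow> \<exists>V. openin X V \<and> y \<in> V \<and>
      (\<forall>w\<in>V. plaque_count k w \<le> plaque_count (M * k) y * card charts)"
    using plaque_count_usc by blast
  have "x \<in> poly_lower m" for m
  proof -
    have "residual_in X (poly_lower m)"
      by (rule residual_in_mono[OF assms INT_lower]) simp
    then obtain n A where A: "openin X A" "A \<noteq> {}" and nA: "\<And>k V. openin X V \<Longrightarrow> V \<inter> A \<noteq> {} \<Longrightarrow>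
        \<exists>w\<in>V. (real k + 1) ^ m / (real n + 1) \<le> real (plaque_count k w)"
      using poly_lower_dichotomy[of m] not_meager_residual[of "poly_lower m"] by meson
    have "E\<^sup>* `` {x} \<inter> A \<noteq> {}"
      using dense_leavesE(3)[OF x] A unfolding dense_subset_iff by blast
    then obtain y where y: "(x, y) \<in> E\<^sup>*" "y \<in> A"
      by blast
    have y0: "y \<in> no_holonomy_points"
      using no_holonomy_points_saturated[OF dense_leavesE(2)[OF x] y(1)] .
    then have yX: "y \<in> topspace X"
      by (simp add: no_holonomy_points_def)
    define N where "N = card charts"
    \<comment> \<open>Positive even when \<open>M\<close> is 0, so radii can be divided by
      it.\<close>
    define M' where "M' = Suc M"
    have le: "(real k + 1) ^ m \<le> real (plaque_count (M * k) y * N * (n + 1))" for k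
    proof -
      obtain V where V: "openin X V" "y \<in> V" "\<And>w. w \<in> V \<Longrightarrow> plaque_count k w \<le> plaque_count (M * k) y * N"
        using M[OF y0, of k] unfolding N_def by blast
      then obtain w where w: "w \<in> V" "(real k + 1) ^ m / (real n + 1) \<le> real (plaque_count k w)"
        using nA[OF V(1), of k] y(2) by blast
      have "(real k + 1) ^ m \<le> real (plaque_count k w) * (real n + 1)"
        using w(2) by (simp add: divide_le_eq)
      also have "\<dots> \<le> real (plaque_count (M * k) y * N) * (real n + 1)"
        using V(3)[OF w(1)] by (intro mult_right_mono of_nat_mono) auto
      also have "\<dots> = real (plaque_count (M * k) y * N * (n + 1))"
        by (simp add: algebra_simps)
      finally show ?thesis .
    qed
    have "(real j + 1) ^ m / (real (M' ^ m * (N * (n + 1))) + 1) \<le> real (plaque_count j y)" for j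
    proof -
      \<comment> \<open>Then \<open>M * k \<le> j\<close> while
        \<open>j + 1 \<le> M' * (k + 1)\<close>, so the bound at \<open>k\<close> controls the
        radius \<open>j\<close> with the loss \<open>M' ^ m\<close>.\<close>
      define k where "k = j div M'"
      have "j < M' * k + M'"
        unfolding k_def M'_def by (metis add.commute dividend_less_times_div zero_less_Suc)
      then have "j + 1 \<le> M' * (k + 1)"
        by simp
      then have "real j + 1 \<le> real M' * (real k + 1)"
        by (metis of_nat_1 of_nat_add of_nat_le_iff of_nat_mult)
      then have "(real j + 1) ^ m \<le> (real M' * (real k + 1)) ^ m"
        by (intro power_mono) auto
      also have "\<dots> = real M' ^ m * (real k + 1) ^ m"
        by (simp add: power_mult_distrib)
      also have "\<dots> \<le> real M' ^ m * real (plaque_count (M * k) y * N * (n + 1))"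
        using le by (intro mult_left_mono) auto
      also have "\<dots> = real (M' ^ m * (N * (n + 1))) * real (plaque_count (M * k) y)"
        by (simp add: algebra_simps)
      also have "\<dots> \<le> (real (M' ^ m * (N * (n + 1))) + 1) * real (plaque_count j y)"
      proof (intro mult_mono of_nat_mono plaque_count_mono[OF yX])
        have "M * k \<le> M' * k"
          by (simp add: M'_def)
        also have "\<dots> \<le> j"
          by (simp add: k_def)
        finally show "M * k \<le> j" .
      qed auto
      finally show ?thesis
        by (simp add: divide_le_eq mult.commute add_pos_nonneg del: of_nat_mult of_nat_power)
    qed
    then have "y \<in> poly_lower m"
      unfolding poly_lower_def lower_set_def using yX by blast
    then show ?thesis
      using poly_lower_saturated sym_orbit[OF y(1)] by blast
  qed
  then show "x \<in> (\<Inter>m. poly_lower m)"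
    by blast
qed

end

theorem corollary1p9:
  fixes X :: "'a topology"
    and \<A> \<U> :: "('a,'n::finite,'z) fol_chart set"
  assumes "compact_Polish_foliated_space X \<A>"
    and "transitive_foliation X \<A>"
    and "regular_atlas X \<A> \<U>"
  shows
    "let X0d = dense_leaves_without_holonomy X \<A> \<U>;
         S = leaves_without_holonomy_with_growth X \<A> \<U>
     in (meager_in X (S polynomial_growth) \<or> residual_in X (S polynomial_growth)) \<and>
        (meager_in X (S exponential_growth) \<or> residual_in X (S exponential_growth)) \<and>
        (meager_in X (S quasi_polynomial_growth) \<or> residual_in X (S quasi_polynomial_growth)) \<and>
        (meager_in X (S quasi_exponential_growth) \<or> residual_in X (S quasi_exponential_growth)) \<and>
        (meager_in X (S pseudo_quasi_polynomial_growth) \<or>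
           residual_in X (S pseudo_quasi_polynomial_growth)) \<and>
        (residual_in X (S quasi_polynomial_growth) \<longrightarrow> X0d \<subseteq> S quasi_polynomial_growth) \<and>
        (meager_in X (S quasi_exponential_growth) \<longrightarrow> S quasi_exponential_growth \<inter> X0d = {}) \<and>
        (meager_in X (S pseudo_quasi_polynomial_growth) \<longrightarrow>
           S pseudo_quasi_polynomial_growth \<inter> X0d = {})"
proof -
  interpret transitive_regular_foliation X \<A> \<U>
    using assms by unfold_locales
  let ?QP = "\<Inter>m. exp_upper m" and ?NPQP = "\<Inter>m. poly_lower m"
  note leaves = polynomial_leaves exponential_leaves quasi_polynomial_leaves quasi_exponential_leaves
    pseudo_quasi_polynomial_leaves
  have QP: "meager_in X ?QP \<or> residual_in X ?QP"
    using exp_upper_dichotomy by (intro Inter_dichotomy) metis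
  have NPQP: "meager_in X ?NPQP \<or> residual_in X ?NPQP"
    using poly_lower_dichotomy by (intro Inter_dichotomy) metis
  have sub: "?QP \<subseteq> topspace X" "?NPQP \<subseteq> topspace X"
    by (auto simp: exp_upper_def upper_set_def poly_lower_def lower_set_def)
  have "meager_in X (growth_leaves polynomial_growth) \<or> residual_in X (growth_leaves polynomial_growth)"
    unfolding leaves using poly_upper_dichotomy by (intro dichotomy_no_holonomy) blast
  moreover have "meager_in X (growth_leaves exponential_growth) \<or> residual_in X (growth_leaves exponential_growth)"
    unfolding leaves using exp_lower_dichotomy by (intro dichotomy_no_holonomy) blast
  moreover have "meager_in X (growth_leaves quasi_polynomial_growth) \<or>
      residual_in X (growth_leaves quasi_polynomial_growth)"
    unfolding leaves using QP by (rule dichotomy_no_holonomy)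
  moreover have "meager_in X (growth_leaves quasi_exponential_growth) \<or>
      residual_in X (growth_leaves quasi_exponential_growth)"
    unfolding leaves by (intro dichotomy_no_holonomy dichotomy_complement sub QP)
  moreover have "meager_in X (growth_leaves pseudo_quasi_polynomial_growth) \<or>
      residual_in X (growth_leaves pseudo_quasi_polynomial_growth)"
    unfolding leaves by (intro dichotomy_no_holonomy dichotomy_complement sub NPQP)
  moreover have "dense_leaves \<subseteq> growth_leaves quasi_polynomial_growth"
    if "residual_in X (growth_leaves quasi_polynomial_growth)"
  proof -
    have "residual_in X ?QP"
      by (rule residual_in_mono[OF that[unfolded leaves]]) simp
    then show ?thesis
      using dense_leaves_in_exp_upper dense_leavesE(2) unfolding leaves by blast
  qed
  \<comment> \<open>If the complement is meager among points without holonomy, the intersection of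
    the sets \<open>exp_upper m\<close> is residual and so contains all dense leaves without
    holonomy.\<close>
  moreover have "growth_leaves quasi_exponential_growth \<inter> dense_leaves = {}"
    if "meager_in X (growth_leaves quasi_exponential_growth)"
    using dense_leaves_in_exp_upper[OF residual_if_meager_complement] that unfolding leaves by blast
  moreover have "growth_leaves pseudo_quasi_polynomial_growth \<inter> dense_leaves = {}"
    if "meager_in X (growth_leaves pseudo_quasi_polynomial_growth)"
    using dense_leaves_in_poly_lower[OF residual_if_meager_complement] that unfolding leaves by blast
  ultimately show ?thesis
    unfolding Let_def by blast
qed

end
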